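(* Let $\sigma\in \operatorname{S}_{2d}$, $\mathbf p_1,\mathbf p_2\in (0,\infty ]^{2d}$ and $\omega _1,\omega _2\in \mathscr P_E(\mathbf R^{2d})$ be such that $\mathbf p_1\le \mathbf p_2$ and $\omega _2\lesssim \omega _1$. Then $$ M^{\mathbf p_1}_{\sigma ,(\omega _1)}(\mathbf R^d)\subseteq M^{\mathbf p_2}_{\sigma ,(\omega _2)}(\mathbf R^d), $$ and $$ \| f\| _{M^{\mathbf p_2}_{\sigma ,(\omega _2)}}\lesssim \| f\| _{M^{\mathbf p_1}_{\sigma ,(\omega _1)}},\qquad f\in \Sigma _1'(\mathbf R^d). $$
   Context: Weights: a weight on $\mathbf R^n$ is a positive function $\omega\in L^\infty_{loc}(\mathbf R^n)$ such that for every compact $K$ there is $c>0$ with $\omega\ge c$ on $K$. $\mathscr P_E(\mathbf R^n)$ is the set of all moderate weights, i.e. weights $\omega$ satisfying $\omega(x+y)\le C\omega(x)v(y)$ for some positive $v\in L^\infty_{loc}(\mathbf R^n)$, a constant $C$ and all $x,y$. $A\lesssim B$ means $A\le cB$ for a constant $c>0$ (independent of the variables, resp. of $f$). $\mathbf p_1\le\mathbf p_2$ is understood componentwise. Mixed quasi-norms: $\operatorname{S}_{n}$ is the set of permutations of $\{1,\dots,n\}$. For measurable $F$ on $\mathbf R^{n}$, $\sigma\in \operatorname{S}_n$, $\mathbf p=(p_1,\dots,p_n)\in(0,\infty]^n$, define $g_\omega$ by $g_\omega(X_{\sigma(1)},\dots,X_{\sigma(n)})=|F(X)\omega(X)|$;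 $\|F\|_{L^{\mathbf p}_{\sigma,(\omega)}}$ is obtained by taking successively the $L^{p_1}(\mathbf R)$ quasi-norm of $g_\omega$ in its first variable, then the $L^{p_2}(\mathbf R)$ quasi-norm in its second variable, ..., the $L^{p_n}(\mathbf R)$ quasi-norm in its last variable. $L^{\mathbf p}_{\sigma,(\omega)}(\mathbf R^n)$ is the set of measurable $F$ with finite quasi-norm. Gelfand-Shilov spaces: for $s,h>0$, $\mathcal S_{s,h}(\mathbf R^d)$ is the set of $f\in C^\infty(\mathbf R^d)$ with $\sup_{\alpha,\beta,x}\frac{|x^\beta\partial^\alpha f(x)|}{h^{|\alpha|+|\beta|}(\alpha!\beta!)^{s}}<\infty$; $\mathcal S_{1/2}=\bigcup_{h>0}\mathcal S_{1/2,h}$ (inductive limit) and $\Sigma_1=\bigcap_{h>0}\mathcal S_{1,h}$ (projective limit), with duals $\mathcal S_{1/2}'$ and $\Sigma_1'$. Short-time Fourier transform: for $\phi\in\mathcal S_{1/2}(\mathbf R^d)$, $f\in\mathcal S_{1/2}'(\mathbf R^d)$, $V_\phi f(x,\xi)=\mathscr F(f\,\overline{\phi(\cdot-x)})(\xi)$, which for suitable functions is $(2\pi)^{-d/2}\int f(y)\overline{\phi(y-x)}e^{-i\langle y,\xi\rangle}dy$. Modulation spaces: fix $\phi\in\mathcal S_{1/2}(\mathbf R^d)\setminus0$. $M^{\mathbf p}_{\sigma,(\omega)}(\mathbf R^d)$ is the set of $f\in\mathcal S_{1/2}'(\mathbf R^d)$ with $\|f\|_{M^{\mathbf p}_{\sigma,(\omega)}}=\|V_\phi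 f\|_{L^{\mathbf p}_{\sigma,(\omega)}}<\infty$; the quasi-norm is $+\infty$ if $f$ is not in the space. *)

theory Defs
  imports "HOL-Analysis.Analysis"
begin

text \<open>
  The space \<open>R\<^sup>d\<close> is \<open>real ^ 'd\<close> with \<open>d = CARD('d)\<close>, and \<open>R\<^sup>2\<^sup>d\<close> is
  \<open>(real ^ 'd) \<times> (real ^ 'd)\<close>. The index type is linearly ordered, so that coordinates can be
  numbered from 1.
\<close>

definition nth_index :: "nat \<Rightarrow> 'd::{finite,linorder}" where
  "nth_index j = sorted_list_of_set (UNIV :: 'd::{finite,linorder} set) ! (j - 1)"

text \<open>Coordinates \<open>1,\<dots>,d\<close> of a phase space point are those of \<open>x\<close>, and
  \<open>d+1,\<dots>,2d\<close> are those of \<open>\<xi>\<close>.\<close>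

definition phase_basis :: "nat \<Rightarrow> (real ^ 'd::{finite,linorder}) \<times> (real ^ 'd::_)" where
  "phase_basis j =
     (if j \<le> CARD('d::{finite,linorder}) then (axis (nth_index j) 1, 0) else (0, axis (nth_index (j - CARD('d::{finite,linorder}))) 1))"

section \<open>Weights\<close>

definition Linf_loc :: "('a::euclidean_space \<Rightarrow> real) \<Rightarrow> bool" where
  "Linf_loc v \<longleftrightarrow> v \<in> borel_measurable lebesgue \<and>
     (\<forall>K. compact K \<longrightarrow> (\<exists>C. AE x in lebesgue. x \<in> K \<longrightarrow> \<bar>v x\<bar> \<le> C))"

definition weight :: "('a::euclidean_space \<Rightarrow> real) \<Rightarrow> bool" where
  "weight \<omega> \<longleftrightarrow> (\<forall>x. 0 < \<omega> x) \<and> Linf_loc \<omega> \<and>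
     (\<forall>K. compact K \<longrightarrow> (\<exists>c>0. \<forall>x\<in>K. c \<le> \<omega> x))"

definition moderate_weights :: "('a::euclidean_space \<Rightarrow> real) set" where
  "moderate_weights =
     {\<omega>. weight \<omega> \<and>
        (\<exists>v C. (\<forall>x. 0 < v x) \<and> Linf_loc v \<and> (\<forall>x y. \<omega> (x + y) \<le> C * \<omega> x * v y))}"

section \<open>Mixed quasi-norms\<close>

text \<open>Real powers in \<open>[0,\<infinity>]\<close>, intended for exponents \<open>a > 0\<close>.\<close>

definition epow :: "ennreal \<Rightarrow> real \<Rightarrow> ennreal" where
  "epow x a = (if x = \<infinity> then \<infinity> else ennreal (enn2real x powr a))"

text \<open>The case \<open>p = \<infinity>\<close> is the essential supremum.\<close>

definition Lp_qnorm :: "ennreal \<Rightarrow> (real \<Rightarrow> ennreal) \<Rightarrow> ennreal" where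
  "Lp_qnorm p g =
     (if p = \<infinity> then Limsup (ae_filter lborel) g
      else epow (\<integral>\<^sup>+ t. epow (g t) (enn2real p) \<partial>lborel) (1 / enn2real p))"

text \<open>\<open>iter_qnorm p k g\<close> takes the quasi-norms in the variables \<open>1,\<dots>,k\<close> (in this order) of a
  function of a coordinate sequence; the result no longer depends on these variables.\<close>

primrec iter_qnorm ::
  "(nat \<Rightarrow> ennreal) \<Rightarrow> nat \<Rightarrow> ((nat \<Rightarrow> real) \<Rightarrow> ennreal) \<Rightarrow> (nat \<Rightarrow> real) \<Rightarrow> ennreal" where
  "iter_qnorm p 0 g = g"
| "iter_qnorm p (Suc k) g = (\<lambda>y. Lp_qnorm (p (Suc k)) (\<lambda>t. iter_qnorm p k g (y(Suc k := t))))"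

text \<open>Here \<open>y k\<close> is the coordinate \<open>X\<^sub>\<sigma>\<^sub>(\<^sub>k\<^sub>)\<close> of \<open>X\<close>. After all \<open>2d\<close> variables are used up, the
  point \<open>\<lambda>_. 0\<close> is immaterial.\<close>

definition mixed_qnorm ::
  "(nat \<Rightarrow> nat) \<Rightarrow> (nat \<Rightarrow> ennreal) \<Rightarrow> ((real ^ 'd::{finite,linorder}) \<times> (real ^ 'd::_) \<Rightarrow> real)
    \<Rightarrow> ((real ^ 'd::_) \<times> (real ^ 'd::_) \<Rightarrow> complex) \<Rightarrow> ennreal" where
  "mixed_qnorm \<sigma> p \<omega> F =
     iter_qnorm p (2 * CARD('d::{finite,linorder}))
       (\<lambda>y. let X = (\<Sum>k = 1..2 * CARD('d::{finite,linorder}). y k *\<^sub>R phase_basis (\<sigma> k))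
             in ennreal (cmod (F X * complex_of_real (\<omega> X)))) (\<lambda>_. 0)"

section \<open>Gelfand-Shilov spaces and their duals\<close>

definition partial_deriv :: "'d \<Rightarrow> (real ^ 'd::finite \<Rightarrow> complex) \<Rightarrow> real ^ 'd::_ \<Rightarrow> complex" where
  "partial_deriv i f x = frechet_derivative f (at x) (axis i 1)"

text \<open>Total differentiability of all iterated partial derivatives amounts to \<open>C\<^sup>\<infinity>\<close>.\<close>

definition smooth :: "(real ^ 'd::finite \<Rightarrow> complex) \<Rightarrow> bool" where
  "smooth f \<longleftrightarrow> (\<forall>is. foldr partial_deriv is f differentiable_on UNIV)"

definition multi_deriv ::
  "('d \<Rightarrow> nat) \<Rightarrow> (real ^ 'd::{finite,linorder} \<Rightarrow> complex) \<Rightarrow> real ^ 'd::_ \<Rightarrow> complex" where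
  "multi_deriv \<alpha> f =
     foldr (\<lambda>i. partial_deriv i ^^ \<alpha> i) (sorted_list_of_set (UNIV :: 'd::{finite,linorder} set)) f"

definition gs_norm :: "real \<Rightarrow> real \<Rightarrow> (real ^ 'd::{finite,linorder} \<Rightarrow> complex) \<Rightarrow> ennreal" where
  "gs_norm s h f =
     (SUP (\<alpha>, \<beta>, x) \<in> UNIV.
        ennreal (cmod (complex_of_real (\<Prod>i\<in>UNIV. (x $ i) ^ \<beta> i) * multi_deriv \<alpha> f x)
          / (h ^ ((\<Sum>i\<in>UNIV. \<alpha> i) + (\<Sum>i\<in>UNIV. \<beta> i))
             * ((\<Prod>i\<in>UNIV. fact (\<alpha> i)) * (\<Prod>i\<in>UNIV. fact (\<beta> i))) powr s)))"

definition gs_step :: "real \<Rightarrow> real \<Rightarrow> (real ^ 'd::{finite,linorder} \<Rightarrow> complex) set" where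
  "gs_step s h = {f. smooth f \<and> gs_norm s h f < \<infinity>}"

definition gs_S :: "real \<Rightarrow> (real ^ 'd::{finite,linorder} \<Rightarrow> complex) set" where
  "gs_S s = (\<Union>h\<in>{0<..}. gs_step s h)"

definition gs_Sigma :: "real \<Rightarrow> (real ^ 'd::{finite,linorder} \<Rightarrow> complex) set" where
  "gs_Sigma s = (\<Inter>h\<in>{0<..}. gs_step s h)"

definition abs_convex :: "('a \<Rightarrow> complex) set \<Rightarrow> bool" where
  "abs_convex W \<longleftrightarrow>
     (\<forall>f\<in>W. \<forall>g\<in>W. \<forall>a b. cmod a + cmod b \<le> 1 \<longrightarrow> (\<lambda>x. a * f x + b * g x) \<in> W)"

text \<open>The locally convex inductive limit topology: a neighbourhood base of the origin consists
  of the absolutely convex sets that meet each step in a neighbourhood of the origin.\<close>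

definition gs_S_open :: "real \<Rightarrow> (real ^ 'd::{finite,linorder} \<Rightarrow> complex) set \<Rightarrow> bool" where
  "gs_S_open s U \<longleftrightarrow> U \<subseteq> gs_S s \<and>
     (\<forall>f\<in>U. \<exists>W \<subseteq> gs_S s. abs_convex W \<and>
        (\<forall>h>0. \<exists>\<epsilon>>0. \<forall>g\<in>gs_step s h. gs_norm s h g < ennreal \<epsilon> \<longrightarrow> g \<in> W) \<and>
        (\<forall>w\<in>W. (\<lambda>x. f x + w x) \<in> U))"

lemma istopology_gs_S_open: "istopology (gs_S_open s)"
  unfolding istopology_def
proof (intro conjI allI impI)
  fix S T :: "(real ^ 'd::{finite,linorder} \<Rightarrow> complex) set"
  assume S: "gs_S_open s S" and T: "gs_S_open s T"
  show "gs_S_open s (S \<inter> T)"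
    unfolding gs_S_open_def
  proof (intro conjI ballI)
    show "S \<inter> T \<subseteq> gs_S s" using S unfolding gs_S_open_def by blast
    fix f assume f: "f \<in> S \<inter> T"
    obtain V where V: "V \<subseteq> gs_S s" "abs_convex V"
      "\<forall>h>0. \<exists>\<epsilon>>0. \<forall>g\<in>gs_step s h. gs_norm s h g < ennreal \<epsilon> \<longrightarrow> g \<in> V"
      "\<forall>w\<in>V. (\<lambda>x. f x + w x) \<in> S"
      using S f unfolding gs_S_open_def by blast
    obtain W where W: "W \<subseteq> gs_S s" "abs_convex W"
      "\<forall>h>0. \<exists>\<epsilon>>0. \<forall>g\<in>gs_step s h. gs_norm s h g < ennreal \<epsilon> \<longrightarrow> g \<in> W"
      "\<forall>w\<in>W. (\<lambda>x. f x + w x) \<in> T"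
      using T f unfolding gs_S_open_def by blast
    have "\<exists>\<epsilon>>0. \<forall>g\<in>gs_step s h. gs_norm s h g < ennreal \<epsilon> \<longrightarrow> g \<in> V \<inter> W" if "h > 0" for h
    proof -
      obtain a b where "a > 0" "\<forall>g\<in>gs_step s h. gs_norm s h g < ennreal a \<longrightarrow> g \<in> V"
        "b > 0" "\<forall>g\<in>gs_step s h. gs_norm s h g < ennreal b \<longrightarrow> g \<in> W"
        using V(3) W(3) \<open>h > 0\<close> by blast
      then show ?thesis
        by (intro exI[of _ "min a b"])
          (metis IntI ennreal_leI less_le_trans min.cobounded1 min.cobounded2 min_less_iff_conj)
    qed
    moreover have "abs_convex (V \<inter> W)"
      using V(2) W(2) unfolding abs_convex_def by blast
    ultimately show "\<exists>W \<subseteq> gs_S s. abs_convex W \<and>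
        (\<forall>h>0. \<exists>\<epsilon>>0. \<forall>g\<in>gs_step s h. gs_norm s h g < ennreal \<epsilon> \<longrightarrow> g \<in> W) \<and>
        (\<forall>w\<in>W. (\<lambda>x. f x + w x) \<in> S \<inter> T)"
      using V(1,4) W(4) by (intro exI[of _ "V \<inter> W"]) blast
  qed
next
  fix \<K> :: "(real ^ 'd::{finite,linorder} \<Rightarrow> complex) set set"
  assume K: "\<forall>K\<in>\<K>. gs_S_open s K"
  show "gs_S_open s (\<Union>\<K>)"
    unfolding gs_S_open_def
  proof (intro conjI ballI)
    show "\<Union>\<K> \<subseteq> gs_S s" using K unfolding gs_S_open_def by blast
    fix f assume "f \<in> \<Union>\<K>"
    then obtain K where "K \<in> \<K>" "f \<in> K" by blast
    moreover then have "gs_S_open s K" using K by blast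
    ultimately obtain W where "W \<subseteq> gs_S s" "abs_convex W"
      "\<forall>h>0. \<exists>\<epsilon>>0. \<forall>g\<in>gs_step s h. gs_norm s h g < ennreal \<epsilon> \<longrightarrow> g \<in> W"
      "\<forall>w\<in>W. (\<lambda>x. f x + w x) \<in> K"
      unfolding gs_S_open_def by blast
    with \<open>K \<in> \<K>\<close> show "\<exists>W \<subseteq> gs_S s. abs_convex W \<and>
        (\<forall>h>0. \<exists>\<epsilon>>0. \<forall>g\<in>gs_step s h. gs_norm s h g < ennreal \<epsilon> \<longrightarrow> g \<in> W) \<and>
        (\<forall>w\<in>W. (\<lambda>x. f x + w x) \<in> \<Union>\<K>)"
      by (intro exI[of _ W]) blast
  qed
qed

definition gs_S_topology :: "real \<Rightarrow> (real ^ 'd::{finite,linorder} \<Rightarrow> complex) topology" where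
  "gs_S_topology s = topology (gs_S_open s)"

text \<open>The projective limit topology, generated by the balls of all the norms.\<close>

definition gs_Sigma_topology :: "real \<Rightarrow> (real ^ 'd::{finite,linorder} \<Rightarrow> complex) topology" where
  "gs_Sigma_topology s = topology_generated_by
     {{g \<in> gs_Sigma s. gs_norm s h (\<lambda>x. g x - f x) < ennreal \<epsilon>} | f h \<epsilon>.
        f \<in> gs_Sigma s \<and> 0 < h \<and> 0 < \<epsilon>}"

text \<open>Continuous complex-linear functionals on \<open>topspace T\<close> (a space of functions), normalised to
  be \<open>undefined\<close> elsewhere so that equality of functionals is equality in HOL.\<close>

definition dual_space :: "('a \<Rightarrow> complex) topology \<Rightarrow> (('a \<Rightarrow> complex) \<Rightarrow> complex) set" where
  "dual_space T =
     {u \<in> extensional (topspace T).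
        (\<forall>f\<in>topspace T. \<forall>g\<in>topspace T. \<forall>a b.
           u (\<lambda>x. a * f x + b * g x) = a * u f + b * u g) \<and>
        continuous_map T euclidean u}"

definition gs_S_dual :: "real \<Rightarrow> ((real ^ 'd::{finite,linorder} \<Rightarrow> complex) \<Rightarrow> complex) set" where
  "gs_S_dual s = dual_space (gs_S_topology s)"

definition gs_Sigma_dual :: "real \<Rightarrow> ((real ^ 'd::{finite,linorder} \<Rightarrow> complex) \<Rightarrow> complex) set" where
  "gs_Sigma_dual s = dual_space (gs_Sigma_topology s)"

section \<open>Short-time Fourier transform and modulation spaces\<close>

definition fourier :: "(real ^ 'd::finite \<Rightarrow> complex) \<Rightarrow> real ^ 'd::_ \<Rightarrow> complex" where
  "fourier \<psi> \<xi> = complex_of_real ((2 * pi) powr (- real CARD('d::finite) / 2)) *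
     (LINT y|lborel. \<psi> y * cis (- (y \<bullet> \<xi>)))"

definition dist_fourier ::
  "((real ^ 'd::finite \<Rightarrow> complex) \<Rightarrow> complex) \<Rightarrow> (real ^ 'd::_ \<Rightarrow> complex) \<Rightarrow> complex" where
  "dist_fourier u \<psi> = u (fourier \<psi>)"

definition dist_mult ::
  "((real ^ 'd::finite \<Rightarrow> complex) \<Rightarrow> complex) \<Rightarrow> (real ^ 'd::_ \<Rightarrow> complex)
    \<Rightarrow> (real ^ 'd::_ \<Rightarrow> complex) \<Rightarrow> complex" where
  "dist_mult u g \<psi> = u (\<lambda>y. g y * \<psi> y)"

text \<open>The continuous function representing a functional on \<open>S\<^sub>1\<^sub>/\<^sub>2\<close>, if there is one (it is unique,
  as translated and dilated Gaussians are test functions).\<close>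

definition dist_density ::
  "((real ^ 'd::{finite,linorder} \<Rightarrow> complex) \<Rightarrow> complex) \<Rightarrow> real ^ 'd::_ \<Rightarrow> complex" where
  "dist_density u = (THE G. continuous_on UNIV G \<and>
     (\<forall>\<psi>\<in>gs_S (1/2). integrable lborel (\<lambda>\<xi>. G \<xi> * \<psi> \<xi>) \<and> u \<psi> = (LINT \<xi>|lborel. G \<xi> * \<psi> \<xi>)))"

text \<open>The Fourier transform of \<open>f\<close> times the conjugate of \<open>\<phi>(\<cdot> - x)\<close> is taken in the sense of
  ultradistributions; it is a continuous function, which is evaluated at \<open>\<xi>\<close>.\<close>

definition stft ::
  "(real ^ 'd::{finite,linorder} \<Rightarrow> complex) \<Rightarrow> ((real ^ 'd::_ \<Rightarrow> complex) \<Rightarrow> complex)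
    \<Rightarrow> (real ^ 'd::_) \<times> (real ^ 'd::_) \<Rightarrow> complex" where
  "stft \<phi> f = (\<lambda>(x, \<xi>). dist_density (dist_fourier (dist_mult f (\<lambda>y. cnj (\<phi> (y - x))))) \<xi>)"

definition modulation_space ::
  "(real ^ 'd::{finite,linorder} \<Rightarrow> complex) \<Rightarrow> (nat \<Rightarrow> nat) \<Rightarrow> (nat \<Rightarrow> ennreal)
    \<Rightarrow> ((real ^ 'd::_) \<times> (real ^ 'd::_) \<Rightarrow> real) \<Rightarrow> ((real ^ 'd::_ \<Rightarrow> complex) \<Rightarrow> complex) set" where
  "modulation_space \<phi> \<sigma> p \<omega> = {f \<in> gs_S_dual (1/2). mixed_qnorm \<sigma> p \<omega> (stft \<phi> f) < \<infinity>}"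

definition modulation_qnorm ::
  "(real ^ 'd::{finite,linorder} \<Rightarrow> complex) \<Rightarrow> (nat \<Rightarrow> nat) \<Rightarrow> (nat \<Rightarrow> ennreal)
    \<Rightarrow> ((real ^ 'd::_) \<times> (real ^ 'd::_) \<Rightarrow> real) \<Rightarrow> ((real ^ 'd::_ \<Rightarrow> complex) \<Rightarrow> complex) \<Rightarrow> ennreal" where
  "modulation_qnorm \<phi> \<sigma> p \<omega> f =
     (if f \<in> modulation_space \<phi> \<sigma> p \<omega> then mixed_qnorm \<sigma> p \<omega> (stft \<phi> f) else \<infinity>)"

text \<open>Since \<open>S\<^sub>1\<^sub>/\<^sub>2\<close> is continuously and densely contained in \<open>\<Sigma>\<^sub>1\<close>, the dual of \<open>\<Sigma>\<^sub>1\<close> embeds into that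
  of \<open>S\<^sub>1\<^sub>/\<^sub>2\<close> by restriction.\<close>

definition to_gs_S_dual ::
  "((real ^ 'd::{finite,linorder} \<Rightarrow> complex) \<Rightarrow> complex) \<Rightarrow> (real ^ 'd::_ \<Rightarrow> complex) \<Rightarrow> complex" where
  "to_gs_S_dual f = restrict f (gs_S (1/2))"

end

theory Submission
  imports Defs "HOL-Probability.Characteristic_Functions" "HOL-Real_Asymp.Real_Asymp"
begin

text \<open>
  Write \<open>V(X) = u(\<Phi>\<^sub>X)\<close>, where \<open>\<Phi>\<^sub>X\<close> is the time-frequency shift of the conjugate window by \<open>X\<close>. Up to a
  constant \<open>V\<close> is the short-time Fourier transform of \<open>u\<close> (lemma \<open>stft_eq\<close>). For ordinary functions
  on \<open>R\<^sup>n\<close> no inclusion between \<open>L\<^sup>p\<close> spaces holds; it holds for \<open>V\<close> because \<open>V\<close> cannot have narrow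
  peaks. This is made precise by the estimate

  \<open>|V(X)|\<^sup>r \<le> A \<integral> exp(-\<gamma>|X - Z|\<^sup>2) |V(Z)|\<^sup>r dZ\<close>

  (lemma \<open>subaveraging_inequality\<close>) for every \<open>r \<in> (0,1]\<close>, with \<open>A\<close> and \<open>\<gamma>\<close> independent of \<open>u\<close>. Take
  \<open>r\<close> below all exponents in \<open>p\<^sub>1\<close>. A moderate weight grows at most exponentially, so it can be
  inserted on both sides at the price of half the Gaussian. The function \<open>G = (|V|\<omega>)\<^sup>r\<close> is then bounded
  by its convolution with a Gaussian. A Gaussian is a product over the coordinates, so the convolution
  is an iteration of convolutions in one variable, and all exponents \<open>p\<^sub>1/r\<close>, \<open>p\<^sub>2/r\<close> are at least \<open>1\<close>.
  In the variable whose quasi-norm is being taken, Young's inequality raises the exponent; in the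
  others Minkowski's inequality takes the convolution out of the quasi-norm (lemma
  \<open>iter_qnorm_convs_le\<close>). Taking the power \<open>1/r\<close> gives the bound between the mixed quasi-norms.

  The sub-averaging estimate rests on the reproducing formula, by which \<open>\<Phi>\<^sub>X\<close> is a superposition of the
  shifts \<open>\<Phi>\<^sub>Z\<close> with coefficients \<open>\<langle>\<Phi>\<^sub>X, \<Phi>\<^sub>Z\<rangle>\<close> that have Gaussian decay in \<open>X - Z\<close>. It gives the estimate for
  \<open>r = 1\<close>. For smaller \<open>r\<close> one splits \<open>|V| = |V|\<^sup>r |V|\<^bsup>1-r\<^esup>\<close> and bounds the second factor by the
  supremum of \<open>|V|\<close> against a wide Gaussian centred at the given point. The supremum is finite, since
  an ultradistribution of order \<open>1/2\<close> has \<open>|V(X)| \<le> C exp(\<epsilon>|X|\<^sup>2)\<close> for every \<open>\<epsilon> > 0\<close>, and the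
  reproducing formula bounds it by its own power \<open>1-r\<close> times the integral on the right.

  Both the reproducing formula and the identification of the short-time Fourier transform require
  that \<open>u\<close> commutes with absolutely convergent integrals of test functions (lemma
  \<open>functional_integral\<close>). To this end the steps of \<open>S\<^sub>1\<^sub>/\<^sub>2\<close> are described by the bounds
  \<open>|\<partial>\<^sup>\<alpha>f(x)| \<le> K h\<^bsup>|\<alpha>|\<^esup> (|\<alpha>|!)\<^bsup>1/2\<^esup> exp(-b|x|\<^sup>2)\<close>, and Riemann sums are shown to converge in the sense of
  such bounds.
\<close>

abbreviation gauss :: "real \<Rightarrow> 'a::real_normed_vector \<Rightarrow> real" where
  "gauss b x \<equiv> exp (- b * (norm x)\<^sup>2)"

section \<open>Factorials against Gaussians\<close>

text \<open>Only the \<open>n\<close>-th term of the exponential series of \<open>2ax\<^sup>2\<close> is kept.\<close>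

lemma power_le_sqrt_fact_exp:
  fixes x a :: real
  assumes "x \<ge> 0" "a > 0"
  shows "x ^ n \<le> (1 / sqrt (2 * a)) ^ n * sqrt (fact n) * exp (a * x\<^sup>2)"
proof -
  let ?s = "2 * a * x\<^sup>2"
  have s: "?s \<ge> 0" using assms by simp
  have "?s ^ n / fact n \<le> exp ?s"
  proof -
    have "(\<Sum>k\<in>{n}. ?s ^ k /\<^sub>R fact k) \<le> (\<Sum>k. ?s ^ k /\<^sub>R fact k)"
      by (intro sum_le_suminf sums_summable[OF exp_converges]) (use s in auto)
    thus ?thesis by (simp add: exp_def divide_inverse mult.commute)
  qed
  hence "?s ^ n \<le> fact n * exp ?s" by (simp add: field_simps)
  hence "sqrt (?s ^ n) \<le> sqrt (fact n * exp ?s)" by simp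
  also have "sqrt (fact n * exp ?s) = sqrt (fact n) * exp (a * x\<^sup>2)"
  proof -
    have "sqrt (exp ?s) = exp (a * x\<^sup>2)"
      by (intro real_sqrt_unique) (simp_all add: power2_eq_square flip: exp_add)
    thus ?thesis by (simp add: real_sqrt_mult)
  qed
  also have "sqrt (?s ^ n) = sqrt (2 * a) ^ n * x ^ n"
    using assms by (simp add: real_sqrt_power real_sqrt_mult power_mult_distrib)
  finally have "sqrt (2 * a) ^ n * x ^ n \<le> sqrt (fact n) * exp (a * x\<^sup>2)" .
  hence "(1 / sqrt (2 * a)) ^ n * (sqrt (2 * a) ^ n * x ^ n)
      \<le> (1 / sqrt (2 * a)) ^ n * (sqrt (fact n) * exp (a * x\<^sup>2))"
    using assms by (intro mult_left_mono) auto
  moreover have "(1 / sqrt (2 * a)) ^ n * (sqrt (2 * a) ^ n * x ^ n) = x ^ n"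
    using assms by (simp add: power_one_over)
  ultimately show ?thesis by (simp only: mult.assoc)
qed

text \<open>Squared, divided by \<open>2\<^sup>n h\<^bsup>2n\<^esup> n!\<close> and summed over \<open>n\<close>, the hypotheses give an exponential
  series on the left and a geometric series on the right. This is how bounds on all powers become
  Gaussian decay, both in the position and in the frequency variable.\<close>

lemma gaussian_decay_if_power_bounds:
  fixes t V W h :: real
  assumes "V \<ge> 0" "W \<ge> 0" "h > 0" and *: "\<And>n. t ^ n * V \<le> W * h ^ n * sqrt (fact n)" and "t \<ge> 0"
  shows "V \<le> sqrt 2 * W * exp (- (t\<^sup>2 / (4 * h\<^sup>2)))"
proof -
  define s where "s = t\<^sup>2 / h\<^sup>2"
  have le: "V\<^sup>2 * ((s / 2) ^ n /\<^sub>R fact n) \<le> W\<^sup>2 * (1 / 2) ^ n" for n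
  proof -
    have "(t ^ n * V)\<^sup>2 \<le> (W * h ^ n * sqrt (fact n))\<^sup>2"
      using * assms by (intro power_mono) auto
    hence "(t\<^sup>2) ^ n * V\<^sup>2 \<le> W\<^sup>2 * (h\<^sup>2) ^ n * fact n"
      by (simp add: power_mult_distrib power_mult[symmetric] mult.commute)
    hence "V\<^sup>2 * s ^ n \<le> W\<^sup>2 * fact n"
      using \<open>h > 0\<close> by (simp add: s_def power_divide field_simps)
    thus ?thesis by (simp add: power_divide field_simps)
  qed
  have s1: "(\<lambda>n. V\<^sup>2 * ((s / 2) ^ n /\<^sub>R fact n)) sums (V\<^sup>2 * exp (s / 2))"
    by (intro sums_mult exp_converges)
  have s2: "(\<lambda>n. W\<^sup>2 * (1 / 2) ^ n) sums (W\<^sup>2 * 2)"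
    using geometric_sums[of "1/2 :: real"] by (intro sums_mult) simp
  have "V\<^sup>2 * exp (s / 2) \<le> W\<^sup>2 * 2" by (rule sums_le[OF le s1 s2])
  hence "V\<^sup>2 * exp (s / 2) * exp (- (s / 2)) \<le> W\<^sup>2 * 2 * exp (- (s / 2))"
    by (intro mult_right_mono) auto
  hence "V\<^sup>2 \<le> W\<^sup>2 * 2 * exp (- (s / 2))" by (simp add: mult.assoc flip: exp_add)
  also have "exp (- (s / 2)) = (exp (- (s / 4)))\<^sup>2" by (simp add: power2_eq_square flip: exp_add)
  also have "W\<^sup>2 * 2 * (exp (- (s / 4)))\<^sup>2 = (sqrt 2 * W * exp (- (s / 4)))\<^sup>2"
    by (simp add: power_mult_distrib)
  finally have "V\<^sup>2 \<le> (sqrt 2 * W * exp (- (s / 4)))\<^sup>2" .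
  hence "V \<le> sqrt 2 * W * exp (- (s / 4))"
    by (rule power2_le_imp_le) (use assms in auto)
  thus ?thesis by (simp add: s_def field_simps)
qed

section \<open>Calculus of iterated partial derivatives\<close>

abbreviation iter_deriv :: "'d list \<Rightarrow> (real ^ 'd::finite \<Rightarrow> complex) \<Rightarrow> real ^ 'd::_ \<Rightarrow> complex" where
  "iter_deriv is f \<equiv> foldr partial_deriv is f"

lemma partial_deriv_unique:
  "(f has_derivative f') (at x) \<Longrightarrow> partial_deriv i f x = f' (axis i 1)"
  unfolding partial_deriv_def by (simp flip: frechet_derivative_at)

lemma smooth_differentiable: "smooth f \<Longrightarrow> f differentiable (at x)"
  unfolding smooth_def differentiable_on_def by (drule spec[of _ "[]"]) simp

lemma smooth_has_derivative: "smooth f \<Longrightarrow> (f has_derivative frechet_derivative f (at x)) (at x)"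
  using smooth_differentiable by (simp add: frechet_derivative_works[symmetric])

lemma smooth_partial_deriv: "smooth f \<Longrightarrow> smooth (partial_deriv i f)"
  unfolding smooth_def
proof
  fix "is" assume "\<forall>is. iter_deriv is f differentiable_on UNIV"
  hence "iter_deriv (is @ [i]) f differentiable_on UNIV" by blast
  thus "iter_deriv is (partial_deriv i f) differentiable_on UNIV" by simp
qed

lemma smooth_iter_deriv: "smooth f \<Longrightarrow> smooth (iter_deriv is f)"
  by (induct "is") (auto intro: smooth_partial_deriv)

lemma smooth_continuous: "smooth f \<Longrightarrow> continuous_on S f"
  by (intro differentiable_imp_continuous_on)
    (simp add: differentiable_on_def differentiable_at_withinI smooth_differentiable)

lemma iter_deriv_snoc: "iter_deriv (is @ [i]) f = iter_deriv is (partial_deriv i f)"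
  by simp

text \<open>Smoothness of a function is shown by exhibiting a class of differentiable functions that
  contains it and is closed under partial derivatives.\<close>

lemma smooth_coinduct:
  assumes "P f" and step: "\<And>g. P g \<Longrightarrow> g differentiable_on UNIV \<and> (\<forall>i. P (partial_deriv i g))"
  shows "smooth f"
proof -
  have "iter_deriv is g differentiable_on UNIV" if "P g" for "is" g
    using that
  proof (induct "is" arbitrary: g rule: rev_induct)
    case Nil thus ?case using step by auto
  next
    case (snoc i "is")
    thus ?case using step[OF \<open>P g\<close>] by simp
  qed
  thus ?thesis using assms(1) unfolding smooth_def by blast
qed

lemma partial_deriv_lin:
  assumes "f differentiable (at x)" "g differentiable (at x)"
  shows "partial_deriv i (\<lambda>x. a * f x + b * g x) x = a * partial_deriv i f x + b * partial_deriv i g x"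
proof -
  have f: "(f has_derivative frechet_derivative f (at x)) (at x)"
    and g: "(g has_derivative frechet_derivative g (at x)) (at x)"
    using assms by (simp_all add: frechet_derivative_works[symmetric])
  have "((\<lambda>x. a * f x + b * g x) has_derivative
     (\<lambda>v. a * frechet_derivative f (at x) v + b * frechet_derivative g (at x) v)) (at x)"
    by (intro has_derivative_add has_derivative_mult_right f g)
  from partial_deriv_unique[OF this] show ?thesis by (simp add: partial_deriv_def)
qed

lemma partial_deriv_mult:
  assumes "f differentiable (at x)" "g differentiable (at x)"
  shows "partial_deriv i (\<lambda>x. f x * g x) x = partial_deriv i f x * g x + f x * partial_deriv i g x"
proof -
  have f: "(f has_derivative frechet_derivative f (at x)) (at x)"
    and g: "(g has_derivative frechet_derivative g (at x)) (at x)"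
    using assms by (simp_all add: frechet_derivative_works[symmetric])
  from partial_deriv_unique[OF has_derivative_mult[OF f g]] show ?thesis
    by (simp add: partial_deriv_def)
qed

lemma smooth_lin:
  assumes "smooth f" "smooth g"
  shows "smooth (\<lambda>x. a * f x + b * g x)"
proof (rule smooth_coinduct[where P="\<lambda>h. \<exists>f g. smooth f \<and> smooth g \<and> h = (\<lambda>x. a * f x + b * g x)"])
  fix h assume "\<exists>f g. smooth f \<and> smooth g \<and> h = (\<lambda>x. a * f x + b * g x)"
  then obtain f g where fg: "smooth f" "smooth g" and h: "h = (\<lambda>x. a * f x + b * g x)" by blast
  have "partial_deriv i h = (\<lambda>x. a * partial_deriv i f x + b * partial_deriv i g x)" for i
    unfolding h using fg by (intro ext partial_deriv_lin smooth_differentiable)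
  moreover have "h differentiable_on UNIV"
    unfolding h differentiable_on_def
    using smooth_differentiable[OF fg(1)] smooth_differentiable[OF fg(2)]
    by (simp add: differentiable_add differentiable_mult)
  ultimately show "h differentiable_on UNIV \<and> (\<forall>i. \<exists>f g. smooth f \<and> smooth g \<and>
      partial_deriv i h = (\<lambda>x. a * f x + b * g x))"
    using fg smooth_partial_deriv by blast
qed (use assms in blast)

lemma iter_deriv_lin:
  assumes "smooth f" "smooth g"
  shows "iter_deriv is (\<lambda>x. a * f x + b * g x) = (\<lambda>x. a * iter_deriv is f x + b * iter_deriv is g x)"
proof (induct "is")
  case (Cons i "is")
  show ?case
    by (simp add: Cons fun_eq_iff partial_deriv_lin smooth_differentiable smooth_iter_deriv assms)
qed simp

lemma smooth_zero: "smooth (\<lambda>_. 0)"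
proof (rule smooth_coinduct[where P="\<lambda>h. h = (\<lambda>_. 0)"])
  fix g :: "real ^ 'a \<Rightarrow> complex" assume g: "g = (\<lambda>_. 0)"
  have "partial_deriv i g x = 0" for i x
    unfolding g by (rule partial_deriv_unique) simp
  thus "g differentiable_on UNIV \<and> (\<forall>i. partial_deriv i g = (\<lambda>_. 0))"
    by (auto simp: g)
qed simp

lemma smooth_sum: "(\<And>k. k \<in> A \<Longrightarrow> smooth (f k)) \<Longrightarrow> smooth (\<lambda>x. \<Sum>k\<in>A. f k x)"
proof (induct A rule: infinite_finite_induct)
  case (insert a A)
  thus ?case using smooth_lin[of "f a" "\<lambda>x. \<Sum>k\<in>A. f k x" 1 1] by simp
qed (simp_all add: smooth_zero)

lemma iter_deriv_zero: "iter_deriv is (\<lambda>_. 0) = (\<lambda>_. 0)"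
  using iter_deriv_lin[OF smooth_zero smooth_zero, of "is" 0 0] by simp

lemma iter_deriv_sum:
  "(\<And>k. k \<in> A \<Longrightarrow> smooth (f k)) \<Longrightarrow>
    iter_deriv is (\<lambda>x. \<Sum>k\<in>A. c k * f k x) = (\<lambda>x. \<Sum>k\<in>A. c k * iter_deriv is (f k) x)"
proof (induct A rule: infinite_finite_induct)
  case (insert a A)
  have "smooth (\<lambda>x. \<Sum>k\<in>A. c k * f k x)"
  proof (rule smooth_sum)
    fix k assume "k \<in> A"
    thus "smooth (\<lambda>x. c k * f k x)"
      using insert smooth_lin[OF _ smooth_zero, of "f k" "c k" 0] by simp
  qed
  thus ?case using insert iter_deriv_lin[of "f a" "\<lambda>x. \<Sum>k\<in>A. c k * f k x" "is" "c a" 1] by simp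
qed (simp_all add: iter_deriv_zero)

text \<open>Products are not closed under differentiation, but finite sums of products are. The induction
  runs over these sums.\<close>

lemma smooth_mult:
  assumes "smooth f" "smooth g"
  shows "smooth (\<lambda>x. f x * g x)"
proof -
  have "iter_deriv is (\<lambda>x. \<Sum>k<m. f k x * g k x) differentiable_on UNIV"
    if "\<And>k. k < m \<Longrightarrow> smooth (f k)" "\<And>k. k < m \<Longrightarrow> smooth (g k)" for "is" m and f g :: "nat \<Rightarrow> real ^ 'a \<Rightarrow> complex"
    using that
  proof (induct "is" arbitrary: f g m rule: rev_induct)
    case Nil
    show ?case unfolding differentiable_on_def
      using smooth_differentiable[OF Nil(1)] smooth_differentiable[OF Nil(2)]
      by (simp add: differentiable_sum differentiable_mult)
  next
    case (snoc i "is")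
    let ?f = "\<lambda>k. if k < m then partial_deriv i (f k) else f (k - m)"
    let ?g = "\<lambda>k. if k < m then g k else partial_deriv i (g (k - m))"
    have "partial_deriv i (\<lambda>x. \<Sum>k<m. f k x * g k x) x = (\<Sum>k<m + m. ?f k x * ?g k x)" for x
    proof -
      have "((\<lambda>x. \<Sum>k<m. f k x * g k x) has_derivative
         (\<lambda>v. \<Sum>k<m. f k x * frechet_derivative (g k) (at x) v + frechet_derivative (f k) (at x) v * g k x)) (at x)"
        by (intro has_derivative_sum has_derivative_mult smooth_has_derivative snoc) auto
      from partial_deriv_unique[OF this]
      have "partial_deriv i (\<lambda>x. \<Sum>k<m. f k x * g k x) x =
         (\<Sum>k<m. f k x * partial_deriv i (g k) x) + (\<Sum>k<m. partial_deriv i (f k) x * g k x)"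
        by (simp add: partial_deriv_def sum.distrib)
      also have "(\<Sum>k<m. partial_deriv i (f k) x * g k x) = (\<Sum>k<m. ?f k x * ?g k x)" by simp
      also have "(\<Sum>k<m. f k x * partial_deriv i (g k) x) = (\<Sum>k=m..<m + m. ?f k x * ?g k x)"
        using sum.shift_bounds_nat_ivl[of "\<lambda>k. ?f k x * ?g k x" 0 m m]
        by (simp add: lessThan_atLeast0)
      finally show ?thesis
        using sum.atLeastLessThan_concat[of 0 m "m + m" "\<lambda>k. ?f k x * ?g k x"]
        by (simp add: lessThan_atLeast0 add.commute)
    qed
    hence "partial_deriv i (\<lambda>x. \<Sum>k<m. f k x * g k x) = (\<lambda>x. \<Sum>k<m + m. ?f k x * ?g k x)" by blast
    moreover have "iter_deriv is (\<lambda>x. \<Sum>k<m + m. ?f k x * ?g k x) differentiable_on UNIV"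
      by (rule snoc(1)) (use snoc(2,3) in \<open>auto intro!: smooth_partial_deriv\<close>)
    ultimately show ?case by simp
  qed
  from this[of 1 "\<lambda>_. f" "\<lambda>_. g"] assms show ?thesis unfolding smooth_def by simp
qed

text \<open>If the bounds depend on the orders only, the Leibniz rule does not need the splittings of a
  list of directions: the binomial coefficients count them.\<close>

lemma norm_iter_deriv_mult_le:
  assumes "smooth f" "smooth g"
    and "\<And>is. cmod (iter_deriv is f x) \<le> a (length is)"
    and "\<And>is. cmod (iter_deriv is g x) \<le> b (length is)"
  shows "cmod (iter_deriv is (\<lambda>x. f x * g x) x)
    \<le> (\<Sum>k\<le>length is. real (length is choose k) * a k * b (length is - k))"
  using assms
proof (induct "is" arbitrary: f g a b rule: rev_induct)
  case Nil
  have "cmod (f x) \<le> a 0" "cmod (g x) \<le> b 0" using Nil(3)[of "[]"] Nil(4)[of "[]"] by auto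
  thus ?case by (auto simp: norm_mult intro!: mult_mono intro: order_trans[OF norm_ge_zero])
next
  case (snoc i "is")
  let ?n = "length is"
  have "partial_deriv i (\<lambda>x. f x * g x) = (\<lambda>x. 1 * (partial_deriv i f x * g x) + 1 * (f x * partial_deriv i g x))"
    using snoc by (simp add: fun_eq_iff partial_deriv_mult smooth_differentiable)
  hence "iter_deriv (is @ [i]) (\<lambda>x. f x * g x) x =
      iter_deriv is (\<lambda>x. partial_deriv i f x * g x) x + iter_deriv is (\<lambda>x. f x * partial_deriv i g x) x"
    using iter_deriv_lin[of "\<lambda>x. partial_deriv i f x * g x" "\<lambda>x. f x * partial_deriv i g x" "is" 1 1] snoc
    by (simp add: smooth_mult smooth_partial_deriv)
  also have "cmod \<dots> \<le> (\<Sum>k\<le>?n. real (?n choose k) * a (Suc k) * b (?n - k))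
      + (\<Sum>k\<le>?n. real (?n choose k) * a k * b (Suc (?n - k)))"
    using snoc(2-) snoc(4)[of "_ @ [i]"] snoc(5)[of "_ @ [i]"]
    by (intro order_trans[OF norm_triangle_ineq] add_mono snoc(1)) (auto intro: smooth_partial_deriv)
  also have "\<dots> = (\<Sum>k\<le>Suc ?n. real (Suc ?n choose k) * a k * b (Suc ?n - k))"
  proof -
    have 1: "(\<Sum>k\<le>Suc ?n. real (Suc ?n choose k) * a k * b (Suc ?n - k)) =
       a 0 * b (Suc ?n) + (\<Sum>k\<le>?n. real (Suc ?n choose Suc k) * a (Suc k) * b (?n - k))"
      by (subst sum.atMost_Suc_shift) simp
    have 2: "(\<Sum>k\<le>?n. real (Suc ?n choose Suc k) * a (Suc k) * b (?n - k)) =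
      (\<Sum>k\<le>?n. real (?n choose k) * a (Suc k) * b (?n - k)) + (\<Sum>k\<le>?n. real (?n choose Suc k) * a (Suc k) * b (?n - k))"
      by (simp add: algebra_simps sum.distrib)
    have 3: "(\<Sum>k\<le>Suc ?n. real (?n choose k) * a k * b (Suc ?n - k)) =
        a 0 * b (Suc ?n) + (\<Sum>k\<le>?n. real (?n choose Suc k) * a (Suc k) * b (?n - k))"
      by (subst sum.atMost_Suc_shift) simp
    have 4: "(\<Sum>k\<le>Suc ?n. real (?n choose k) * a k * b (Suc ?n - k))
        = (\<Sum>k\<le>?n. real (?n choose k) * a k * b (Suc (?n - k)))"
      by (simp add: Suc_diff_le)
    show ?thesis using 1 2 3 4 by linarith
  qed
  finally show ?case by simp
qed

lemma partial_deriv_translate: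
  "f differentiable (at (y - x)) \<Longrightarrow> partial_deriv i (\<lambda>y. f (y - x)) y = partial_deriv i f (y - x)"
proof -
  assume "f differentiable (at (y - x))"
  hence f: "(f has_derivative frechet_derivative f (at (y - x))) (at (y - x))"
    by (simp add: frechet_derivative_works[symmetric])
  have "((\<lambda>y. y - x) has_derivative (\<lambda>v. v)) (at y)"
    by (auto intro!: derivative_eq_intros)
  from partial_deriv_unique[OF diff_chain_at[OF this, unfolded o_def, OF f]]
  show ?thesis by (simp add: partial_deriv_def)
qed

lemma iter_deriv_translate:
  "smooth f \<Longrightarrow> iter_deriv is (\<lambda>y. f (y - x)) = (\<lambda>y. iter_deriv is f (y - x))"
proof (induct "is")
  case (Cons i "is")
  have "iter_deriv (i # is) (\<lambda>y. f (y - x)) = partial_deriv i (\<lambda>y. iter_deriv is f (y - x))"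
    using Cons by simp
  also have "\<dots> = (\<lambda>y. iter_deriv (i # is) f (y - x))"
    by (simp add: fun_eq_iff partial_deriv_translate smooth_differentiable smooth_iter_deriv Cons)
  finally show ?case .
qed simp

lemma smooth_translate:
  assumes "smooth f"
  shows "smooth (\<lambda>y. f (y - x))"
  unfolding smooth_def iter_deriv_translate[OF assms] differentiable_on_def
proof (intro allI ballI, rule differentiable_at_withinI)
  fix y and "is" :: "'a list"
  have "((\<lambda>y. y - x) has_derivative (\<lambda>v. v)) (at y)"
    by (auto intro!: derivative_eq_intros)
  from has_derivative_compose[OF this smooth_has_derivative[OF smooth_iter_deriv[OF assms]]]
  show "(\<lambda>y. iter_deriv is f (y - x)) differentiable at y"
    unfolding differentiable_def by blast
qed

lemma partial_deriv_cnj: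
  assumes "f differentiable (at y)"
  shows "partial_deriv i (\<lambda>y. cnj (f y)) y = cnj (partial_deriv i f y)"
proof -
  have "(f has_derivative frechet_derivative f (at y)) (at y)"
    using assms by (simp add: frechet_derivative_works[symmetric])
  from partial_deriv_unique[OF bounded_linear.has_derivative[OF bounded_linear_cnj this]]
  show ?thesis by (simp add: partial_deriv_def)
qed

lemma iter_deriv_cnj:
  "smooth f \<Longrightarrow> iter_deriv is (\<lambda>y. cnj (f y)) = (\<lambda>y. cnj (iter_deriv is f y))"
proof (induct "is")
  case (Cons i "is")
  have "iter_deriv (i # is) (\<lambda>y. cnj (f y)) = partial_deriv i (\<lambda>y. cnj (iter_deriv is f y))"
    using Cons by simp
  also have "\<dots> = (\<lambda>y. cnj (iter_deriv (i # is) f y))"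
    by (simp add: fun_eq_iff partial_deriv_cnj smooth_differentiable smooth_iter_deriv Cons)
  finally show ?case .
qed simp

lemma smooth_cnj:
  assumes "smooth f"
  shows "smooth (\<lambda>y. cnj (f y))"
  unfolding smooth_def iter_deriv_cnj[OF assms] differentiable_on_def
proof (intro allI ballI, rule differentiable_at_withinI)
  fix y and "is" :: "'a list"
  show "(\<lambda>y. cnj (iter_deriv is f y)) differentiable at y"
    by (rule differentiableI[OF bounded_linear.has_derivative[OF bounded_linear_cnj
      smooth_has_derivative[OF smooth_iter_deriv[OF assms]]]])
qed

lemma has_derivative_modulation:
  fixes \<xi> :: "real ^ 'd::finite"
  shows "((\<lambda>y. c * cis (- (y \<bullet> \<xi>))) has_derivative (\<lambda>v. (c * (- \<i> * complex_of_real (v \<bullet> \<xi>))) * cis (- (y \<bullet> \<xi>)))) (at y)"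
proof -
  have "((\<lambda>y. - (y \<bullet> \<xi>)) has_derivative (\<lambda>v. - (v \<bullet> \<xi>))) (at y)"
    by (intro has_derivative_minus has_derivative_inner_left has_derivative_ident)
  from has_derivative_mult_right[OF has_derivative_cis[OF this], of c] show ?thesis
    by (simp add: scaleR_conv_of_real mult_ac)
qed

lemma iter_deriv_modulation:
  fixes \<xi> :: "real ^ 'd::finite"
  shows "iter_deriv is (\<lambda>y. cis (- (y \<bullet> \<xi>))) =
    (\<lambda>y. prod_list (map (\<lambda>i. - \<i> * complex_of_real (\<xi> $ i)) is) * cis (- (y \<bullet> \<xi>)))"
proof (induct "is")
  case (Cons i "is")
  show ?case
    by (simp add: Cons fun_eq_iff partial_deriv_unique[OF has_derivative_modulation] inner_axis')
qed simp

lemma smooth_modulation: "smooth (\<lambda>y :: real ^ 'd::finite. cis (- (y \<bullet> \<xi>)))"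
  unfolding smooth_def iter_deriv_modulation differentiable_on_def
  by (intro allI ballI, rule differentiable_at_withinI, rule differentiableI[OF has_derivative_modulation])

lemma partial_deriv_along_axis:
  assumes "smooth f"
  shows "((\<lambda>s. f (z + s *\<^sub>R axis i 1)) has_vector_derivative partial_deriv i f (z + s *\<^sub>R axis i 1)) (at s within S)"
proof -
  let ?D = "frechet_derivative f (at (z + s *\<^sub>R axis i 1))"
  have f: "(f has_derivative ?D) (at (z + s *\<^sub>R axis i 1))"
    using assms by (rule smooth_has_derivative)
  have "((\<lambda>s. z + s *\<^sub>R axis i 1) has_derivative (\<lambda>v. v *\<^sub>R axis i 1)) (at s within S)"
    by (auto intro!: derivative_eq_intros)
  from has_derivative_compose[OF this f]
  have "((\<lambda>s. f (z + s *\<^sub>R axis i 1)) has_derivative (\<lambda>v. ?D (v *\<^sub>R axis i 1))) (at s within S)" .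
  thus ?thesis
    unfolding has_vector_derivative_def partial_deriv_def
    using linear_scale[OF has_derivative_linear[OF f]] by simp
qed

text \<open>Differentiate \<open>f (x + t b + s a) - f (x + t b) = \<integral>\<^bsub>[0,s]\<^esub> \<partial>\<^sub>a f (x + t b + \<tau> a) d\<tau>\<close> in \<open>t\<close> under
  the integral sign and compare the result with the fundamental theorem for \<open>\<partial>\<^sub>b f\<close>. Both are
  integrals of continuous functions over every \<open>[0,s]\<close>, so the integrands agree at \<open>0\<close>.\<close>

lemma partial_deriv_commute:
  assumes "smooth f"
  shows "partial_deriv i (partial_deriv j f) = partial_deriv j (partial_deriv i f)"
proof
  fix x
  define a b :: "real ^ 'a" where "a = axis i 1" and "b = axis j 1"
  define u where "u = partial_deriv i f"
  have u: "smooth u" "smooth (partial_deriv j f)" unfolding u_def by (intro smooth_partial_deriv assms)+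
  have ftc: "((\<lambda>\<tau>. partial_deriv i g (z + \<tau> *\<^sub>R a)) has_integral g (z + s *\<^sub>R a) - g z) {0..s}"
    if "0 \<le> s" "smooth g" for s z and g :: "real ^ 'a \<Rightarrow> complex"
    using fundamental_theorem_of_calculus[of 0 s "\<lambda>s. g (z + s *\<^sub>R a)"] partial_deriv_along_axis[OF that(2)] that(1)
    unfolding a_def by force
  have cont: "continuous_on S (\<lambda>\<tau>. g (z + \<tau> *\<^sub>R a))" if "smooth g" for g z S
    by (rule continuous_on_compose2[OF smooth_continuous[OF that, of UNIV]]) (auto intro!: continuous_intros)
  have eq: "integral {0..s} (\<lambda>\<tau>. partial_deriv i (partial_deriv j f) (x + \<tau> *\<^sub>R a))
      = integral {0..s} (\<lambda>\<tau>. partial_deriv j u (x + \<tau> *\<^sub>R a))" if "s \<in> {0..1}" for s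
  proof -
    have s: "0 \<le> s" using that by simp
    let ?U = "{-1..1 :: real}"
    have "((\<lambda>t. integral (cbox 0 s) (\<lambda>\<tau>. u (x + t *\<^sub>R b + \<tau> *\<^sub>R a))) has_vector_derivative
        integral (cbox 0 s) (\<lambda>\<tau>. partial_deriv j u (x + 0 *\<^sub>R b + \<tau> *\<^sub>R a))) (at 0 within ?U)"
    proof (rule leibniz_rule_vector_derivative)
      fix t \<tau> :: real
      show "((\<lambda>t. u (x + t *\<^sub>R b + \<tau> *\<^sub>R a)) has_vector_derivative partial_deriv j u (x + t *\<^sub>R b + \<tau> *\<^sub>R a)) (at t within ?U)"
        using partial_deriv_along_axis[OF u(1), of "x + \<tau> *\<^sub>R a" j t ?U]
        by (simp add: b_def add_ac)
      show "(\<lambda>\<tau>. u (x + t *\<^sub>R b + \<tau> *\<^sub>R a)) integrable_on cbox 0 s"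
        by (intro integrable_continuous cont u)
    next
      show "continuous_on (?U \<times> cbox 0 s) (\<lambda>(t, \<tau>). partial_deriv j u (x + t *\<^sub>R b + \<tau> *\<^sub>R a))"
        unfolding case_prod_beta
        by (rule continuous_on_compose2[OF smooth_continuous[OF smooth_partial_deriv[OF u(1)], of UNIV]])
          (auto intro!: continuous_intros)
    qed auto
    moreover have "integral (cbox 0 s) (\<lambda>\<tau>. u (x + t *\<^sub>R b + \<tau> *\<^sub>R a)) = f (x + t *\<^sub>R b + s *\<^sub>R a) - f (x + t *\<^sub>R b)" for t
      using integral_unique[OF ftc[OF s assms, of "x + t *\<^sub>R b"]] by (simp add: u_def)
    ultimately have "((\<lambda>t. f (x + t *\<^sub>R b + s *\<^sub>R a) - f (x + t *\<^sub>R b)) has_vector_derivative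
        integral {0..s} (\<lambda>\<tau>. partial_deriv j u (x + \<tau> *\<^sub>R a))) (at 0 within ?U)" by simp
    moreover have "((\<lambda>t. f (x + t *\<^sub>R b + s *\<^sub>R a) - f (x + t *\<^sub>R b)) has_vector_derivative
        partial_deriv j f (x + s *\<^sub>R a) - partial_deriv j f x) (at 0 within ?U)"
      using partial_deriv_along_axis[OF assms, of "x + s *\<^sub>R a" j 0 ?U] partial_deriv_along_axis[OF assms, of x j 0 ?U]
      by (auto intro!: has_vector_derivative_diff simp: b_def add_ac)
    ultimately have "partial_deriv j f (x + s *\<^sub>R a) - partial_deriv j f x = integral {0..s} (\<lambda>\<tau>. partial_deriv j u (x + \<tau> *\<^sub>R a))"
      using vector_derivative_unique_within_closed_interval[unfolded cbox_interval, of "-1 :: real" 1 0] by simp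
    thus ?thesis using integral_unique[OF ftc[OF s u(2), of x]] by simp
  qed
  have "((\<lambda>s. integral {0..s} (\<lambda>\<tau>. g (x + \<tau> *\<^sub>R a))) has_vector_derivative g x) (at 0 within {0..1})"
    if "smooth g" for g
    using integral_has_vector_derivative[OF cont[OF that, of "{0..1}" x], of 0] by simp
  hence 1: "((\<lambda>s. integral {0..s} (\<lambda>\<tau>. partial_deriv i (partial_deriv j f) (x + \<tau> *\<^sub>R a))) has_vector_derivative
       partial_deriv i (partial_deriv j f) x) (at 0 within {0..1})"
    and 2: "((\<lambda>s. integral {0..s} (\<lambda>\<tau>. partial_deriv j u (x + \<tau> *\<^sub>R a))) has_vector_derivative
       partial_deriv j u x) (at 0 within {0..1})"
    using u by (auto intro!: smooth_partial_deriv)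
  have 3: "((\<lambda>s. integral {0..s} (\<lambda>\<tau>. partial_deriv i (partial_deriv j f) (x + \<tau> *\<^sub>R a))) has_vector_derivative
       partial_deriv j u x) (at 0 within {0..1})"
    by (rule has_vector_derivative_transform[OF _ _ 2]) (auto simp: eq)
  thus "partial_deriv i (partial_deriv j f) x = partial_deriv j (partial_deriv i f) x"
    using vector_derivative_unique_within_closed_interval[unfolded cbox_interval, OF _ _ 1 3] by (simp add: u_def)
qed

lemma iter_deriv_move_front:
  "smooth f \<Longrightarrow> iter_deriv (js @ i # is) f = iter_deriv (i # js @ is) f"
proof (induct js)
  case (Cons j js)
  have "smooth (iter_deriv (js @ is) f)" using Cons.prems by (rule smooth_iter_deriv)
  from partial_deriv_commute[OF this, of j i] show ?case using Cons by simp
qed simp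

lemma iter_deriv_perm:
  assumes "smooth f" "mset is = mset js"
  shows "iter_deriv is f = iter_deriv js f"
  using assms(2)
proof (induct "is" arbitrary: js)
  case (Cons i "is")
  have "i \<in> set js" using Cons.prems by (metis list.set_intros(1) set_mset_mset)
  from split_list[OF this] obtain ys zs where js: "js = ys @ i # zs" by blast
  have "mset is = mset (ys @ zs)" using Cons.prems js by simp
  hence "iter_deriv (i # is) f = iter_deriv (i # ys @ zs) f"
    using Cons.hyps[of "ys @ zs"] by (simp only: foldr_Cons comp_apply)
  thus ?case using iter_deriv_move_front[OF assms(1), of ys i zs] js by (simp only:)
qed simp

section \<open>Derivative bounds and Gelfand-Shilov norms\<close>

text \<open>A bound of Gevrey order \<open>1/2\<close> in terms of the order of the derivative alone, with a majorant
  \<open>m\<close> that describes the decay. Since \<open>\<alpha>! \<le> |\<alpha>|! \<le> c\<^bsup>|\<alpha>|\<^esup> \<alpha>!\<close>, this does not change the spaces of order \<open>1/2\<close>,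
  and it makes products easy to handle.\<close>

definition deriv_bound :: "(real ^ 'd::finite \<Rightarrow> real) \<Rightarrow> real \<Rightarrow> (real ^ 'd::_ \<Rightarrow> complex) \<Rightarrow> bool" where
  "deriv_bound m h f \<longleftrightarrow> smooth f \<and>
     (\<forall>is x. cmod (iter_deriv is f x) \<le> m x * (h ^ length is * sqrt (fact (length is))))"

lemma deriv_boundD:
  assumes "deriv_bound m h f"
  shows "smooth f" "cmod (iter_deriv is f x) \<le> m x * (h ^ length is * sqrt (fact (length is)))"
    "cmod (f x) \<le> m x" "0 \<le> m x"
proof -
  show "smooth f" and 1: "cmod (iter_deriv is f x) \<le> m x * (h ^ length is * sqrt (fact (length is)))" for "is"
    using assms by (auto simp: deriv_bound_def)
  show "cmod (f x) \<le> m x" using 1[of "[]"] by simp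
  thus "0 \<le> m x" using norm_ge_zero order_trans by blast
qed

lemma deriv_bound_mono:
  assumes "deriv_bound m h f" "\<And>x. m x \<le> m' x" "0 \<le> h" "h \<le> h'"
  shows "deriv_bound m' h' f"
  unfolding deriv_bound_def
proof (intro conjI allI)
  show "smooth f" by (rule deriv_boundD(1)[OF assms(1)])
  fix "is" x
  have "cmod (iter_deriv is f x) \<le> m x * (h ^ length is * sqrt (fact (length is)))"
    by (rule deriv_boundD(2)[OF assms(1)])
  also have "\<dots> \<le> m' x * (h' ^ length is * sqrt (fact (length is)))"
    using assms deriv_boundD(4)[OF assms(1), of x]
    by (intro mult_mono power_mono) (auto intro: order_trans)
  finally show "cmod (iter_deriv is f x) \<le> m' x * (h' ^ length is * sqrt (fact (length is)))" .
qed

lemma deriv_bound_lin: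
  fixes f g :: "real ^ 'd::finite \<Rightarrow> complex"
  assumes "deriv_bound m h f" "deriv_bound m' h g"
  shows "deriv_bound (\<lambda>x. cmod a * m x + cmod b * m' x) h (\<lambda>x. a * f x + b * g x)"
  unfolding deriv_bound_def
proof (intro conjI allI)
  have sm: "smooth f" "smooth g" using assms deriv_boundD by blast+
  show "smooth (\<lambda>x. a * f x + b * g x)" by (rule smooth_lin[OF sm])
  fix "is" :: "'d list" and x
  let ?c = "h ^ length is * sqrt (fact (length is))"
  have "cmod (iter_deriv is (\<lambda>x. a * f x + b * g x) x)
      \<le> cmod a * cmod (iter_deriv is f x) + cmod b * cmod (iter_deriv is g x)"
    unfolding iter_deriv_lin[OF sm] by (metis norm_mult norm_triangle_ineq)
  also have "\<dots> \<le> cmod a * (m x * ?c) + cmod b * (m' x * ?c)"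
    by (intro add_mono mult_left_mono deriv_boundD(2)[OF assms(1)] deriv_boundD(2)[OF assms(2)]) auto
  finally show "cmod (iter_deriv is (\<lambda>x. a * f x + b * g x) x) \<le> (cmod a * m x + cmod b * m' x) * ?c"
    by (simp add: algebra_simps)
qed

lemma fact_mult_fact_le: "fact a * fact b \<le> (fact (a + b) :: real)"
proof -
  have "fact a * fact b \<le> (fact (a + b) :: nat)"
    by (rule dvd_imp_le[OF fact_fact_dvd_fact]) simp
  hence "real (fact a * fact b) \<le> real (fact (a + b))" by (rule of_nat_mono)
  thus ?thesis by simp
qed

lemma deriv_bound_mult:
  fixes f g :: "real ^ 'd::finite \<Rightarrow> complex"
  assumes f: "deriv_bound m h f" and g: "deriv_bound m' h' g" and h: "0 \<le> h" "0 \<le> h'"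
  shows "deriv_bound (\<lambda>x. m x * m' x) (h + h') (\<lambda>x. f x * g x)"
  unfolding deriv_bound_def
proof (intro conjI allI)
  show "smooth (\<lambda>x. f x * g x)" using f g deriv_boundD(1) smooth_mult by blast
  fix "is" :: "'d list" and x
  let ?n = "length is" and ?a = "\<lambda>k. m x * (h ^ k * sqrt (fact k))" and ?b = "\<lambda>k. m' x * (h' ^ k * sqrt (fact k))"
  have m: "0 \<le> m x" "0 \<le> m' x" using f g deriv_boundD(4) by blast+
  have "cmod (iter_deriv is (\<lambda>x. f x * g x) x) \<le> (\<Sum>k\<le>?n. real (?n choose k) * ?a k * ?b (?n - k))"
    by (rule norm_iter_deriv_mult_le) (intro deriv_boundD(1)[OF f] deriv_boundD(1)[OF g] deriv_boundD(2)[OF f] deriv_boundD(2)[OF g])+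
  also have "\<dots> \<le> (\<Sum>k\<le>?n. m x * m' x * sqrt (fact ?n) * (real (?n choose k) * h ^ k * h' ^ (?n - k)))"
  proof (rule sum_mono)
    fix k assume "k \<in> {..?n}"
    hence "fact k * fact (?n - k) \<le> (fact ?n :: real)"
      using fact_mult_fact_le[of k "?n - k"] by simp
    hence "sqrt (fact k) * sqrt (fact (?n - k)) \<le> sqrt (fact ?n)"
      by (simp flip: real_sqrt_mult)
    hence "(m x * m' x * (real (?n choose k) * h ^ k * h' ^ (?n - k))) * (sqrt (fact k) * sqrt (fact (?n - k)))
       \<le> (m x * m' x * (real (?n choose k) * h ^ k * h' ^ (?n - k))) * sqrt (fact ?n)"
      using m h by (intro mult_left_mono) auto
    thus "real (?n choose k) * ?a k * ?b (?n - k) \<le> m x * m' x * sqrt (fact ?n) * (real (?n choose k) * h ^ k * h' ^ (?n - k))"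
      by (simp add: mult_ac)
  qed
  also have "\<dots> = m x * m' x * ((h + h') ^ ?n * sqrt (fact ?n))"
    by (simp add: binomial_ring sum_distrib_left mult_ac)
  finally show "cmod (iter_deriv is (\<lambda>x. f x * g x) x) \<le> m x * m' x * ((h + h') ^ ?n * sqrt (fact ?n))" .
qed

lemma deriv_bound_translate:
  "deriv_bound m h f \<Longrightarrow> deriv_bound (\<lambda>y. m (y - x)) h (\<lambda>y. f (y - x))"
  unfolding deriv_bound_def by (simp add: smooth_translate iter_deriv_translate)

lemma deriv_bound_cnj: "deriv_bound m h f \<Longrightarrow> deriv_bound m h (\<lambda>y. cnj (f y))"
  unfolding deriv_bound_def by (simp add: smooth_cnj iter_deriv_cnj)

text \<open>Derivatives of a character are powers of the frequency, which a Gaussian of any rate absorbs.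
  The rate \<open>\<epsilon>\<close> is free, and smaller rates cost a larger constant in the order.\<close>

lemma deriv_bound_modulation:
  fixes \<xi> :: "real ^ 'd::finite"
  assumes "\<epsilon> > 0"
  shows "deriv_bound (\<lambda>_. exp (\<epsilon> * (norm \<xi>)\<^sup>2)) (1 / sqrt (2 * \<epsilon>)) (\<lambda>y. cis (- (y \<bullet> \<xi>)))"
  unfolding deriv_bound_def
proof (intro conjI allI)
  show "smooth (\<lambda>y. cis (- (y \<bullet> \<xi>)))" by (rule smooth_modulation)
  fix "is" and y :: "real ^ 'd"
  have "cmod (prod_list (map (\<lambda>i. - \<i> * complex_of_real (\<xi> $ i)) is)) \<le> norm \<xi> ^ length is"
    by (induct "is") (auto simp: norm_mult component_le_norm_cart intro!: mult_mono)
  hence "cmod (iter_deriv is (\<lambda>y. cis (- (y \<bullet> \<xi>))) y) \<le> norm \<xi> ^ length is"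
    by (simp add: iter_deriv_modulation norm_mult)
  also have "\<dots> \<le> (1 / sqrt (2 * \<epsilon>)) ^ length is * sqrt (fact (length is)) * exp (\<epsilon> * (norm \<xi>)\<^sup>2)"
    by (rule power_le_sqrt_fact_exp) (use assms in auto)
  finally show "cmod (iter_deriv is (\<lambda>y. cis (- (y \<bullet> \<xi>))) y)
      \<le> exp (\<epsilon> * (norm \<xi>)\<^sup>2) * ((1 / sqrt (2 * \<epsilon>)) ^ length is * sqrt (fact (length is)))"
    by (simp add: mult_ac)
qed

subsection \<open>Multi-indices and lists of directions\<close>

lemma multi_deriv_conv_iter_deriv:
  fixes f :: "real ^ 'd::{finite,linorder} \<Rightarrow> complex"
  shows "multi_deriv \<alpha> f = iter_deriv (concat (map (\<lambda>i. replicate (\<alpha> i) i) (sorted_list_of_set (UNIV :: 'd set)))) f"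
proof -
  have 1: "iter_deriv (replicate n i) g = (partial_deriv i ^^ n) g" for n i and g :: "real ^ 'd::_ \<Rightarrow> complex"
    by (induct n) simp_all
  have "foldr (\<lambda>i. partial_deriv i ^^ \<alpha> i) xs f = iter_deriv (concat (map (\<lambda>i. replicate (\<alpha> i) i) xs)) f" for xs :: "'d list"
    by (induct xs) (simp_all add: 1)
  thus ?thesis by (simp add: multi_deriv_def)
qed

lemma count_concat_replicate:
  "distinct xs \<Longrightarrow> count (mset (concat (map (\<lambda>i. replicate (\<alpha> i) i) xs))) j = (if j \<in> set xs then \<alpha> j else 0)"
  by (induct xs) auto

lemma length_concat_replicate:
  "length (concat (map (\<lambda>i. replicate (\<alpha> i) i) (sorted_list_of_set (UNIV :: 'd::{finite,linorder} set)))) = (\<Sum>i\<in>UNIV. \<alpha> i)"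
  by (simp add: length_concat o_def sum_list_distinct_conv_sum_set)

lemma iter_deriv_conv_multi_deriv:
  fixes f :: "real ^ 'd::{finite,linorder} \<Rightarrow> complex"
  assumes "smooth f"
  shows "iter_deriv is f = multi_deriv (count (mset is)) f"
  unfolding multi_deriv_conv_iter_deriv
  by (rule iter_deriv_perm[OF assms]) (simp add: multiset_eq_iff count_concat_replicate)

lemma sum_count_mset: "(\<Sum>i\<in>UNIV. count (mset is) i) = length (is :: 'd::{finite,linorder} list)"
proof (induct "is")
  case (Cons a "is")
  have "count (mset (a # is)) i = (if i = a then 1 else 0) + count (mset is) i" for i by simp
  hence "(\<Sum>i\<in>UNIV. count (mset (a # is)) i) = (\<Sum>i\<in>UNIV. if i = a then 1 else 0) + (\<Sum>i\<in>UNIV. count (mset is) i)"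
    by (simp only: sum.distrib)
  thus ?case using Cons by simp
qed simp

lemma prod_fact_le_fact_sum: "finite A \<Longrightarrow> (\<Prod>i\<in>A. fact (\<alpha> i)) \<le> (fact (\<Sum>i\<in>A. \<alpha> i) :: real)"
proof (induct A rule: finite_induct)
  case (insert a A)
  have "fact (\<alpha> a) * fact (\<Sum>i\<in>A. \<alpha> i) \<le> (fact (\<alpha> a + (\<Sum>i\<in>A. \<alpha> i)) :: real)"
    by (rule fact_mult_fact_le)
  moreover have "fact (\<alpha> a) * (\<Prod>i\<in>A. fact (\<alpha> i)) \<le> fact (\<alpha> a) * (fact (\<Sum>i\<in>A. \<alpha> i) :: real)"
    using insert by (intro mult_left_mono) auto
  ultimately show ?case unfolding prod.insert[OF insert(1,2)] sum.insert[OF insert(1,2)] by (rule order_trans[rotated])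
qed simp

lemma fact_sum_le_prod_fact:
  "finite A \<Longrightarrow> (fact (\<Sum>i\<in>A. \<alpha> i) :: real) \<le> (2 ^ card A) ^ (\<Sum>i\<in>A. \<alpha> i) * (\<Prod>i\<in>A. fact (\<alpha> i))"
proof (induct A rule: finite_induct)
  case (insert a A)
  let ?s = "\<Sum>i\<in>A. \<alpha> i" and ?P = "\<Prod>i\<in>A. fact (\<alpha> i) :: real"
  have "real ((\<alpha> a + ?s) choose \<alpha> a) \<le> 2 ^ (\<alpha> a + ?s)"
    using binomial_le_pow2[of "\<alpha> a + ?s" "\<alpha> a"] by (metis of_nat_le_iff of_nat_numeral of_nat_power)
  hence "fact (\<alpha> a + ?s) \<le> 2 ^ (\<alpha> a + ?s) * (fact (\<alpha> a) * fact ?s :: real)"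
    by (simp add: binomial_fact field_simps)
  also have "\<dots> \<le> 2 ^ (\<alpha> a + ?s) * (fact (\<alpha> a) * ((2 ^ card A) ^ ?s * ?P))"
    using insert by (intro mult_left_mono) auto
  also have "\<dots> \<le> 2 ^ (\<alpha> a + ?s) * (fact (\<alpha> a) * ((2 ^ card A) ^ (\<alpha> a + ?s) * ?P))"
    by (intro mult_left_mono mult_right_mono power_increasing) (auto intro: prod_nonneg)
  finally show ?case using insert by (simp add: power_mult_distrib mult_ac)
qed simp

lemma sqrt_prod: "finite A \<Longrightarrow> sqrt (\<Prod>i\<in>A. f i) = (\<Prod>i\<in>A. sqrt (f i))"
  by (induct A rule: finite_induct) (simp_all add: real_sqrt_mult)

lemma norm_sq_le_max_component:
  fixes x :: "real ^ 'd::finite"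
  shows "\<exists>i. (norm x)\<^sup>2 \<le> real CARD('d) * (x $ i)\<^sup>2"
proof -
  obtain i where i: "\<And>j. (x $ j)\<^sup>2 \<le> (x $ i)\<^sup>2"
  proof -
    have "Max (range (\<lambda>j. (x $ j)\<^sup>2)) \<in> range (\<lambda>j. (x $ j)\<^sup>2)" by (rule Max_in) auto
    then obtain i where "Max (range (\<lambda>j. (x $ j)\<^sup>2)) = (x $ i)\<^sup>2" by (rule rangeE)
    thus ?thesis using that[of i] Max_ge[of "range (\<lambda>j. (x $ j)\<^sup>2)"] by simp
  qed
  have "(norm x)\<^sup>2 = (\<Sum>j\<in>UNIV. (x $ j)\<^sup>2)"
    unfolding power2_norm_eq_inner inner_vec_def by (simp add: power2_eq_square)
  also have "\<dots> \<le> of_nat (card (UNIV :: 'd set)) * (x $ i)\<^sup>2"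
    by (rule sum_bounded_above) (use i in auto)
  finally show ?thesis by blast
qed

text \<open>The powers of one coordinate are enough: applied to the largest coordinate of \<open>x\<close> they give
  decay in \<open>|x|\<close>, with a rate divided by the dimension.\<close>

lemma gs_S_imp_deriv_bound:
  fixes f :: "real ^ 'd::{finite,linorder} \<Rightarrow> complex"
  assumes "f \<in> gs_S (1/2)"
  obtains K h b where "0 \<le> K" "0 < h" "0 < b" "deriv_bound (\<lambda>x. K * gauss b x) h f"
proof -
  obtain h where h: "h > 0" and sm: "smooth f" and fin: "gs_norm (1/2) h f < \<infinity>"
    using assms unfolding gs_S_def gs_step_def by auto
  define M where "M = enn2real (gs_norm (1/2) h f)"
  have M: "M \<ge> 0" "ennreal M = gs_norm (1/2) h f"
    using fin by (simp_all add: M_def)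
  have bnd: "cmod (complex_of_real (\<Prod>i\<in>UNIV. (x $ i) ^ \<beta> i) * multi_deriv \<alpha> f x)
          / (h ^ ((\<Sum>i\<in>UNIV. \<alpha> i) + (\<Sum>i\<in>UNIV. \<beta> i))
             * ((\<Prod>i\<in>UNIV. fact (\<alpha> i)) * (\<Prod>i\<in>UNIV. fact (\<beta> i))) powr (1/2)) \<le> M" for \<alpha> \<beta> x
  proof -
    have "ennreal (cmod (complex_of_real (\<Prod>i\<in>UNIV. (x $ i) ^ \<beta> i) * multi_deriv \<alpha> f x)
          / (h ^ ((\<Sum>i\<in>UNIV. \<alpha> i) + (\<Sum>i\<in>UNIV. \<beta> i))
             * ((\<Prod>i\<in>UNIV. fact (\<alpha> i)) * (\<Prod>i\<in>UNIV. fact (\<beta> i))) powr (1/2))) \<le> ennreal M"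
      unfolding M(2) gs_norm_def by (rule SUP_upper2[of "(\<alpha>, \<beta>, x)"]) auto
    thus ?thesis using M(1) by simp
  qed
  have pure: "\<bar>x $ i\<bar> ^ k * cmod (iter_deriv is f x) \<le> M * (h ^ length is * sqrt (fact (length is))) * h ^ k * sqrt (fact k)" for x i k "is"
  proof -
    define \<beta> where "\<beta> = (\<lambda>j. if j = i then k else 0)"
    define P where "P = (\<Prod>i\<in>UNIV. fact (count (mset is) i) :: real)"
    have P: "0 < P" "P \<le> fact (length is)"
      using prod_fact_le_fact_sum[of UNIV "count (mset is)"] by (auto simp: P_def sum_count_mset intro!: prod_pos)
    have 1: "(\<Prod>j\<in>UNIV. (x $ j) ^ \<beta> j) = (x $ i) ^ k"
      by (subst prod.remove[of _ i]) (auto simp: \<beta>_def intro!: prod.neutral)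
    have 2: "(\<Prod>j\<in>UNIV. fact (\<beta> j)) = (fact k :: real)"
      by (subst prod.remove[of _ i]) (auto simp: \<beta>_def intro!: prod.neutral)
    have 3: "(\<Sum>j\<in>UNIV. \<beta> j) = k" by (simp add: \<beta>_def)
    have "cmod (complex_of_real ((x $ i) ^ k) * iter_deriv is f x) / (h ^ (length is + k) * (P * fact k) powr (1/2)) \<le> M"
      using bnd[where \<alpha> = "count (mset is)" and \<beta> = \<beta> and x = x]
      unfolding 1 2 3 sum_count_mset P_def iter_deriv_conv_multi_deriv[OF sm, of "is", symmetric] .
    hence "\<bar>x $ i\<bar> ^ k * cmod (iter_deriv is f x) \<le> M * (h ^ (length is + k) * (P * fact k) powr (1/2))"
      using h P by (simp add: pos_divide_le_eq norm_mult norm_power)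
    also have "(P * fact k) powr (1/2) = sqrt P * sqrt (fact k)"
      using P by (simp add: powr_half_sqrt real_sqrt_mult)
    also have "M * (h ^ (length is + k) * (sqrt P * sqrt (fact k))) \<le> M * (h ^ (length is + k) * (sqrt (fact (length is)) * sqrt (fact k)))"
      using P M h by (intro mult_left_mono mult_right_mono) auto
    finally show ?thesis by (simp add: power_add mult_ac)
  qed
  let ?b = "1 / (4 * real CARD('d) * h\<^sup>2)"
  have "deriv_bound (\<lambda>x. sqrt 2 * M * gauss ?b x) h f"
    unfolding deriv_bound_def
  proof (intro conjI allI)
    fix "is" :: "'d list" and x :: "real ^ 'd::_"
    obtain i where i: "(norm x)\<^sup>2 \<le> real CARD('d) * (x $ i)\<^sup>2" using norm_sq_le_max_component by blast
    let ?c = "h ^ length is * sqrt (fact (length is))"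
    have "cmod (iter_deriv is f x) \<le> sqrt 2 * (M * ?c) * exp (- (\<bar>x $ i\<bar>\<^sup>2 / (4 * h\<^sup>2)))"
      by (rule gaussian_decay_if_power_bounds) (use pure M h in auto)
    also have "\<dots> \<le> sqrt 2 * (M * ?c) * gauss ?b x"
      using i h M by (intro mult_left_mono) (auto simp: field_simps)
    finally show "cmod (iter_deriv is f x) \<le> sqrt 2 * M * gauss ?b x * ?c"
      by (simp add: mult_ac)
  qed (rule sm)
  thus ?thesis using that[of "sqrt 2 * M" h ?b] M h by simp
qed

text \<open>A step of \<open>S\<^sub>1\<^sub>/\<^sub>2\<close> that contains all functions with the given rates, and in which the
  constant in the bound controls the norm.\<close>

definition step_of_rates :: "'d::finite itself \<Rightarrow> real \<Rightarrow> real \<Rightarrow> real" where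
  "step_of_rates d h b = h * 2 ^ CARD('d) + 1 / sqrt (2 * b)"

text \<open>The Gaussian absorbs all powers of the coordinates, and the multinomial coefficient
  \<open>|\<alpha>|!/\<alpha>!\<close> is absorbed into the step.\<close>

lemma deriv_bound_imp_gs_step:
  fixes f :: "real ^ 'd::{finite,linorder} \<Rightarrow> complex"
  assumes f: "deriv_bound (\<lambda>x. K * gauss b x) h f" and "0 \<le> h" "0 < b"
  defines "H \<equiv> step_of_rates TYPE('d) h b"
  shows "0 < H" "gs_norm (1/2) H f \<le> ennreal K" "f \<in> gs_step (1/2) H"
proof -
  have H: "h * 2 ^ CARD('d) \<le> H" "1 / sqrt (2 * b) \<le> H" "H > 0"
    using assms by (auto simp: H_def step_of_rates_def add_nonneg_pos)
  show "0 < H" by fact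
  have K: "K \<ge> 0" using deriv_boundD(4)[OF f, of 0] by simp
  have "cmod (complex_of_real (\<Prod>i\<in>UNIV. (x $ i) ^ \<beta> i) * multi_deriv \<alpha> f x)
      / (H ^ ((\<Sum>i\<in>UNIV. \<alpha> i) + (\<Sum>i\<in>UNIV. \<beta> i)) * ((\<Prod>i\<in>UNIV. fact (\<alpha> i)) * (\<Prod>i\<in>UNIV. fact (\<beta> i))) powr (1/2)) \<le> K" for \<alpha> \<beta> x
  proof -
    define n m where "n = (\<Sum>i\<in>UNIV. \<alpha> i)" and "m = (\<Sum>i\<in>UNIV. \<beta> i)"
    define P Q where "P = (\<Prod>i\<in>UNIV. fact (\<alpha> i) :: real)" and "Q = (\<Prod>i\<in>UNIV. fact (\<beta> i) :: real)"
    have PQ: "P > 0" "Q > 0" by (auto simp: P_def Q_def intro!: prod_pos)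
    have "cmod (multi_deriv \<alpha> f x) \<le> K * gauss b x * (h ^ n * sqrt (fact n))"
      using deriv_boundD(2)[OF f, of "concat (map (\<lambda>i. replicate (\<alpha> i) i) (sorted_list_of_set UNIV))" x]
      unfolding multi_deriv_conv_iter_deriv n_def length_concat_replicate .
    also have "\<dots> \<le> K * gauss b x * (H ^ n * sqrt P)"
    proof -
      have "sqrt (fact n) \<le> sqrt ((2 ^ CARD('d)) ^ n * P)"
        unfolding n_def P_def using fact_sum_le_prod_fact[of UNIV \<alpha>] by simp
      also have "\<dots> \<le> (2 ^ CARD('d)) ^ n * sqrt P"
      proof -
        have "sqrt ((2 ^ CARD('d)) ^ n) \<le> (2 ^ CARD('d)) ^ n"
          by (rule real_le_lsqrt) (auto intro!: self_le_power one_le_power)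
        thus ?thesis unfolding real_sqrt_mult using PQ by (intro mult_right_mono) auto
      qed
      finally have "h ^ n * sqrt (fact n) \<le> h ^ n * ((2 ^ CARD('d)) ^ n * sqrt P)"
        using assms by (intro mult_left_mono) auto
      also have "\<dots> = (h * 2 ^ CARD('d)) ^ n * sqrt P" by (simp only: power_mult_distrib mult.assoc)
      also have "\<dots> \<le> H ^ n * sqrt P" using H PQ assms by (intro mult_right_mono power_mono) auto
      finally show ?thesis using K by (intro mult_left_mono) auto
    qed
    finally have 1: "cmod (multi_deriv \<alpha> f x) \<le> K * gauss b x * (H ^ n * sqrt P)" .
    have "\<bar>\<Prod>i\<in>UNIV. (x $ i) ^ \<beta> i\<bar> = (\<Prod>i\<in>UNIV. \<bar>x $ i\<bar> ^ \<beta> i)" by (simp add: abs_prod power_abs)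
    also have "\<dots> \<le> (\<Prod>i\<in>UNIV. (1 / sqrt (2 * b)) ^ \<beta> i * sqrt (fact (\<beta> i)) * exp (b * (x $ i)\<^sup>2))"
    proof (intro prod_mono conjI)
      fix i :: 'd show "\<bar>x $ i\<bar> ^ \<beta> i \<le> (1 / sqrt (2 * b)) ^ \<beta> i * sqrt (fact (\<beta> i)) * exp (b * (x $ i)\<^sup>2)"
        using power_le_sqrt_fact_exp[of "\<bar>x $ i\<bar>" b "\<beta> i"] assms by simp
    qed auto
    also have "\<dots> = (1 / sqrt (2 * b)) ^ m * sqrt Q * exp (b * (norm x)\<^sup>2)"
    proof -
      have "(norm x)\<^sup>2 = (\<Sum>j\<in>UNIV. (x $ j)\<^sup>2)"
        unfolding power2_norm_eq_inner inner_vec_def by (simp add: power2_eq_square)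
      moreover have "sqrt Q = (\<Prod>i\<in>UNIV. sqrt (fact (\<beta> i)))"
        unfolding Q_def by (rule sqrt_prod) simp
      ultimately show ?thesis by (simp only: prod.distrib m_def power_sum exp_sum sum_distrib_left finite)
    qed
    also have "\<dots> \<le> H ^ m * sqrt Q * exp (b * (norm x)\<^sup>2)"
      using H PQ assms by (intro mult_right_mono power_mono) auto
    finally have 2: "\<bar>\<Prod>i\<in>UNIV. (x $ i) ^ \<beta> i\<bar> \<le> H ^ m * sqrt Q * exp (b * (norm x)\<^sup>2)" .
    have "cmod (complex_of_real (\<Prod>i\<in>UNIV. (x $ i) ^ \<beta> i) * multi_deriv \<alpha> f x)
       \<le> (H ^ m * sqrt Q * exp (b * (norm x)\<^sup>2)) * (K * gauss b x * (H ^ n * sqrt P))"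
      unfolding norm_mult norm_of_real using H(3) PQ by (intro mult_mono 1 2) auto
    also have "\<dots> = K * (H ^ (n + m) * (sqrt P * sqrt Q)) * (exp (b * (norm x)\<^sup>2) * gauss b x)"
      by (simp only: power_add mult_ac)
    also have "\<dots> = K * (H ^ (n + m) * (P * Q) powr (1/2))"
      using PQ by (simp add: powr_half_sqrt real_sqrt_mult flip: exp_add)
    finally show ?thesis using H(3) PQ unfolding n_def[symmetric] m_def[symmetric] P_def[symmetric] Q_def[symmetric]
      by (simp add: pos_divide_le_eq)
  qed
  thus *: "gs_norm (1/2) H f \<le> ennreal K"
    unfolding gs_norm_def by (intro SUP_least) (auto intro: ennreal_leI)
  show "f \<in> gs_step (1/2) H"
    unfolding gs_step_def using le_less_trans[OF *] deriv_boundD(1)[OF f] by simp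
qed

lemma deriv_bound_imp_gs_S:
  assumes "deriv_bound (\<lambda>x. K * gauss b x) h f" "0 \<le> h" "0 < b"
  shows "f \<in> gs_S (1/2)"
  using deriv_bound_imp_gs_step[OF assms] unfolding gs_S_def by blast

section \<open>Continuity of ultradistributions and integrals of test functions\<close>

lemma gs_S_lin:
  fixes f g :: "real ^ 'd::{finite,linorder} \<Rightarrow> complex"
  assumes "f \<in> gs_S (1/2)" "g \<in> gs_S (1/2)"
  shows "(\<lambda>x. a * f x + b * g x) \<in> gs_S (1/2)"
proof -
  obtain K h r where f: "0 \<le> K" "0 < h" "0 < r" "deriv_bound (\<lambda>x. K * gauss r x) h f"
    using gs_S_imp_deriv_bound[OF assms(1)] by blast
  obtain K' h' r' where g: "0 \<le> K'" "0 < h'" "0 < r'" "deriv_bound (\<lambda>x. K' * gauss r' x) h' g"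
    using gs_S_imp_deriv_bound[OF assms(2)] by blast
  let ?h = "max h h'" and ?r = "min r r'"
  have "deriv_bound (\<lambda>x. K * gauss ?r x) ?h f"
    by (rule deriv_bound_mono[OF f(4)]) (use f in \<open>auto intro!: mult_left_mono mult_right_mono\<close>)
  moreover have "deriv_bound (\<lambda>x. K' * gauss ?r x) ?h g"
    by (rule deriv_bound_mono[OF g(4)]) (use g in \<open>auto intro!: mult_left_mono mult_right_mono\<close>)
  ultimately have "deriv_bound (\<lambda>x. cmod a * (K * gauss ?r x) + cmod b * (K' * gauss ?r x)) ?h (\<lambda>x. a * f x + b * g x)"
    by (rule deriv_bound_lin)
  hence "deriv_bound (\<lambda>x. (cmod a * K + cmod b * K') * gauss ?r x) ?h (\<lambda>x. a * f x + b * g x)"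
    by (simp add: algebra_simps)
  thus ?thesis by (rule deriv_bound_imp_gs_S) (use f g in auto)
qed

lemma gs_S_zero: "(\<lambda>_. 0) \<in> gs_S (1/2)"
  by (rule deriv_bound_imp_gs_S[of 0 1 1]) (auto simp: deriv_bound_def smooth_zero iter_deriv_zero)

lemma openin_gs_S_topology: "openin (gs_S_topology s) = gs_S_open s"
  unfolding gs_S_topology_def using istopology_gs_S_open by (rule topology_inverse')

lemma topspace_gs_S_topology:
  "topspace (gs_S_topology (1/2)) = (gs_S (1/2) :: (real ^ 'd::{finite,linorder} \<Rightarrow> complex) set)"
proof -
  have "gs_S_open (1/2) (gs_S (1/2) :: (real ^ 'd::_ \<Rightarrow> complex) set)"
    unfolding gs_S_open_def
  proof (intro conjI ballI exI[of _ "gs_S (1/2) :: (real ^ 'd::_ \<Rightarrow> complex) set"])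
    show "abs_convex (gs_S (1/2) :: (real ^ 'd::_ \<Rightarrow> complex) set)"
      unfolding abs_convex_def using gs_S_lin by blast
    show "\<forall>h>0. \<exists>\<epsilon>>0. \<forall>g\<in>gs_step (1/2) h. gs_norm (1/2) h g < ennreal \<epsilon> \<longrightarrow> g \<in> (gs_S (1/2) :: (real ^ 'd::_ \<Rightarrow> complex) set)"
      unfolding gs_S_def by (auto intro: exI[of _ 1])
    fix f w :: "real ^ 'd::_ \<Rightarrow> complex" assume "f \<in> gs_S (1/2)" "w \<in> gs_S (1/2)"
    thus "(\<lambda>x. f x + w x) \<in> gs_S (1/2)" using gs_S_lin[of f w 1 1] by simp
  qed auto
  hence "openin (gs_S_topology (1/2)) (gs_S (1/2) :: (real ^ 'd::_ \<Rightarrow> complex) set)" by (simp add: openin_gs_S_topology)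
  moreover have "topspace (gs_S_topology (1/2)) \<subseteq> (gs_S (1/2) :: (real ^ 'd::_ \<Rightarrow> complex) set)"
    unfolding topspace_def openin_gs_S_topology by (auto simp: gs_S_open_def)
  ultimately show ?thesis using openin_subset by blast
qed

lemma gs_S_dual_lin:
  assumes "u \<in> gs_S_dual (1/2)" "f \<in> gs_S (1/2)" "g \<in> gs_S (1/2)"
  shows "u (\<lambda>x. a * f x + b * g x) = a * u f + b * u g"
  using assms by (simp add: gs_S_dual_def dual_space_def topspace_gs_S_topology)

lemma gs_S_dual_zero: "u \<in> gs_S_dual (1/2) \<Longrightarrow> u (\<lambda>_. 0) = 0"
  using gs_S_dual_lin[OF _ gs_S_zero gs_S_zero, of u 0 0] by simp

text \<open>A neighbourhood of the origin for the inductive limit topology contains a ball of every step,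
  so a continuous functional is bounded on each step.\<close>

lemma gs_S_dual_bound:
  fixes u :: "(real ^ 'd::{finite,linorder} \<Rightarrow> complex) \<Rightarrow> complex"
  assumes u: "u \<in> gs_S_dual (1/2)" and "0 \<le> h" "0 < b"
  obtains C where "C > 0" "\<And>K f. deriv_bound (\<lambda>x. K * gauss b x) h f \<Longrightarrow> cmod (u f) \<le> C * K"
proof -
  define U where "U = {f \<in> topspace (gs_S_topology (1/2)). u f \<in> ball 0 1}"
  have "openin (gs_S_topology (1/2)) U"
    unfolding U_def using u
    by (intro openin_continuous_map_preimage[of _ euclidean]) (auto simp: gs_S_dual_def dual_space_def)
  moreover have "(\<lambda>_. 0) \<in> U"
    by (simp add: U_def gs_S_dual_zero[OF u] topspace_gs_S_topology gs_S_zero)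
  ultimately obtain W where W: "\<And>h. h > 0 \<Longrightarrow> \<exists>\<epsilon>>0. \<forall>g\<in>gs_step (1/2) h. gs_norm (1/2) h g < ennreal \<epsilon> \<longrightarrow> g \<in> W"
      "\<forall>w\<in>W. (\<lambda>x. 0 + w x) \<in> U"
    unfolding openin_gs_S_topology gs_S_open_def by (elim conjE ballE[of _ _ "\<lambda>_. 0"]) auto
  define H where "H = step_of_rates TYPE('d) h b"
  have "H > 0" unfolding H_def step_of_rates_def using assms by (auto simp: add_nonneg_pos)
  then obtain \<epsilon> where e: "\<epsilon> > 0" "\<And>g. g \<in> gs_step (1/2) H \<Longrightarrow> gs_norm (1/2) H g < ennreal \<epsilon> \<Longrightarrow> g \<in> W"
    using W(1) by blast
  have "cmod (u f) \<le> 2 / \<epsilon> * K" if f: "deriv_bound (\<lambda>x. K * gauss b x) h f" for K f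
  proof (rule field_le_epsilon)
    fix \<delta> :: real assume "\<delta> > 0"
    \<comment> \<open>The constant \<open>K\<close> may vanish, so it is enlarged before \<open>f\<close> is scaled into the ball.\<close>
    define K' where "K' = K + \<delta> * \<epsilon> / 2"
    have K: "K \<ge> 0" using deriv_boundD(4)[OF f, of 0] by simp
    hence K': "K' > 0" "K \<le> K'" using \<open>\<delta> > 0\<close> e by (auto simp: K'_def add_nonneg_pos)
    define c where "c = \<epsilon> / (2 * K')"
    have c: "c > 0" using e K' by (simp add: c_def)
    have fS: "f \<in> gs_S (1/2)" by (rule deriv_bound_imp_gs_S[OF f assms(2,3)])
    have "deriv_bound (\<lambda>x. (c * K') * gauss b x) h (\<lambda>x. complex_of_real c * f x)"
    proof (rule deriv_bound_mono[of "\<lambda>x. cmod (complex_of_real c) * (K * gauss b x) + cmod 0 * (K * gauss b x)" h])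
      show "deriv_bound (\<lambda>x. cmod (complex_of_real c) * (K * gauss b x) + cmod 0 * (K * gauss b x)) h (\<lambda>x. complex_of_real c * f x)"
        using deriv_bound_lin[OF f f, of "complex_of_real c" 0] by simp
    qed (use c K' assms in auto)
    from deriv_bound_imp_gs_step[OF this assms(2,3)]
    have "gs_norm (1/2) H (\<lambda>x. complex_of_real c * f x) \<le> ennreal (c * K')" "(\<lambda>x. complex_of_real c * f x) \<in> gs_step (1/2) H"
      by (simp_all add: H_def)
    moreover have "ennreal (c * K') < ennreal \<epsilon>" using K' e by (intro ennreal_lessI) (auto simp: c_def)
    ultimately have "(\<lambda>x. complex_of_real c * f x) \<in> W" using e(2) by (meson le_less_trans)
    hence "cmod (u (\<lambda>x. complex_of_real c * f x)) < 1" using W(2) unfolding U_def by auto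
    moreover have "u (\<lambda>x. complex_of_real c * f x) = complex_of_real c * u f"
      using gs_S_dual_lin[OF u fS fS, of "complex_of_real c" 0] by simp
    ultimately have "c * cmod (u f) < 1" using c by (simp add: norm_mult)
    hence "cmod (u f) < 2 * K' / \<epsilon>" using c K' e by (simp add: c_def field_simps)
    also have "2 * K' / \<epsilon> = 2 / \<epsilon> * K + \<delta>" using e by (simp add: K'_def field_simps)
    finally show "cmod (u f) \<le> 2 / \<epsilon> * K + \<delta>" by simp
  qed
  thus ?thesis using that[of "2 / \<epsilon>"] e by simp
qed

lemma gs_S_dual_sum:
  assumes u: "u \<in> gs_S_dual (1/2)" and "finite A" "\<And>k. k \<in> A \<Longrightarrow> f k \<in> gs_S (1/2)"
  shows "(\<lambda>x. \<Sum>k\<in>A. c k * f k x) \<in> gs_S (1/2) \<and> u (\<lambda>x. \<Sum>k\<in>A. c k * f k x) = (\<Sum>k\<in>A. c k * u (f k))"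
  using assms(2,3)
proof (induct A rule: finite_induct)
  case empty
  show ?case using gs_S_zero gs_S_dual_zero[OF u] by simp
next
  case (insert a A)
  have 1: "(\<lambda>x. \<Sum>k\<in>insert a A. c k * f k x) = (\<lambda>x. c a * f a x + 1 * (\<Sum>k\<in>A. c k * f k x))"
    using insert by simp
  have f: "f a \<in> gs_S (1/2)" "(\<lambda>x. \<Sum>k\<in>A. c k * f k x) \<in> gs_S (1/2)" using insert by auto
  show ?case unfolding 1 using gs_S_lin[OF f, of "c a" 1] gs_S_dual_lin[OF u f, of "c a" 1] insert by simp
qed

subsection \<open>Differentiation under the integral sign\<close>

lemma frechet_derivative_eq_sum_partial_deriv:
  assumes "smooth f"
  shows "frechet_derivative f (at y) v = (\<Sum>i\<in>UNIV. complex_of_real (v $ i) * partial_deriv i f y)"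
proof -
  have lin: "linear (frechet_derivative f (at y))"
    by (rule has_derivative_linear[OF smooth_has_derivative[OF assms]])
  have "v = (\<Sum>i\<in>UNIV. (v $ i) *\<^sub>R axis i 1)" using basis_expansion[of v] by (simp add: scalar_mult_eq_scaleR)
  hence "frechet_derivative f (at y) v = frechet_derivative f (at y) (\<Sum>i\<in>UNIV. (v $ i) *\<^sub>R axis i 1)" by simp
  also have "\<dots> = (\<Sum>i\<in>UNIV. (v $ i) *\<^sub>R frechet_derivative f (at y) (axis i 1))"
    by (simp add: linear_sum[OF lin] linear_scale[OF lin])
  finally show ?thesis by (simp add: partial_deriv_def scaleR_conv_of_real)
qed

lemma norm_frechet_derivative_le:
  fixes f :: "real ^ 'd::finite \<Rightarrow> complex"
  assumes "smooth f" "\<And>i. cmod (partial_deriv i f y) \<le> k"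
  shows "cmod (frechet_derivative f (at y) v) \<le> real CARD('d) * k * norm v"
proof -
  have "cmod (frechet_derivative f (at y) v) \<le> (\<Sum>i\<in>UNIV. cmod (complex_of_real (v $ i) * partial_deriv i f y))"
    unfolding frechet_derivative_eq_sum_partial_deriv[OF assms(1)] by (rule norm_sum)
  also have "\<dots> \<le> (\<Sum>i\<in>(UNIV :: 'd set). norm v * k)"
    using assms(2) component_le_norm_cart[of v] by (intro sum_mono) (auto simp: norm_mult intro!: mult_mono)
  finally show ?thesis by (simp add: mult_ac)
qed

text \<open>The mean value inequality bounds the difference quotients by \<open>2k\<close>, so dominated convergence
  applies to their error terms. Bounds are needed on a neighbourhood only, which allows translates of
  a fixed function.\<close>

lemma has_derivative_integral_dominated:
  fixes F :: "'z \<Rightarrow> 'a::euclidean_space \<Rightarrow> complex"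
  assumes int: "\<And>y. y \<in> ball y0 1 \<Longrightarrow> integrable M (\<lambda>z. F z y)"
    and der: "\<And>z y. y \<in> ball y0 1 \<Longrightarrow> (F z has_derivative F' z y) (at y)"
    and bnd: "\<And>z y v. y \<in> ball y0 1 \<Longrightarrow> cmod (F' z y v) \<le> k z * norm v"
    and meas: "\<And>v. (\<lambda>z. F' z y0 v) \<in> borel_measurable M"
    and k: "integrable M k" "\<And>z. 0 \<le> k z"
  shows "((\<lambda>y. LINT z|M. F z y) has_derivative (\<lambda>v. LINT z|M. F' z y0 v)) (at y0)"
proof -
  have y0: "y0 \<in> ball y0 1" by simp
  have int': "integrable M (\<lambda>z. F' z y0 v)" for v
    by (rule Bochner_Integration.integrable_bound[OF integrable_mult_left[OF k(1), of "norm v"] meas])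
      (use bnd[OF y0] k in auto)
  have lin: "linear (F' z y0)" for z by (rule has_derivative_linear[OF der[OF y0]])
  have "bounded_linear (\<lambda>v. LINT z|M. F' z y0 v)"
  proof (rule bounded_linear_intro[where K = "integral\<^sup>L M k"])
    show "(LINT z|M. F' z y0 (v + w)) = (LINT z|M. F' z y0 v) + (LINT z|M. F' z y0 w)" for v w
      by (simp add: linear_add[OF lin] int')
    show "(LINT z|M. F' z y0 (r *\<^sub>R v)) = r *\<^sub>R (LINT z|M. F' z y0 v)" for v r
      by (simp add: linear_scale[OF lin])
    show "norm (LINT z|M. F' z y0 v) \<le> norm v * integral\<^sup>L M k" for v
    proof -
      have "norm (LINT z|M. F' z y0 v) \<le> (LINT z|M. k z * norm v)"
        by (rule order_trans[OF integral_norm_bound integral_mono])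
          (auto intro: integrable_norm int' integrable_mult_left k bnd[OF y0])
      thus ?thesis by (simp add: mult.commute)
    qed
  qed
  moreover have "((\<lambda>y. ((LINT z|M. F z y) - (LINT z|M. F z y0) - (LINT z|M. F' z y0 (y - y0))) /\<^sub>R norm (y - y0)) \<longlongrightarrow> 0) (at y0)"
    unfolding tendsto_at_iff_sequentially
  proof (intro allI impI)
    fix X assume X: "\<forall>i. X i \<in> UNIV - {y0}" "X \<longlonglongrightarrow> y0"
    then obtain N where N: "\<And>n. n \<ge> N \<Longrightarrow> dist (X n) y0 < 1"
      unfolding lim_sequentially by (metis zero_less_one)
    let ?Y = "\<lambda>n. X (n + N)"
    have Y: "?Y n \<in> ball y0 1" "?Y n \<noteq> y0" for n using N[of "n + N"] X(1) by (auto simp: dist_commute)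
    have Ylim: "?Y \<longlonglongrightarrow> y0" using X(2) by (rule LIMSEQ_ignore_initial_segment)
    let ?q = "\<lambda>n z. (F z (?Y n) - F z y0 - F' z y0 (?Y n - y0)) /\<^sub>R norm (?Y n - y0)"
    have intq: "integrable M (?q n)" for n
      using int[OF Y(1)] int[OF y0] int' by auto
    have eq: "((LINT z|M. F z (?Y n)) - (LINT z|M. F z y0) - (LINT z|M. F' z y0 (?Y n - y0))) /\<^sub>R norm (?Y n - y0)
        = (LINT z|M. ?q n z)" for n
      using int[OF Y(1)] int[OF y0] int' by simp
    have "(\<lambda>n. LINT z|M. ?q n z) \<longlonglongrightarrow> (LINT z|M. 0)"
    proof (rule integral_dominated_convergence[where w = "\<lambda>z. 2 * k z"])
      show "integrable M (\<lambda>z. 2 * k z)" using k by simp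
      show "AE z in M. (\<lambda>n. ?q n z) \<longlonglongrightarrow> 0"
      proof (rule AE_I2)
        fix z
        have "((\<lambda>y. (F z y - F z y0 - F' z y0 (y - y0)) /\<^sub>R norm (y - y0)) \<longlongrightarrow> 0) (at y0)"
          using der[OF y0, of z] by (simp add: has_derivative_def Lim_ident_at)
        moreover have "filterlim ?Y (at y0) sequentially"
          unfolding filterlim_at using Ylim Y by auto
        ultimately show "(\<lambda>n. ?q n z) \<longlonglongrightarrow> 0" by (rule filterlim_compose)
      qed
      fix n show "AE z in M. norm (?q n z) \<le> 2 * k z"
      proof (rule AE_I2)
        fix z
        have "norm (F z (?Y n) - F z y0) \<le> k z * norm (?Y n - y0)"
        proof (rule differentiable_bound[of "ball y0 1" "F z" "F' z"])
          show "onorm (F' z y) \<le> k z" if "y \<in> ball y0 1" for y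
            by (rule onorm_le) (rule bnd[OF that])
        qed (use der Y y0 in \<open>auto intro: has_derivative_at_withinI\<close>)
        moreover have "norm (F' z y0 (?Y n - y0)) \<le> k z * norm (?Y n - y0)" by (rule bnd[OF y0])
        ultimately have "norm (F z (?Y n) - F z y0 - F' z y0 (?Y n - y0)) \<le> 2 * k z * norm (?Y n - y0)"
          using norm_triangle_ineq4[of "F z (?Y n) - F z y0" "F' z y0 (?Y n - y0)"] by simp
        hence "norm (F z (?Y n) - F z y0 - F' z y0 (?Y n - y0)) / norm (?Y n - y0) \<le> 2 * k z"
          using Y(2)[of n] by (subst pos_divide_le_eq) auto
        thus "norm (?q n z) \<le> 2 * k z" by (simp add: divide_inverse mult.commute)
      qed
    qed (use intq in auto)
    hence "(\<lambda>n. ((LINT z|M. F z (?Y n)) - (LINT z|M. F z y0) - (LINT z|M. F' z y0 (?Y n - y0))) /\<^sub>R norm (?Y n - y0)) \<longlonglongrightarrow> 0"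
      unfolding eq by simp
    from LIMSEQ_offset[OF this]
    show "((\<lambda>y. ((LINT z|M. F z y) - (LINT z|M. F z y0) - (LINT z|M. F' z y0 (y - y0))) /\<^sub>R norm (y - y0)) \<circ> X) \<longlonglongrightarrow> 0"
      unfolding o_def .
  qed
  ultimately show ?thesis unfolding has_derivative_def by (simp add: Lim_ident_at)
qed

section \<open>Superpositions of test functions\<close>

lemma deriv_bound_diff:
  fixes f g :: "real ^ 'd::finite \<Rightarrow> complex"
  assumes "smooth f" "smooth g"
    and "\<And>is y. cmod (iter_deriv is f y - iter_deriv is g y) \<le> m y * (h ^ length is * sqrt (fact (length is)))"
  shows "deriv_bound m h (\<lambda>y. f y - g y)"
proof -
  have "iter_deriv is (\<lambda>y. f y - g y) = (\<lambda>y. iter_deriv is f y - iter_deriv is g y)" for "is"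
    using iter_deriv_lin[OF assms(1,2), of "is" 1 "-1"] by simp
  moreover have "smooth (\<lambda>y. f y - g y)" using smooth_lin[OF assms(1,2), of 1 "-1"] by simp
  ultimately show ?thesis unfolding deriv_bound_def using assms(3) by simp
qed

lemma Riemann_sum_error:
  fixes \<phi> :: "'p::euclidean_space \<Rightarrow> complex"
  assumes p: "p tagged_division_of (cbox a c)" and cont: "continuous_on (cbox a c) \<phi>"
    and e: "\<And>x k z. (x, k) \<in> p \<Longrightarrow> z \<in> k \<Longrightarrow> cmod (\<phi> x - \<phi> z) \<le> e"
  shows "cmod ((\<Sum>q\<in>p. complex_of_real (measure lborel (snd q)) * \<phi> (fst q)) - integral (cbox a c) \<phi>) \<le> e * measure lborel (cbox a c)"
proof -
  have int: "\<phi> integrable_on (cbox a c)" using cont by (rule integrable_continuous)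
  have "(\<Sum>q\<in>p. complex_of_real (measure lborel (snd q)) * \<phi> (fst q)) - integral (cbox a c) \<phi>
      = (\<Sum>(x, k)\<in>p. complex_of_real (measure lborel k) * \<phi> x - integral k \<phi>)"
    unfolding integral_combine_tagged_division_topdown[OF int p]
    by (simp add: sum_subtractf case_prod_beta)
  also have "cmod \<dots> \<le> (\<Sum>(x, k)\<in>p. e * measure lborel k)"
  proof (rule sum_norm_le, clarify)
    fix x k assume xk: "(x, k) \<in> p"
    obtain l r where k: "k = cbox l r" and sub: "k \<subseteq> cbox a c"
      using tagged_division_ofD(3,4)[OF p xk] by blast
    have ne: "x \<in> k" using tagged_division_ofD(2)[OF p xk] .
    have ik: "\<phi> integrable_on cbox l r"
      by (rule integrable_continuous) (rule continuous_on_subset[OF cont], use sub k in auto)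
    have "complex_of_real (measure lborel k) * \<phi> x - integral k \<phi> = integral (cbox l r) (\<lambda>z. \<phi> x - \<phi> z)"
      unfolding k integral_diff[OF integrable_const ik] integral_const by (simp add: scaleR_conv_of_real)
    also have "cmod \<dots> \<le> e * measure lborel (cbox l r)"
    proof (rule has_integral_bound[OF _ integrable_integral])
      show "0 \<le> e" using e[OF xk ne] by simp
      show "(\<lambda>z. \<phi> x - \<phi> z) integrable_on cbox l r" by (intro integrable_diff integrable_const ik)
    qed (use e[OF xk] k in auto)
    finally show "cmod (complex_of_real (measure lborel k) * \<phi> x - integral k \<phi>) \<le> e * measure lborel k" by (simp add: k)
  qed
  also have "\<dots> = e * measure lborel (cbox a c)"
    using additive_content_tagged_division[OF p] by (simp add: case_prod_beta sum_distrib_left[symmetric])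
  finally show ?thesis .
qed

lemma integral_outside_boxes_small:
  fixes \<kappa> :: "'p::euclidean_space \<Rightarrow> real"
  assumes "integrable lborel \<kappa>" "e > 0"
  obtains a c where "\<bar>LINT z|lborel. indicator (- cbox a c) z * \<kappa> z\<bar> < e"
proof -
  let ?S = "\<lambda>n. cbox (- (real n *\<^sub>R One)) (real n *\<^sub>R One) :: 'p set"
  have "(\<lambda>n. LINT z|lborel. indicator (- ?S n) z * \<kappa> z) \<longlonglongrightarrow> (LINT z|(lborel :: 'p measure). (0::real))"
  proof (rule integral_dominated_convergence[where w = "\<lambda>z. norm (\<kappa> z)"])
    show "AE z in lborel. (\<lambda>n. indicator (- ?S n) z * \<kappa> z) \<longlonglongrightarrow> 0"
    proof (rule AE_I2)
      fix z :: 'p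
      obtain N where N: "norm z \<le> real N" using real_arch_simple[of "norm z"] by (rule exE)
      have "z \<in> ?S n" if "n \<ge> N" for n
      proof -
        have "\<bar>z \<bullet> i\<bar> \<le> real n" if "i \<in> Basis" for i
          using Basis_le_norm[OF that, of z] N \<open>n \<ge> N\<close> by simp
        thus ?thesis by (auto simp: mem_box abs_le_iff minus_le_iff)
      qed
      hence "eventually (\<lambda>n. indicator (- ?S n) z * \<kappa> z = 0) sequentially"
        by (auto simp: eventually_sequentially intro!: exI[of _ N])
      thus "(\<lambda>n. indicator (- ?S n) z * \<kappa> z) \<longlonglongrightarrow> 0" by (rule tendsto_eventually)
    qed
    show "integrable lborel (\<lambda>z. norm (\<kappa> z))" using assms by simp
    show "AE z in lborel. norm (indicator (- ?S n) z * \<kappa> z) \<le> norm (\<kappa> z)" for n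
      by (auto simp: indicator_def)
  qed (use assms in auto)
  hence "(\<lambda>n. LINT z|lborel. indicator (- ?S n) z * \<kappa> z) \<longlonglongrightarrow> 0" by simp
  from LIMSEQ_D[OF this assms(2)] obtain N where "\<forall>n\<ge>N. \<bar>LINT z|lborel. indicator (- ?S n) z * \<kappa> z\<bar> < e"
    by auto
  thus ?thesis using that[of "- (real N *\<^sub>R One)" "real N *\<^sub>R One"] by (meson order_refl)
qed

text \<open>A family of test functions with common rates \<open>h\<close>, \<open>b\<close> and a constant \<open>\<kappa>\<close> that may depend on the
  parameter. The superposition exists once \<open>\<kappa>\<close> is integrable. Continuity is required separately for
  each derivative; continuity with respect to the norms follows.\<close>

locale gs_family =
  fixes G :: "'p::euclidean_space \<Rightarrow> real ^ 'd::{finite,linorder} \<Rightarrow> complex" and \<kappa> :: "'p \<Rightarrow> real" and h b :: real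
  assumes bound: "\<And>z. deriv_bound (\<lambda>y. \<kappa> z * gauss b y) h (G z)"
    and cont: "\<And>is. continuous_on UNIV (\<lambda>(z, y). iter_deriv is (G z) y)"
    and cont_\<kappa>: "continuous_on UNIV \<kappa>"
    and pos: "h > 0" "b > 0"
begin

lemma \<kappa>_nonneg: "\<kappa> z \<ge> 0"
  using deriv_boundD(4)[OF bound, of z 0] by simp

lemma smooth_G: "smooth (G z)" using bound deriv_boundD(1) by blast

lemma G_in_gs_S: "G z \<in> gs_S (1/2)"
  by (rule deriv_bound_imp_gs_S[OF bound]) (use pos in auto)

lemma G_bound: "cmod (iter_deriv is (G z) y) \<le> \<kappa> z * gauss b y * (h ^ length is * sqrt (fact (length is)))"
  by (rule deriv_boundD(2)[OF bound])

lemma deriv_bound_weaken: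
  fixes f :: "real ^ 'd::_ \<Rightarrow> complex"
  assumes "deriv_bound (\<lambda>y. K * gauss b y) h f"
  shows "deriv_bound (\<lambda>y. K * gauss (b / 2) y) (2 * h) f"
proof (rule deriv_bound_mono[OF assms])
  have "0 \<le> K" using deriv_boundD(4)[OF assms, of 0] by simp
  thus "K * gauss b y \<le> K * gauss (b / 2) y" for y :: "real ^ 'd::_"
    using pos by (intro mult_left_mono) auto
qed (use pos in auto)

lemma continuous_iter_deriv: "continuous_on S (\<lambda>z. iter_deriv is (G z) y)"
proof -
  have "continuous_on S (\<lambda>z. (z, y))" by (intro continuous_intros)
  from continuous_on_compose2[OF cont[of "is"] this] show ?thesis by simp
qed

text \<open>Relaxing the rates makes high orders and large arguments negligible, so that only finitely many
  derivatives on a compact set matter.\<close>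

lemma uniformly_continuous_in_step:
  assumes S: "compact S" and e: "e > 0"
  obtains \<delta> where "\<delta> > 0" "\<And>z w. z \<in> S \<Longrightarrow> w \<in> S \<Longrightarrow> dist z w < \<delta> \<Longrightarrow>
    deriv_bound (\<lambda>y. e * gauss (b / 2) y) (2 * h) (\<lambda>y. G z y - G w y)"
proof -
  obtain B where B: "B > 0" "\<And>z. z \<in> S \<Longrightarrow> \<kappa> z \<le> B"
  proof -
    have "bounded (\<kappa> ` S)"
      by (intro compact_imp_bounded compact_continuous_image continuous_on_subset[OF cont_\<kappa>] S) auto
    then obtain B where "B > 0" "\<forall>x\<in>\<kappa> ` S. norm x \<le> B" using bounded_pos by blast
    thus ?thesis using that by force
  qed
  obtain N where "(1/2 :: real) ^ N < e / (2 * B)"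
    using real_arch_pow_inv[of "e / (2 * B)" "1/2"] e B by auto
  hence N: "2 * B * (1/2) ^ N \<le> e" using B by (simp add: field_simps)
  \<comment> \<open>Beyond order \<open>N\<close> or radius \<open>R\<close> the crude bound \<open>2B\<close> for the difference suffices.\<close>
  have "((\<lambda>R::real. 2 * B * exp (- (b / 2) * R\<^sup>2)) \<longlongrightarrow> 0) at_top"
    using pos by real_asymp
  hence "eventually (\<lambda>R::real. 2 * B * exp (- (b / 2) * R\<^sup>2) < e) at_top" using e by (rule order_tendstoD(2))
  then obtain R :: real where R: "2 * B * exp (- (b / 2) * R\<^sup>2) < e" "R \<ge> 0"
    using eventually_happens'[OF trivial_limit_at_top_linorder eventually_conj[OF _ eventually_ge_at_top[of "0::real"]]] by blast
  define c where "c = (\<lambda>is :: 'd list. (2 * h) ^ length is * sqrt (fact (length is)))"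
  have c: "c is > 0" for "is" using pos by (simp add: c_def)
  define L where "L = {is :: 'd list. length is \<le> N}"
  have "finite L" using finite_lists_length_le[of "UNIV :: 'd set" N] by (simp add: L_def)
  have "\<exists>\<delta>>0. \<forall>z\<in>S. \<forall>w\<in>S. \<forall>y\<in>cball 0 R. dist z w < \<delta> \<longrightarrow>
      cmod (iter_deriv is (G z) y - iter_deriv is (G w) y) \<le> e * exp (- (b / 2) * R\<^sup>2) * c is" for "is"
  proof -
    have "uniformly_continuous_on (S \<times> cball 0 R) (\<lambda>(z, y). iter_deriv is (G z) y)"
      by (intro compact_uniformly_continuous continuous_on_subset[OF cont] compact_Times S compact_cball) auto
    moreover have "e * exp (- (b / 2) * R\<^sup>2) * c is > 0" using e c by simp
    ultimately obtain \<delta> where d: "\<delta> > 0" "\<And>q q'. q \<in> S \<times> cball 0 R \<Longrightarrow> q' \<in> S \<times> cball 0 R \<Longrightarrow> dist q' q < \<delta> \<Longrightarrow>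
       dist ((\<lambda>(z, y). iter_deriv is (G z) y) q') ((\<lambda>(z, y). iter_deriv is (G z) y) q) < e * exp (- (b / 2) * R\<^sup>2) * c is"
      unfolding uniformly_continuous_on_def by meson
    show ?thesis
    proof (intro exI[of _ \<delta>] conjI ballI impI)
      fix z w and y :: "real ^ 'd::_" assume "z \<in> S" "w \<in> S" "y \<in> cball 0 R" "dist z w < \<delta>"
      thus "cmod (iter_deriv is (G z) y - iter_deriv is (G w) y) \<le> e * exp (- (b / 2) * R\<^sup>2) * c is"
        using d(2)[of "(w, y)" "(z, y)"] by (simp add: dist_Pair_Pair dist_norm)
    qed (rule d(1))
  qed
  then obtain D where D: "\<And>is. D is > (0::real)" "\<And>is z w y. z \<in> S \<Longrightarrow> w \<in> S \<Longrightarrow> y \<in> cball 0 R \<Longrightarrow> dist z w < D is \<Longrightarrow>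
      cmod (iter_deriv is (G z) y - iter_deriv is (G w) y) \<le> e * exp (- (b / 2) * R\<^sup>2) * c is" by metis
  show ?thesis
  proof (rule that[of "Min (insert 1 (D ` L))"])
    show "Min (insert 1 (D ` L)) > 0" using \<open>finite L\<close> D(1) by (subst Min_gr_iff) auto
    fix z w assume zw: "z \<in> S" "w \<in> S" "dist z w < Min (insert 1 (D ` L))"
    show "deriv_bound (\<lambda>y. e * gauss (b / 2) y) (2 * h) (\<lambda>y. G z y - G w y)"
    proof (rule deriv_bound_diff[OF smooth_G smooth_G])
      fix "is" :: "'d list" and y :: "real ^ 'd::_"
      let ?l = "cmod (iter_deriv is (G z) y - iter_deriv is (G w) y)"
      have c2: "h ^ length is * sqrt (fact (length is)) = (1/2) ^ length is * c is"
        by (simp add: c_def power_mult_distrib power_one_over)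
      have "?l \<le> cmod (iter_deriv is (G z) y) + cmod (iter_deriv is (G w) y)" by (rule norm_triangle_ineq4)
      also have "\<dots> \<le> \<kappa> z * gauss b y * ((1/2) ^ length is * c is) + \<kappa> w * gauss b y * ((1/2) ^ length is * c is)"
        using G_bound[of "is" z y] G_bound[of "is" w y] unfolding c2 by (rule add_mono)
      also have "\<dots> \<le> B * gauss b y * ((1/2) ^ length is * c is) + B * gauss b y * ((1/2) ^ length is * c is)"
        using zw B c[of "is"] by (intro add_mono mult_right_mono) auto
      also have "gauss b y = gauss (b/2) y * gauss (b/2) y"
        by (simp flip: exp_add)
      finally have l: "?l \<le> 2 * B * (1/2) ^ length is * gauss (b/2) y * (gauss (b/2) y * c is)"
        by (simp add: mult_ac)
      have cc: "0 \<le> gauss (b/2) y * c is" using c[of "is"] by simp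
      \<comment> \<open>Half of the decay rate and the factor \<open>2\<^bsup>-n\<^esup>\<close> in the order are given away for smallness.\<close>
      consider "length is > N" | "norm y > R" | "length is \<le> N" "norm y \<le> R" by linarith
      hence "?l \<le> e * (gauss (b / 2) y * c is)"
      proof cases
        case 1
        have "2 * B * (1/2) ^ length is * gauss (b/2) y \<le> 2 * B * (1/2) ^ N * 1"
          using 1 B pos by (intro mult_mono power_decreasing) auto
        hence "2 * B * (1/2) ^ length is * gauss (b/2) y \<le> e" using N by simp
        from mult_right_mono[OF this cc] show ?thesis using l by linarith
      next
        case 2
        have "2 * B * (1/2) ^ length is * gauss (b/2) y \<le> 2 * B * 1 * exp (- (b / 2) * R\<^sup>2)"
          using 2 B pos R by (intro mult_mono power_le_one) (auto intro!: power_mono)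
        hence "2 * B * (1/2) ^ length is * gauss (b/2) y \<le> e" using R by simp
        from mult_right_mono[OF this cc] show ?thesis using l by linarith
      next
        case 3
        have "dist z w < D is" using zw(3) 3 \<open>finite L\<close> by (subst (asm) Min_gr_iff) (auto simp: L_def)
        hence "?l \<le> e * exp (- (b / 2) * R\<^sup>2) * c is" using D(2) zw 3 by simp
        also have "\<dots> \<le> e * gauss (b / 2) y * c is"
          using 3 pos e c[of "is"] R by (intro mult_right_mono mult_left_mono) (auto intro!: power_mono)
        finally show ?thesis by (simp add: mult_ac)
      qed
      thus "?l \<le> e * gauss (b / 2) y * ((2 * h) ^ length is * sqrt (fact (length is)))"
        by (simp add: c_def mult_ac)
    qed
  qed
qed

lemma continuous_functional:
  assumes u: "u \<in> gs_S_dual (1/2)"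
  shows "continuous_on A (\<lambda>z. u (G z))"
proof (rule continuous_at_imp_continuous_on, rule ballI)
  fix z0 assume "z0 \<in> A"
  obtain C where C: "C > 0" "\<And>K f. deriv_bound (\<lambda>x. K * gauss (b / 2) x) (2 * h) f \<Longrightarrow> cmod (u f) \<le> C * K"
    using gs_S_dual_bound[OF u, of "2 * h" "b / 2"] pos by (metis half_gt_zero less_eq_real_def mult_nonneg_nonneg zero_le_numeral)
  show "isCont (\<lambda>z. u (G z)) z0"
    unfolding continuous_at_eps_delta
  proof (intro allI impI)
    fix e :: real assume e: "e > 0"
    obtain \<delta> where d: "\<delta> > 0" "\<And>z w. z \<in> cball z0 1 \<Longrightarrow> w \<in> cball z0 1 \<Longrightarrow> dist z w < \<delta> \<Longrightarrow>
      deriv_bound (\<lambda>y. (e / (2 * C)) * gauss (b / 2) y) (2 * h) (\<lambda>y. G z y - G w y)"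
      using uniformly_continuous_in_step[of "cball z0 1" "e / (2 * C)"] e C(1) by auto
    show "\<exists>d>0. \<forall>x'. dist x' z0 < d \<longrightarrow> dist (u (G x')) (u (G z0)) < e"
    proof (intro exI[of _ "min 1 \<delta>"] conjI allI impI)
      fix z assume z: "dist z z0 < min 1 \<delta>"
      have "cmod (u (\<lambda>y. G z y - G z0 y)) \<le> C * (e / (2 * C))"
        by (intro C(2) d(2)) (use z in \<open>auto simp: dist_commute\<close>)
      moreover have "u (\<lambda>y. G z y - G z0 y) = u (G z) - u (G z0)"
        using gs_S_dual_lin[OF u G_in_gs_S G_in_gs_S, of 1 z "-1" z0] by simp
      ultimately show "dist (u (G z)) (u (G z0)) < e" using e C(1) by (simp add: dist_norm)
    qed (use d in auto)
  qed
qed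

end

context gs_family begin

lemma borel_measurable_iter_deriv: "(\<lambda>z. iter_deriv is (G z) y) \<in> borel_measurable borel"
  by (intro borel_measurable_continuous_onI continuous_iter_deriv)

lemma iter_deriv_le: "cmod (iter_deriv is (G z) y) \<le> \<kappa> z * (h ^ length is * sqrt (fact (length is)))"
proof -
  have "\<kappa> z * gauss b y \<le> \<kappa> z * 1"
    using \<kappa>_nonneg pos by (intro mult_left_mono) auto
  hence "\<kappa> z * gauss b y * (h ^ length is * sqrt (fact (length is))) \<le> \<kappa> z * (h ^ length is * sqrt (fact (length is)))"
    using pos by (intro mult_right_mono) auto
  thus ?thesis using G_bound order_trans by blast
qed

context
  assumes int_\<kappa>: "integrable lborel \<kappa>"
begin

lemma integrable_iter_deriv: "integrable lborel (\<lambda>z. iter_deriv is (G z) y)"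
  by (rule Bochner_Integration.integrable_bound[OF integrable_mult_left[OF int_\<kappa>, of "h ^ length is * sqrt (fact (length is))"]])
    (use borel_measurable_iter_deriv iter_deriv_le \<kappa>_nonneg pos in \<open>auto simp: abs_mult\<close>)

lemma has_derivative_integral_iter_deriv:
  "((\<lambda>y. LINT z|lborel. iter_deriv is (G z) y) has_derivative
    (\<lambda>v. LINT z|lborel. frechet_derivative (iter_deriv is (G z)) (at y) v)) (at y)"
proof -
  define c where "c = h ^ length (undefined # is) * sqrt (fact (length (undefined # is)))"
  have c: "c \<ge> 0" using pos by (simp add: c_def)
  show ?thesis
  proof (rule has_derivative_integral_dominated[where k = "\<lambda>z. real CARD('d) * (\<kappa> z * c)"])
    show "integrable lborel (\<lambda>z. iter_deriv is (G z) y)" for y by (rule integrable_iter_deriv)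
    show "(iter_deriv is (G z) has_derivative frechet_derivative (iter_deriv is (G z)) (at y)) (at y)" for z y
      by (intro smooth_has_derivative smooth_iter_deriv smooth_G)
    show "cmod (frechet_derivative (iter_deriv is (G z)) (at y) v) \<le> real CARD('d) * (\<kappa> z * c) * norm v" for z y v
    proof (rule norm_frechet_derivative_le)
      show "cmod (partial_deriv i (iter_deriv is (G z)) y) \<le> \<kappa> z * c" for i
        using iter_deriv_le[of "i # is" z y] by (simp add: c_def)
    qed (intro smooth_iter_deriv smooth_G)
    show "(\<lambda>z. frechet_derivative (iter_deriv is (G z)) (at y) v) \<in> borel_measurable lborel" for v
      using borel_measurable_iter_deriv[of "_ # is" y]
      by (simp add: frechet_derivative_eq_sum_partial_deriv smooth_iter_deriv smooth_G)
    show "integrable lborel (\<lambda>z. real CARD('d) * (\<kappa> z * c))" using int_\<kappa> by simp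
    show "0 \<le> real CARD('d) * (\<kappa> z * c)" for z using \<kappa>_nonneg c by simp
  qed
qed

lemma iter_deriv_integral:
  "iter_deriv is (\<lambda>y. LINT z|lborel. G z y) = (\<lambda>y. LINT z|lborel. iter_deriv is (G z) y)"
proof (induct "is")
  case (Cons i "is")
  have "iter_deriv (i # is) (\<lambda>y. LINT z|lborel. G z y) = partial_deriv i (\<lambda>y. LINT z|lborel. iter_deriv is (G z) y)"
    using Cons by simp
  also have "\<dots> = (\<lambda>y. LINT z|lborel. partial_deriv i (iter_deriv is (G z)) y)"
  proof
    fix y
    have "partial_deriv i (\<lambda>y. LINT z|lborel. iter_deriv is (G z) y) y
        = (LINT z|lborel. frechet_derivative (iter_deriv is (G z)) (at y) (axis i 1))"
      by (rule partial_deriv_unique[OF has_derivative_integral_iter_deriv])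
    thus "partial_deriv i (\<lambda>y. LINT z|lborel. iter_deriv is (G z) y) y = (LINT z|lborel. partial_deriv i (iter_deriv is (G z)) y)"
      by (simp only: partial_deriv_def[symmetric])
  qed
  finally show ?case by simp
qed simp

lemma smooth_integral: "smooth (\<lambda>y. LINT z|lborel. G z y)"
  unfolding smooth_def iter_deriv_integral differentiable_on_def
  by (intro allI ballI, rule differentiable_at_withinI, rule differentiableI[OF has_derivative_integral_iter_deriv])

lemma deriv_bound_integral:
  "deriv_bound (\<lambda>y. (LINT z|lborel. \<kappa> z) * gauss b y) h (\<lambda>y. LINT z|lborel. G z y)"
  unfolding deriv_bound_def
proof (intro conjI allI smooth_integral)
  fix "is" :: "'d list" and y :: "real ^ 'd::_"
  let ?c = "gauss b y * (h ^ length is * sqrt (fact (length is)))"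
  have "cmod (LINT z|lborel. iter_deriv is (G z) y) \<le> (LINT z|lborel. \<kappa> z * ?c)"
    using G_bound[of "is" _ y] int_\<kappa>
    by (intro order_trans[OF integral_norm_bound integral_mono] integrable_norm integrable_iter_deriv integrable_mult_left)
      (auto simp: mult_ac)
  thus "cmod (iter_deriv is (\<lambda>y. LINT z|lborel. G z y) y)
      \<le> (LINT z|lborel. \<kappa> z) * gauss b y * (h ^ length is * sqrt (fact (length is)))"
    by (simp add: iter_deriv_integral mult_ac)
qed

lemma integral_split_box:
  fixes \<phi> :: "'p \<Rightarrow> complex"
  assumes "continuous_on UNIV \<phi>" "\<And>z. cmod (\<phi> z) \<le> B * \<kappa> z" "B \<ge> 0"
  shows "integrable lborel \<phi>"
    and "cmod ((LINT z|lborel. \<phi> z) - integral (cbox a c) \<phi>) \<le> B * (LINT z|lborel. indicator (- cbox a c) z * \<kappa> z)"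
proof -
  have meas: "\<phi> \<in> borel_measurable lborel" using borel_measurable_continuous_onI[OF assms(1)] by simp
  show int: "integrable lborel \<phi>"
    by (rule Bochner_Integration.integrable_bound[OF integrable_mult_right[OF int_\<kappa>, of B] meas])
      (use assms \<kappa>_nonneg in auto)
  have sint: "set_integrable lborel (cbox a c) \<phi>" "set_integrable lborel (- cbox a c) \<phi>"
    unfolding set_integrable_def by (auto intro!: integrable_mult_indicator int)
  have "(LINT z|lborel. \<phi> z) = (LINT z:cbox a c \<union> - cbox a c|lborel. \<phi> z)"
    by (simp add: set_lebesgue_integral_def)
  also have "\<dots> = (LINT z:cbox a c|lborel. \<phi> z) + (LINT z:- cbox a c|lborel. \<phi> z)"
    by (rule set_integral_Un) (use sint in auto)
  also have "(LINT z:cbox a c|lborel. \<phi> z) = integral (cbox a c) \<phi>"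
    by (rule set_borel_integral_eq_integral(2)[OF sint(1)])
  finally have "(LINT z|lborel. \<phi> z) - integral (cbox a c) \<phi> = (LINT z|lborel. indicator (- cbox a c) z *\<^sub>R \<phi> z)"
    by (simp add: set_lebesgue_integral_def)
  also have "cmod \<dots> \<le> (LINT z|lborel. B * (indicator (- cbox a c) z * \<kappa> z))"
  proof (rule order_trans[OF integral_norm_bound integral_mono])
    show "integrable lborel (\<lambda>z. norm (indicator (- cbox a c) z *\<^sub>R \<phi> z))"
      using sint(2) unfolding set_integrable_def by (rule integrable_norm)
    show "integrable lborel (\<lambda>z. B * (indicator (- cbox a c) z * \<kappa> z))"
      using integrable_mult_indicator[OF _ int_\<kappa>, of "- cbox a c"] by (intro integrable_mult_right) simp
    show "norm (indicator (- cbox a c) z *\<^sub>R \<phi> z) \<le> B * (indicator (- cbox a c) z * \<kappa> z)" for z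
      using assms(2)[of z] by (auto simp: indicator_def)
  qed
  finally show "cmod ((LINT z|lborel. \<phi> z) - integral (cbox a c) \<phi>) \<le> B * (LINT z|lborel. indicator (- cbox a c) z * \<kappa> z)"
    by simp
qed

text \<open>Riemann sums over a large box converge to the integral in a step of \<open>S\<^sub>1\<^sub>/\<^sub>2\<close>, on which an
  ultradistribution is continuous. The rates are relaxed to \<open>2h\<close> and \<open>b/2\<close>, because convergence of the
  sums is uniform only after this loss.\<close>

lemma functional_integral:
  assumes u: "u \<in> gs_S_dual (1/2)"
  shows "integrable lborel (\<lambda>z. u (G z))" "u (\<lambda>y. LINT z|lborel. G z y) = (LINT z|lborel. u (G z))"
proof -
  obtain C where C: "C > 0" "\<And>K f. deriv_bound (\<lambda>x. K * gauss (b / 2) x) (2 * h) f \<Longrightarrow> cmod (u f) \<le> C * K"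
    using gs_S_dual_bound[OF u, of "2 * h" "b / 2"] pos by (metis half_gt_zero less_eq_real_def mult_nonneg_nonneg zero_le_numeral)
  have uG: "cmod (u (G z)) \<le> C * \<kappa> z" for z by (rule C(2)[OF deriv_bound_weaken[OF bound]])
  have cu: "continuous_on A (\<lambda>z. u (G z))" for A by (rule continuous_functional[OF u])
  show "integrable lborel (\<lambda>z. u (G z))" by (rule integral_split_box(1)[OF cu uG]) (use C in simp)
  let ?g = "\<lambda>y. LINT z|lborel. G z y"
  have "cmod (u ?g - (LINT z|lborel. u (G z))) \<le> 0 + e" if "e > 0" for e
  proof -
    \<comment> \<open>Two of the four parts of the error come from outside the box and two from the Riemann sums.\<close>
    define e' where "e' = e / (4 * C)"
    have e': "e' > 0" using that C by (simp add: e'_def)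
    obtain a c where ac: "\<bar>LINT z|lborel. indicator (- cbox a c) z * \<kappa> z\<bar> < e'"
      by (rule integral_outside_boxes_small[OF int_\<kappa> e'])
    define m where "m = measure lborel (cbox a c)"
    have m: "m \<ge> 0" by (simp add: m_def)
    define d where "d = e' / (1 + m)"
    have d: "d > 0" "d * m \<le> e'" using e' m by (auto simp: d_def field_simps add_pos_nonneg)
    obtain \<delta> where \<delta>: "\<delta> > 0" "\<And>z w. z \<in> cbox a c \<Longrightarrow> w \<in> cbox a c \<Longrightarrow> dist z w < \<delta> \<Longrightarrow>
        deriv_bound (\<lambda>y. d * gauss (b / 2) y) (2 * h) (\<lambda>y. G z y - G w y)"
      by (rule uniformly_continuous_in_step[OF compact_cbox d(1), of a c]) auto
    obtain p where p: "p tagged_division_of (cbox a c)" "(\<lambda>x. ball x \<delta>) fine p"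
      by (rule fine_division_exists[OF gauge_ball[OF \<delta>(1)], of a c]) auto
    have fin: "finite p" using p(1) by (rule tagged_division_of_finite)
    have close: "deriv_bound (\<lambda>y. d * gauss (b / 2) y) (2 * h) (\<lambda>y. G x y - G z y)"
      if "(x, k) \<in> p" "z \<in> k" for x k z
    proof (rule \<delta>(2))
      show "x \<in> cbox a c" "z \<in> cbox a c" using tagged_division_ofD(2,3)[OF p(1) that(1)] that(2) by auto
      show "dist x z < \<delta>" using fineD[OF p(2) that(1)] that(2) by auto
    qed
    let ?c = "\<lambda>q. complex_of_real (measure lborel (snd q))" and ?G = "\<lambda>q. G (fst q)"
    let ?s = "\<lambda>y. \<Sum>q\<in>p. ?c q * ?G q y"
    have s: "?s \<in> gs_S (1/2)" "u ?s = (\<Sum>q\<in>p. ?c q * u (?G q))"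
      using gs_S_dual_sum[OF u fin, of ?G ?c, OF G_in_gs_S] by simp_all
    have "deriv_bound (\<lambda>y. (2 * e') * gauss (b / 2) y) (2 * h) (\<lambda>y. ?g y - ?s y)"
    proof (rule deriv_bound_diff[OF smooth_integral])
      show "smooth ?s"
      proof (rule smooth_sum)
        show "smooth (\<lambda>y. ?c q * ?G q y)" for q
          using smooth_lin[OF smooth_G[of "fst q"] smooth_zero, of "?c q" 0] by simp
      qed
      fix "is" :: "'d list" and y :: "real ^ 'd::_"
      let ?D = "\<lambda>z. iter_deriv is (G z) y" and ?E = "gauss (b / 2) y * ((2 * h) ^ length is * sqrt (fact (length is)))"
      have E: "?E \<ge> 0" using pos by simp
      have DE: "cmod (?D z) \<le> ?E * \<kappa> z" for z
        using deriv_boundD(2)[OF deriv_bound_weaken[OF bound], of "is" z y] by (simp add: mult_ac)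
      have 1: "cmod ((LINT z|lborel. ?D z) - integral (cbox a c) ?D) \<le> ?E * e'"
        by (rule order_trans[OF integral_split_box(2)[OF continuous_iter_deriv DE E, of a c] mult_left_mono[OF _ E]])
          (use ac in simp)
      have 2: "cmod ((\<Sum>q\<in>p. ?c q * iter_deriv is (?G q) y) - integral (cbox a c) ?D) \<le> (d * ?E) * m"
        unfolding m_def
      proof (rule Riemann_sum_error[OF p(1) continuous_iter_deriv])
        fix x k z assume "(x, k) \<in> p" "z \<in> k"
        from deriv_boundD(2)[OF close[OF this], of "is" y]
        show "cmod (?D x - ?D z) \<le> d * ?E"
          using iter_deriv_lin[OF smooth_G smooth_G, of "is" 1 x "-1" z] by (simp add: mult_ac)
      qed
      have "(d * ?E) * m \<le> e' * ?E" using mult_right_mono[OF d(2) E] by (simp add: mult_ac)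
      hence "cmod ((LINT z|lborel. ?D z) - (\<Sum>q\<in>p. ?c q * iter_deriv is (?G q) y)) \<le> ?E * e' + e' * ?E"
        using norm_triangle_ineq4[of "(LINT z|lborel. ?D z) - integral (cbox a c) ?D" "(\<Sum>q\<in>p. ?c q * iter_deriv is (?G q) y) - integral (cbox a c) ?D"] 1 2
        by (simp only: diff_diff_eq2 diff_add_cancel) 
      moreover have "iter_deriv is ?s = (\<lambda>y. \<Sum>q\<in>p. ?c q * iter_deriv is (?G q) y)"
        by (rule iter_deriv_sum) (rule smooth_G)
      ultimately show "cmod (iter_deriv is ?g y - iter_deriv is ?s y)
          \<le> 2 * e' * gauss (b / 2) y * ((2 * h) ^ length is * sqrt (fact (length is)))"
        unfolding iter_deriv_integral by (simp add: mult_ac)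
    qed
    hence A: "cmod (u (\<lambda>y. ?g y - ?s y)) \<le> C * (2 * e')" by (rule C(2))
    have gS: "?g \<in> gs_S (1/2)" by (rule deriv_bound_imp_gs_S[OF deriv_bound_integral]) (use pos in auto)
    have A': "u (\<lambda>y. ?g y - ?s y) = u ?g - u ?s"
      using gs_S_dual_lin[OF u gS s(1), of 1 "-1"] by simp
    have B: "cmod (u ?s - integral (cbox a c) (\<lambda>z. u (G z))) \<le> (C * d) * m"
      unfolding m_def s(2)
    proof (rule Riemann_sum_error[OF p(1) cu])
      fix x k z assume "(x, k) \<in> p" "z \<in> k"
      from C(2)[OF close[OF this]]
      show "cmod (u (G x) - u (G z)) \<le> C * d"
        using gs_S_dual_lin[OF u G_in_gs_S G_in_gs_S, of 1 x "-1" z] by simp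
    qed
    have B': "(C * d) * m \<le> C * e'" using mult_left_mono[OF d(2), of C] C by (simp add: mult_ac)
    have D: "cmod ((LINT z|lborel. u (G z)) - integral (cbox a c) (\<lambda>z. u (G z))) \<le> C * e'"
      by (rule order_trans[OF integral_split_box(2)[OF cu uG, of a c] mult_left_mono]) (use ac C in auto)
    have tri: "cmod (x - z) \<le> cmod (x - s) + cmod (s - i) + cmod (z - i)" for x z s i
      using norm_triangle_ineq4[of "(x - s) + (s - i)" "z - i"] norm_triangle_ineq[of "x - s" "s - i"] by simp
    have "C * (2 * e') + C * e' + C * e' = e" using C by (simp add: e'_def)
    thus ?thesis
      using tri[of "u ?g" "LINT z|lborel. u (G z)" "u ?s" "integral (cbox a c) (\<lambda>z. u (G z))"] A B B' D
      unfolding A' by linarith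
  qed
  hence "cmod (u ?g - (LINT z|lborel. u (G z))) \<le> 0" by (rule field_le_epsilon)
  thus "u ?g = (LINT z|lborel. u (G z))" by simp
qed

end

end

section \<open>Gaussian integrals and Fourier inversion\<close>

lemma lborel_integral_prod_Basis:
  fixes f :: "'a::euclidean_space \<Rightarrow> real \<Rightarrow> complex"
  assumes int: "\<And>b. b \<in> Basis \<Longrightarrow> integrable lborel (f b)"
  shows "integrable lborel (\<lambda>x. \<Prod>b\<in>Basis. f b (x \<bullet> b))"
    and "(LINT x|lborel. (\<Prod>b\<in>Basis. f b (x \<bullet> b))) = (\<Prod>b\<in>Basis. LINT t|lborel. f b t)"
proof -
  interpret product_sigma_finite "\<lambda>_ :: 'a. lborel :: real measure" by standard
  let ?g = "\<lambda>x :: 'a. \<Prod>b\<in>Basis. f b (x \<bullet> b)" and ?T = "\<lambda>y. \<Sum>b\<in>Basis. y b *\<^sub>R (b :: 'a)"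
  have [measurable]: "f b \<in> borel_measurable borel" if "b \<in> Basis" for b
    using int[OF that] by (auto dest: borel_measurable_integrable)
  have g: "?g \<in> borel_measurable borel" by measurable
  have T: "?T \<in> measurable (\<Pi>\<^sub>M b\<in>Basis. lborel) borel" by measurable
  have eq: "?g (?T y) = (\<Prod>b\<in>Basis. f b (y b))" for y
    by (rule prod.cong) (auto simp: inner_sum_left inner_Basis if_distrib cong: if_cong)
  have "integrable (\<Pi>\<^sub>M b\<in>Basis. lborel) (\<lambda>y. \<Prod>b\<in>Basis. f b (y b))"
    by (rule product_integrable_prod) (auto intro: int)
  hence "integrable (distr (\<Pi>\<^sub>M b\<in>Basis. lborel) borel ?T) ?g"
    by (subst integrable_distr_eq[OF T g]) (simp only: eq)
  thus "integrable lborel ?g" by (simp only: lborel_eq[symmetric])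
  have "(LINT x|distr (\<Pi>\<^sub>M b\<in>Basis. lborel) borel ?T. ?g x) = (LINT y|(\<Pi>\<^sub>M b\<in>Basis. lborel). ?g (?T y))"
    by (rule integral_distr[OF T g])
  also have "\<dots> = (\<Prod>b\<in>Basis. LINT t|lborel. f b t)"
    unfolding eq by (rule product_integral_prod) (auto intro: int)
  finally show "(LINT x|lborel. ?g x) = (\<Prod>b\<in>Basis. LINT t|lborel. f b t)" by (simp only: lborel_eq[symmetric])
qed

text \<open>The characteristic function of the standard normal distribution, rescaled.\<close>

lemma gaussian_fourier_1d:
  fixes \<delta> s :: real
  assumes "\<delta> > 0"
  shows "integrable lborel (\<lambda>t. complex_of_real (exp (- \<delta> * t\<^sup>2)) * cis (t * s))"
    and "(LINT t|lborel. complex_of_real (exp (- \<delta> * t\<^sup>2)) * cis (t * s)) = complex_of_real (sqrt (pi / \<delta>) * exp (- s\<^sup>2 / (4 * \<delta>)))"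
proof -
  let ?c = "sqrt (2 * \<delta>)"
  have c: "?c > 0" "?c\<^sup>2 = 2 * \<delta>" using assms by auto
  let ?F = "\<lambda>x. std_normal_density x *\<^sub>R cis ((s / ?c) * x)"
  have "integrable lborel ?F"
  proof (rule Bochner_Integration.integrable_bound[OF integrable_normal_density[of 1 0]])
    have "(\<lambda>x. cis ((s / ?c) * x)) \<in> borel_measurable borel"
      by (intro borel_measurable_continuous_onI continuous_intros)
    thus "?F \<in> borel_measurable lborel" by (intro borel_measurable_scaleR) auto
  qed auto
  moreover have "(LINT x|lborel. ?F x) = complex_of_real (exp (- ((s / ?c)\<^sup>2) / 2))"
  proof -
    have "(LINT x|lborel. ?F x) = char std_normal_distribution (s / ?c)"
      unfolding char_def by (subst integral_density) (auto simp: cis_conv_exp mult_ac intro!: borel_measurable_continuous_onI continuous_intros)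
    thus ?thesis by (simp add: char_std_normal_distribution)
  qed
  ultimately have "has_bochner_integral lborel ?F (complex_of_real (exp (- ((s / ?c)\<^sup>2) / 2)))"
    by (simp add: has_bochner_integral_iff)
  hence "has_bochner_integral lborel (\<lambda>x. ?F (0 + ?c * x)) (complex_of_real (exp (- ((s / ?c)\<^sup>2) / 2)) /\<^sub>R \<bar>?c\<bar>)"
    using c by (subst (asm) lborel_has_bochner_integral_real_affine_iff[of ?c _ _ 0]) auto
  hence "has_bochner_integral lborel (\<lambda>x. sqrt (2 * pi) *\<^sub>R ?F (0 + ?c * x)) (sqrt (2 * pi) *\<^sub>R (complex_of_real (exp (- ((s / ?c)\<^sup>2) / 2)) /\<^sub>R \<bar>?c\<bar>))"
    by (rule has_bochner_integral_scaleR_right)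
  moreover have "sqrt (2 * pi) *\<^sub>R ?F (0 + ?c * x) = complex_of_real (exp (- \<delta> * x\<^sup>2)) * cis (x * s)" for x
  proof -
    have "(?c * x)\<^sup>2 = 2 * \<delta> * x\<^sup>2" by (simp add: power_mult_distrib c(2) del: real_sqrt_pow2_iff)
    moreover have "(s / ?c) * (?c * x) = x * s" using c(1) by simp
    ultimately show ?thesis by (simp add: normal_density_def scaleR_conv_of_real)
  qed
  moreover have "sqrt (2 * pi) *\<^sub>R (complex_of_real (exp (- ((s / ?c)\<^sup>2) / 2)) /\<^sub>R \<bar>?c\<bar>)
      = complex_of_real (sqrt (pi / \<delta>) * exp (- s\<^sup>2 / (4 * \<delta>)))"
  proof -
    have "(s / ?c)\<^sup>2 = s\<^sup>2 / (2 * \<delta>)" by (simp add: power_divide c(2) del: real_sqrt_pow2_iff)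
    moreover have "sqrt (2 * pi) / ?c = sqrt (pi / \<delta>)" using assms by (simp add: real_sqrt_divide[symmetric])
    moreover have "sqrt (2 * pi) *\<^sub>R (complex_of_real E /\<^sub>R \<bar>?c\<bar>) = complex_of_real ((sqrt (2 * pi) / ?c) * E)" for E
      using c(1) by (simp add: scaleR_conv_of_real divide_inverse del: real_sqrt_eq_iff)
    ultimately show ?thesis by simp
  qed
  ultimately have "has_bochner_integral lborel (\<lambda>x. complex_of_real (exp (- \<delta> * x\<^sup>2)) * cis (x * s)) (complex_of_real (sqrt (pi / \<delta>) * exp (- s\<^sup>2 / (4 * \<delta>))))"
    by simp
  thus "integrable lborel (\<lambda>t. complex_of_real (exp (- \<delta> * t\<^sup>2)) * cis (t * s))"
    and "(LINT t|lborel. complex_of_real (exp (- \<delta> * t\<^sup>2)) * cis (t * s)) = complex_of_real (sqrt (pi / \<delta>) * exp (- s\<^sup>2 / (4 * \<delta>)))"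
    by (simp_all add: has_bochner_integral_iff)
qed

lemma cis_sum: "cis (\<Sum>b\<in>A. f b) = (\<Prod>b\<in>A. cis (f b))"
  by (induct A rule: infinite_finite_induct) (simp_all add: cis_mult[symmetric])

lemma norm_sq_Basis: "(norm (x :: 'a::euclidean_space))\<^sup>2 = (\<Sum>b\<in>Basis. (x \<bullet> b)\<^sup>2)"
  unfolding power2_norm_eq_inner by (subst euclidean_inner) (simp add: power2_eq_square)

lemma gaussian_fourier:
  fixes s :: "'a::euclidean_space"
  assumes "\<delta> > 0"
  shows "integrable lborel (\<lambda>x. complex_of_real (gauss \<delta> x) * cis (x \<bullet> s))"
    and "(LINT x|lborel. complex_of_real (gauss \<delta> x) * cis (x \<bullet> s))
      = complex_of_real (sqrt (pi / \<delta>) ^ DIM('a) * exp (- (norm s)\<^sup>2 / (4 * \<delta>)))"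
proof -
  let ?f = "\<lambda>b t. complex_of_real (exp (- \<delta> * t\<^sup>2)) * cis (t * (s \<bullet> b))"
  have eq: "complex_of_real (gauss \<delta> x) * cis (x \<bullet> s) = (\<Prod>b\<in>Basis. ?f b (x \<bullet> b))" for x :: 'a
    unfolding prod.distrib euclidean_inner[of x s] cis_sum norm_sq_Basis sum_distrib_left
    by (simp add: exp_sum)
  show "integrable lborel (\<lambda>x. complex_of_real (gauss \<delta> x) * cis (x \<bullet> s))"
    unfolding eq by (rule lborel_integral_prod_Basis) (rule gaussian_fourier_1d[OF assms])
  have "(\<Sum>b\<in>Basis. - (s \<bullet> b)\<^sup>2 / (4 * \<delta>)) = - (norm s)\<^sup>2 / (4 * \<delta>)"
    unfolding norm_sq_Basis by (simp add: sum_divide_distrib sum_negf)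
  hence "(\<Prod>b\<in>Basis. LINT t|lborel. ?f b t) = complex_of_real (sqrt (pi / \<delta>) ^ DIM('a) * exp (- (norm s)\<^sup>2 / (4 * \<delta>)))"
    unfolding gaussian_fourier_1d(2)[OF assms] of_real_prod[symmetric]
    by (simp add: prod.distrib exp_sum[symmetric])
  thus "(LINT x|lborel. complex_of_real (gauss \<delta> x) * cis (x \<bullet> s))
      = complex_of_real (sqrt (pi / \<delta>) ^ DIM('a) * exp (- (norm s)\<^sup>2 / (4 * \<delta>)))"
    unfolding eq by (subst lborel_integral_prod_Basis(2)) (rule gaussian_fourier_1d[OF assms])+
qed

lemma gaussian_integral:
  assumes "\<delta> > 0"
  shows "integrable lborel (\<lambda>x :: 'a::euclidean_space. gauss \<delta> x)"
    and "(LINT x|lborel. gauss \<delta> (x :: 'a::euclidean_space)) = sqrt (pi / \<delta>) ^ DIM('a)"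
proof -
  have "integrable lborel (\<lambda>x :: 'a. complex_of_real (gauss \<delta> x))"
    using gaussian_fourier(1)[OF assms, of "0 :: 'a"] by simp
  thus "integrable lborel (\<lambda>x :: 'a. gauss \<delta> x)" by (simp only: complex_of_real_integrable_eq)
  have "(LINT x|lborel. complex_of_real (gauss \<delta> (x::'a))) = complex_of_real (sqrt (pi / \<delta>) ^ DIM('a))"
    using gaussian_fourier(2)[OF assms, of "0 :: 'a"] by simp
  thus "(LINT x|lborel. gauss \<delta> (x :: 'a)) = sqrt (pi / \<delta>) ^ DIM('a)"
    by (simp only: integral_complex_of_real of_real_eq_iff)
qed

lemma lborel_integral_shift:
  fixes f :: "'a::euclidean_space \<Rightarrow> 'b::{banach, second_countable_topology}"
  assumes "f \<in> borel_measurable borel"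
  shows "(LINT x|lborel. f (x - c)) = (LINT x|lborel. f x)" "integrable lborel (\<lambda>x. f (x - c)) \<longleftrightarrow> integrable lborel f"
proof -
  have m: "(+) (- c) \<in> measurable lborel borel" by simp
  have "(LINT x|distr lborel borel ((+) (- c)). f x) = (LINT x|lborel. f (- c + x))"
    by (rule integral_distr[OF m assms])
  thus "(LINT x|lborel. f (x - c)) = (LINT x|lborel. f x)" by (simp add: lborel_distr_plus)
  have "integrable (distr lborel borel ((+) (- c))) f \<longleftrightarrow> integrable lborel (\<lambda>x. f (- c + x))"
    by (rule integrable_distr_eq[OF m assms])
  thus "integrable lborel (\<lambda>x. f (x - c)) \<longleftrightarrow> integrable lborel f" by (simp add: lborel_distr_plus)
qed

lemma gaussian_integral_shift:
  fixes x :: "'a::euclidean_space"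
  assumes "\<beta> > 0"
  shows "integrable lborel (\<lambda>t. gauss \<beta> (t - x))"
    "(LINT t|lborel. gauss \<beta> (t - x)) = sqrt (pi / \<beta>) ^ DIM('a)"
proof -
  have m: "(\<lambda>t :: 'a. gauss \<beta> t) \<in> borel_measurable borel" by measurable
  show "integrable lborel (\<lambda>t. gauss \<beta> (t - x))"
    "(LINT t|lborel. gauss \<beta> (t - x)) = sqrt (pi / \<beta>) ^ DIM('a)"
    using lborel_integral_shift[OF m, of x] gaussian_integral[OF assms, where 'a='a] by auto
qed

text \<open>The function \<open>g\<close> may be unbounded, so the part away from \<open>y\<close> is estimated through the
  supremum of the Gaussian there, and half of the exponent is kept to integrate the constant \<open>g(y)\<close>.\<close>

lemma gaussian_approximate_identity:
  fixes g :: "'a::euclidean_space \<Rightarrow> complex"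
  assumes g: "integrable lborel g" and cont: "isCont g y"
  defines "\<delta> \<equiv> \<lambda>n. 1 / real (Suc n)"
  shows "(\<lambda>n. LINT t|lborel. g t * complex_of_real (sqrt (pi / \<delta> n) ^ DIM('a) * exp (- (norm (t - y))\<^sup>2 / (4 * \<delta> n))))
    \<longlonglongrightarrow> complex_of_real ((2 * pi) ^ DIM('a)) * g y"
proof -
  let ?d = "DIM('a)"
  define K where "K = (\<lambda>n t. sqrt (pi / \<delta> n) ^ ?d * gauss (1 / (4 * \<delta> n)) (t - y))"
  have \<delta>: "\<delta> n > 0" for n by (simp add: \<delta>_def)
  have gm: "g \<in> borel_measurable borel" using g by (auto dest: borel_measurable_integrable)
  have K: "integrable lborel (K n)" "(LINT t|lborel. K n t) = (2 * pi) ^ ?d" for n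
  proof -
    have a: "1 / (4 * \<delta> n) > 0" using \<delta> by simp
    show "integrable lborel (K n)" unfolding K_def using gaussian_integral_shift(1)[OF a, of y] by (rule integrable_mult_right)
    have "(LINT t|lborel. K n t) = sqrt (pi / \<delta> n) ^ ?d * sqrt (pi / (1 / (4 * \<delta> n))) ^ ?d"
      unfolding K_def by (simp only: integral_mult_right_zero gaussian_integral_shift(2)[OF a, of y])
    also have "\<dots> = (sqrt (pi / \<delta> n) * sqrt (pi / (1 / (4 * \<delta> n)))) ^ ?d" by (simp only: power_mult_distrib)
    also have "sqrt (pi / \<delta> n) * sqrt (pi / (1 / (4 * \<delta> n))) = 2 * pi"
    proof -
      have "sqrt (pi / \<delta> n) * sqrt (pi / (1 / (4 * \<delta> n))) = sqrt ((2 * pi)\<^sup>2)"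
        unfolding real_sqrt_mult[symmetric] using \<delta>[of n] by (simp add: power2_eq_square)
      thus ?thesis unfolding real_sqrt_abs by simp
    qed
    finally show "(LINT t|lborel. K n t) = (2 * pi) ^ ?d" by simp
  qed
  have K0: "K n t \<ge> 0" for n t using \<delta>[of n] by (simp add: K_def)
  have bddK: "K n t \<le> sqrt (pi / \<delta> n) ^ ?d" for n t
  proof -
    have "gauss (1 / (4 * \<delta> n)) (t - y) \<le> 1" using \<delta>[of n] by simp
    thus ?thesis unfolding K_def using \<delta>[of n] by (simp add: mult_left_le)
  qed
  have gK: "integrable lborel (\<lambda>t. g t * complex_of_real (K n t))" for n
  proof (rule Bochner_Integration.integrable_bound[OF integrable_mult_right[OF g, of "complex_of_real (sqrt (pi / \<delta> n) ^ ?d)"]])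
    show "(\<lambda>t. g t * complex_of_real (K n t)) \<in> borel_measurable lborel" unfolding K_def using gm by measurable
    show "AE t in lborel. norm (g t * complex_of_real (K n t)) \<le> norm (complex_of_real (sqrt (pi / \<delta> n) ^ ?d) * g t)"
    proof (rule AE_I2)
      fix t
      have "cmod (g t) * K n t \<le> cmod (g t) * sqrt (pi / \<delta> n) ^ ?d" by (intro mult_left_mono bddK) auto
      thus "norm (g t * complex_of_real (K n t)) \<le> norm (complex_of_real (sqrt (pi / \<delta> n) ^ ?d) * g t)"
        using K0[of n t] \<delta>[of n] by (simp add: norm_mult norm_power mult.commute)
    qed
  qed
  have "(\<lambda>n. (LINT t|lborel. g t * complex_of_real (K n t)) - complex_of_real ((2 * pi) ^ ?d) * g y) \<longlonglongrightarrow> 0"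
  proof (rule LIMSEQ_I)
    fix e0 :: real assume "e0 > 0"
    define e where "e = e0 / (2 * (2 * pi) ^ ?d)"
    have e: "e > 0" using \<open>e0 > 0\<close> by (simp add: e_def)
    obtain \<eta> where \<eta>: "\<eta> > 0" "\<And>t. norm (t - y) < \<eta> \<Longrightarrow> cmod (g t - g y) < e"
      using cont e unfolding continuous_at_eps_delta dist_norm by blast
    define A where "A = (\<lambda>n. exp (- \<eta>\<^sup>2 * real (Suc n) / 8))"
    define R where "R = (\<lambda>n. A n * (sqrt (pi * real (Suc n)) ^ ?d * (LINT t|lborel. cmod (g t)) + cmod (g y) * (sqrt (pi * real (Suc n)) * sqrt (8 * pi / real (Suc n))) ^ ?d))"
    have est: "cmod ((LINT t|lborel. g t * complex_of_real (K n t)) - complex_of_real ((2 * pi) ^ ?d) * g y) \<le> e * (2 * pi) ^ ?d + R n" for n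
    proof -
      have a: "1 / (8 * \<delta> n) > 0" using \<delta> by simp
      let ?E = "\<lambda>t. gauss (1 / (8 * \<delta> n)) (t - y)"
      let ?w = "\<lambda>t. e * K n t + A n * (sqrt (pi / \<delta> n) ^ ?d * cmod (g t) + cmod (g y) * sqrt (pi / \<delta> n) ^ ?d * ?E t)"
      have "(LINT t|lborel. g t * complex_of_real (K n t)) - complex_of_real ((2 * pi) ^ ?d) * g y
          = (LINT t|lborel. g t * complex_of_real (K n t)) - (LINT t|lborel. complex_of_real (K n t) * g y)"
        using K(2)[of n] by simp
      also have "\<dots> = (LINT t|lborel. (g t - g y) * complex_of_real (K n t))"
        using gK[of n] integrable_mult_left[OF integrable_of_real[OF K(1)[of n]], of "g y"]
        by (subst Bochner_Integration.integral_diff[symmetric]) (auto simp: algebra_simps)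
      also have "cmod \<dots> \<le> (LINT t|lborel. ?w t)"
      proof (rule order_trans[OF integral_norm_bound integral_mono])
        show "integrable lborel (\<lambda>t. norm ((g t - g y) * complex_of_real (K n t)))"
          using Bochner_Integration.integrable_diff[OF gK[of n] integrable_mult_left[OF integrable_of_real[OF K(1)[of n]], of "g y"]]
          by (intro integrable_norm) (simp add: algebra_simps)
        show "integrable lborel ?w"
          using K(1)[of n] gaussian_integral_shift(1)[OF a, of y] integrable_norm[OF g] by (intro Bochner_Integration.integrable_add integrable_mult_right)
        fix t
        show "norm ((g t - g y) * complex_of_real (K n t)) \<le> ?w t"
        proof (cases "norm (t - y) < \<eta>")
          case True
          have "norm ((g t - g y) * complex_of_real (K n t)) \<le> e * K n t"
            using \<eta>(2)[OF True] K0[of n t] by (simp add: norm_mult mult_right_mono)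
          moreover have "0 \<le> A n * (sqrt (pi / \<delta> n) ^ ?d * cmod (g t) + cmod (g y) * sqrt (pi / \<delta> n) ^ ?d * ?E t)"
            using \<delta>[of n] by (simp add: A_def)
          ultimately show ?thesis by linarith
        next
          case False
          hence "\<eta>\<^sup>2 \<le> (norm (t - y))\<^sup>2" using \<eta>(1) by (intro power_mono) auto
          hence "(1 / (8 * \<delta> n)) * \<eta>\<^sup>2 \<le> (1 / (8 * \<delta> n)) * (norm (t - y))\<^sup>2" using \<delta>[of n] by (intro mult_left_mono) auto
          hence E: "?E t \<le> A n" by (simp add: A_def \<delta>_def mult_ac)
          have Ksplit: "K n t = sqrt (pi / \<delta> n) ^ ?d * (?E t * ?E t)"
            using \<delta>[of n] by (simp add: K_def field_simps flip: exp_add)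
          have E1: "?E t \<le> 1" using \<delta>[of n] by simp
          have "norm ((g t - g y) * complex_of_real (K n t)) \<le> (cmod (g t) + cmod (g y)) * K n t"
            using K0[of n t] by (simp add: norm_mult mult_right_mono norm_triangle_ineq4)
          also have "\<dots> = sqrt (pi / \<delta> n) ^ ?d * cmod (g t) * (?E t * ?E t) + cmod (g y) * sqrt (pi / \<delta> n) ^ ?d * ?E t * ?E t"
            by (simp add: Ksplit algebra_simps)
          also have "\<dots> \<le> sqrt (pi / \<delta> n) ^ ?d * cmod (g t) * (A n * 1) + cmod (g y) * sqrt (pi / \<delta> n) ^ ?d * ?E t * A n"
            using E E1 \<delta>[of n] by (intro add_mono mult_left_mono mult_mono) (auto simp: A_def)
          also have "\<dots> \<le> ?w t" using e K0[of n t] by (simp add: algebra_simps)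
          finally show ?thesis .
        qed
      qed
      also have "\<dots> = e * (2 * pi) ^ ?d + A n * (sqrt (pi / \<delta> n) ^ ?d * (LINT t|lborel. cmod (g t)) + cmod (g y) * sqrt (pi / \<delta> n) ^ ?d * sqrt (pi / (1 / (8 * \<delta> n))) ^ ?d)"
        using K(1)[of n] gaussian_integral_shift(1)[OF a, of y] integrable_norm[OF g]
        by (simp only: Bochner_Integration.integral_add integrable_mult_right Bochner_Integration.integrable_add integral_mult_right_zero K(2) gaussian_integral_shift(2)[OF a, of y])
      also have "\<dots> = e * (2 * pi) ^ ?d + R n"
        by (simp add: R_def \<delta>_def power_mult_distrib mult_ac)
      finally show ?thesis .
    qed
    have "R \<longlonglongrightarrow> 0"
    proof -
      have 1: "(\<lambda>n. exp (- \<eta>\<^sup>2 * real (Suc n) / 8) * sqrt (pi * real (Suc n)) ^ ?d) \<longlonglongrightarrow> 0"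
        using \<eta>(1) by real_asymp
      have 2: "(\<lambda>n. exp (- \<eta>\<^sup>2 * real (Suc n) / 8) * (sqrt (pi * real (Suc n)) * sqrt (8 * pi / real (Suc n))) ^ ?d) \<longlonglongrightarrow> 0"
        using \<eta>(1) by real_asymp
      have "(\<lambda>n. (exp (- \<eta>\<^sup>2 * real (Suc n) / 8) * sqrt (pi * real (Suc n)) ^ ?d) * (LINT t|lborel. cmod (g t))
          + cmod (g y) * (exp (- \<eta>\<^sup>2 * real (Suc n) / 8) * (sqrt (pi * real (Suc n)) * sqrt (8 * pi / real (Suc n))) ^ ?d)) \<longlonglongrightarrow> 0 * (LINT t|lborel. cmod (g t)) + cmod (g y) * 0"
        by (intro tendsto_add tendsto_mult tendsto_const 1 2)
      thus ?thesis unfolding R_def A_def by (simp add: algebra_simps)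
    qed
    hence "eventually (\<lambda>n. R n < e0 / 2) sequentially" using \<open>e0 > 0\<close> by (intro order_tendstoD(2)) auto
    then obtain N where N: "\<And>n. n \<ge> N \<Longrightarrow> R n < e0 / 2" unfolding eventually_sequentially by blast
    show "\<exists>no. \<forall>n\<ge>no. norm ((LINT t|lborel. g t * complex_of_real (K n t)) - complex_of_real ((2 * pi) ^ ?d) * g y - 0) < e0"
    proof (intro exI allI impI)
      fix n assume "n \<ge> N"
      moreover have "e * (2 * pi) ^ ?d = e0 / 2" by (simp add: e_def)
      ultimately show "norm ((LINT t|lborel. g t * complex_of_real (K n t)) - complex_of_real ((2 * pi) ^ ?d) * g y - 0) < e0"
        using est[of n] N[of n] by simp
    qed
  qed
  hence "(\<lambda>n. LINT t|lborel. g t * complex_of_real (K n t)) \<longlonglongrightarrow> complex_of_real ((2 * pi) ^ ?d) * g y"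
    by (simp only: LIM_zero_iff)
  thus ?thesis by (simp add: K_def)
qed

lemma integrable_times_bounded_continuous:
  fixes f w :: "'a::euclidean_space \<Rightarrow> complex"
  assumes "integrable lborel f" "continuous_on UNIV w" "\<And>x. cmod (w x) \<le> B"
  shows "integrable lborel (\<lambda>x. f x * w x)"
proof (rule Bochner_Integration.integrable_bound[OF integrable_mult_right[OF assms(1), of "complex_of_real B"]])
  show "(\<lambda>x. f x * w x) \<in> borel_measurable lborel"
    using assms(1) borel_measurable_continuous_onI[OF assms(2)] by auto
  have "0 \<le> B" using assms(3)[of 0] norm_ge_zero order_trans by blast
  thus "AE x in lborel. norm (f x * w x) \<le> norm (complex_of_real B * f x)"
    using mult_left_mono[OF assms(3) norm_ge_zero] by (intro AE_I2) (simp add: norm_mult mult.commute)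
qed

text \<open>Insert the factor \<open>exp(-\<delta>|\<xi>|\<^sup>2)\<close> and let \<open>\<delta> \<rightarrow> 0\<close>: on one side dominated convergence applies, and
  on the other side Fubini's theorem turns the integral into a mean of \<open>g\<close> against a narrowing
  Gaussian.\<close>

theorem Fourier_inversion:
  fixes g :: "'a::euclidean_space \<Rightarrow> complex"
  defines "G \<equiv> \<lambda>\<xi>. LINT t|lborel. g t * cis (- (t \<bullet> \<xi>))"
  assumes g: "integrable lborel g" and cont: "isCont g y" and G: "integrable lborel G"
  shows "(LINT \<xi>|lborel. G \<xi> * cis (y \<bullet> \<xi>)) = complex_of_real ((2 * pi) ^ DIM('a)) * g y"
proof -
  let ?d = "DIM('a)"
  let ?\<delta> = "\<lambda>n. 1 / real (Suc n)"
  let ?e = "\<lambda>n \<xi> :: 'a. complex_of_real (gauss (?\<delta> n) \<xi>)"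
  have [measurable]: "g \<in> borel_measurable borel" "G \<in> borel_measurable borel"
    using g G by (auto dest: borel_measurable_integrable)
  have cont_cis: "continuous_on UNIV (\<lambda>t. cis (f t))" if "continuous_on UNIV f" for f :: "'a \<Rightarrow> real"
    using that by (intro continuous_intros)
  have cism[measurable]: "(\<lambda>x. cis (f x)) \<in> borel_measurable M" if "f \<in> borel_measurable M" for f and M :: "'z measure"
    using measurable_compose[OF that borel_measurable_continuous_onI[OF continuous_on_cis[OF continuous_on_id]]] by simp
  have "(\<lambda>n. LINT \<xi>|lborel. G \<xi> * cis (y \<bullet> \<xi>) * ?e n \<xi>) \<longlonglongrightarrow> (LINT \<xi>|lborel. G \<xi> * cis (y \<bullet> \<xi>))"
  proof (rule integral_dominated_convergence[where w = "\<lambda>\<xi>. norm (G \<xi>)"])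
    show "AE \<xi> in lborel. (\<lambda>n. G \<xi> * cis (y \<bullet> \<xi>) * ?e n \<xi>) \<longlonglongrightarrow> G \<xi> * cis (y \<bullet> \<xi>)"
    proof (rule AE_I2)
      fix \<xi> :: 'a
      have "(\<lambda>n. gauss (?\<delta> n) \<xi>) \<longlonglongrightarrow> 1" by real_asymp
      from tendsto_mult[OF tendsto_const tendsto_of_real[OF this]]
      show "(\<lambda>n. G \<xi> * cis (y \<bullet> \<xi>) * ?e n \<xi>) \<longlonglongrightarrow> G \<xi> * cis (y \<bullet> \<xi>)" by simp
    qed
    show "integrable lborel (\<lambda>\<xi>. norm (G \<xi>))" using G by (rule integrable_norm)
    show "AE \<xi> in lborel. norm (G \<xi> * cis (y \<bullet> \<xi>) * ?e n \<xi>) \<le> norm (G \<xi>)" for n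
      by (intro AE_I2) (simp add: norm_mult mult_left_le)
  qed measurable
  moreover have "(LINT \<xi>|lborel. G \<xi> * cis (y \<bullet> \<xi>) * ?e n \<xi>)
      = (LINT t|lborel. g t * complex_of_real (sqrt (pi / ?\<delta> n) ^ ?d * exp (- (norm (t - y))\<^sup>2 / (4 * ?\<delta> n))))" for n
  proof -
    have \<delta>: "?\<delta> n > 0" by simp
    let ?H = "\<lambda>t \<xi>. g t * (?e n \<xi> * cis (\<xi> \<bullet> (y - t)))"
    have en: "integrable lborel (\<lambda>\<xi>. ?e n \<xi>)" using gaussian_fourier(1)[OF \<delta>, of 0] by simp
    have Hm: "(\<lambda>(t, \<xi>). ?H t \<xi>) \<in> borel_measurable (lborel \<Otimes>\<^sub>M lborel)" by measurable
    have "integrable (lborel \<Otimes>\<^sub>M lborel) (\<lambda>(t, \<xi>). ?H t \<xi>)"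
    proof (rule lborel_pair.Fubini_integrable[OF Hm])
      show "AE t in lborel. integrable lborel (\<lambda>\<xi>. (\<lambda>(t, \<xi>). ?H t \<xi>) (t, \<xi>))"
        unfolding prod.case by (intro AE_I2 integrable_mult_right gaussian_fourier(1)[OF \<delta>])
      have "(LINT \<xi>|lborel. norm ((\<lambda>(t, \<xi>). ?H t \<xi>) (t, \<xi>))) = norm (g t) * (LINT \<xi>|lborel. norm (?e n \<xi>))" for t
        by (simp add: norm_mult)
      thus "integrable lborel (\<lambda>t. LINT \<xi>|lborel. norm ((\<lambda>(t, \<xi>). ?H t \<xi>) (t, \<xi>)))"
        using integrable_norm[OF g] by (simp only: integrable_mult_left)
    qed
    from lborel_pair.Fubini_integral[OF this]
    have "(LINT \<xi>|lborel. LINT t|lborel. ?H t \<xi>) = (LINT t|lborel. LINT \<xi>|lborel. ?H t \<xi>)" by simp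
    also have "(LINT \<xi>|lborel. LINT t|lborel. ?H t \<xi>) = (LINT \<xi>|lborel. G \<xi> * cis (y \<bullet> \<xi>) * ?e n \<xi>)"
    proof (rule Bochner_Integration.integral_cong[OF refl])
      fix \<xi> :: 'a
      have "?H t \<xi> = (g t * cis (- (t \<bullet> \<xi>))) * (cis (y \<bullet> \<xi>) * ?e n \<xi>)" for t
        by (simp add: inner_diff_right cis_mult inner_commute mult_ac)
      thus "(LINT t|lborel. ?H t \<xi>) = G \<xi> * cis (y \<bullet> \<xi>) * ?e n \<xi>"
        by (simp only: G_def integral_mult_left_zero mult.assoc[of "G \<xi>"] mult.assoc[of "integral\<^sup>L _ _"])
    qed
    also have "(LINT t|lborel. LINT \<xi>|lborel. ?H t \<xi>) = (LINT t|lborel. g t * complex_of_real (sqrt (pi / ?\<delta> n) ^ ?d * exp (- (norm (t - y))\<^sup>2 / (4 * ?\<delta> n))))"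
      by (simp only: integral_mult_right_zero gaussian_fourier(2)[OF \<delta>] norm_minus_commute[of y])
    finally show ?thesis .
  qed
  ultimately have "(\<lambda>n. LINT t|lborel. g t * complex_of_real (sqrt (pi / ?\<delta> n) ^ ?d * exp (- (norm (t - y))\<^sup>2 / (4 * ?\<delta> n))))
      \<longlonglongrightarrow> (LINT \<xi>|lborel. G \<xi> * cis (y \<bullet> \<xi>))" by simp
  from LIMSEQ_unique[OF this gaussian_approximate_identity[OF g cont]] show ?thesis .
qed

section \<open>Time-frequency shifts\<close>

text \<open>The difference of the two sides is \<open>|pu - qw|\<^sup>2 / (p + q)\<close>. With this inequality a product of
  Gaussians around two centres is bounded by a Gaussian in the distance of the centres.\<close>

lemma harmonic_norm_ineq:
  fixes u w :: "'a::real_inner"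
  assumes "0 < p" "0 < q"
  shows "(p * q / (p + q)) * (norm (u + w))\<^sup>2 \<le> p * (norm u)\<^sup>2 + q * (norm w)\<^sup>2"
proof -
  have "0 \<le> (norm (p *\<^sub>R u - q *\<^sub>R w))\<^sup>2" by simp
  also have "\<dots> = (p + q) * (p * (norm u)\<^sup>2 + q * (norm w)\<^sup>2) - p * q * (norm (u + w))\<^sup>2"
    unfolding power2_norm_eq_inner
    by (simp add: inner_add_left inner_add_right inner_diff_left inner_diff_right inner_commute algebra_simps power2_eq_square)
  finally have "p * q * (norm (u + w))\<^sup>2 \<le> (p + q) * (p * (norm u)\<^sup>2 + q * (norm w)\<^sup>2)" by simp
  thus ?thesis using assms by (simp add: pos_divide_le_eq mult.commute)
qed

text \<open>Shifts that carry the phase of the Fourier transform, so that the short-time Fourier transform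
  of \<open>f\<close> is \<open>f\<close> applied to the shifts of the conjugate window.\<close>

definition tf_shift :: "(real ^ 'd::finite \<Rightarrow> complex) \<Rightarrow> (real ^ 'd::_) \<times> (real ^ 'd::_) \<Rightarrow> real ^ 'd::_ \<Rightarrow> complex" where
  "tf_shift g X = (\<lambda>y. g (y - fst X) * cis (- (y \<bullet> snd X)))"

lemma smooth_tf_shift: "smooth g \<Longrightarrow> smooth (tf_shift g X)"
  unfolding tf_shift_def by (intro smooth_mult smooth_translate smooth_modulation)

text \<open>A derivative of a shift is a sum of shifts of derivatives with coefficients that are polynomials
  in the frequency. The factor \<open>c\<close> makes the statement stable under this.\<close>

lemma continuous_iter_deriv_tf_shift_poly:
  fixes g :: "real ^ 'd::finite \<Rightarrow> complex"
  assumes "smooth g" "continuous_on UNIV c"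
  shows "continuous_on UNIV (\<lambda>(X, y). iter_deriv is (\<lambda>y. c (snd X) * tf_shift g X y) y)"
  using assms
proof (induct "is" arbitrary: g c rule: rev_induct)
  case Nil
  have "continuous_on UNIV (\<lambda>q :: ((real ^ 'd) \<times> (real ^ 'd)) \<times> (real ^ 'd). g (snd q - fst (fst q)))"
    by (rule continuous_on_compose2[OF smooth_continuous[OF Nil(1), of UNIV]]) (auto intro!: continuous_intros)
  moreover have "continuous_on UNIV (\<lambda>q :: ((real ^ 'd) \<times> (real ^ 'd)) \<times> (real ^ 'd). c (snd (fst q)))"
    by (rule continuous_on_compose2[OF Nil(2)]) (auto intro!: continuous_intros)
  ultimately show ?case
    unfolding tf_shift_def case_prod_beta by (auto intro!: continuous_intros)
next
  case (snoc i "is")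
  let ?c' = "\<lambda>\<xi> :: real ^ 'd. c \<xi> * (- \<i> * complex_of_real (\<xi> $ i))"
  have eq: "iter_deriv (is @ [i]) (\<lambda>y. c (snd X) * tf_shift g X y) =
      (\<lambda>y. iter_deriv is (\<lambda>y. c (snd X) * tf_shift (partial_deriv i g) X y) y
        + iter_deriv is (\<lambda>y. ?c' (snd X) * tf_shift g X y) y)" for X
  proof -
    have sm: "smooth (\<lambda>y. a * tf_shift f X y)" if "smooth f" for a f
      using smooth_lin[OF smooth_tf_shift[OF that] smooth_zero, of a X 0] by simp
    have "partial_deriv i (\<lambda>y. c (snd X) * tf_shift g X y) y
      = c (snd X) * tf_shift (partial_deriv i g) X y + ?c' (snd X) * tf_shift g X y" for y
    proof -
      have 1: "(\<lambda>y. c (snd X) * tf_shift g X y) = (\<lambda>y. g (y - fst X) * (c (snd X) * cis (- (y \<bullet> snd X))))"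
        by (simp add: tf_shift_def mult_ac)
      have d: "(\<lambda>y. g (y - fst X)) differentiable (at y)" "(\<lambda>y. c (snd X) * cis (- (y \<bullet> snd X))) differentiable (at y)"
        by (rule smooth_differentiable[OF smooth_translate[OF snoc(2)]], rule differentiableI[OF has_derivative_modulation])
      show ?thesis
        unfolding 1 partial_deriv_mult[OF d] partial_deriv_translate[OF smooth_differentiable[OF snoc(2)]]
          partial_deriv_unique[OF has_derivative_modulation]
        by (simp add: tf_shift_def inner_axis' algebra_simps)
    qed
    hence pd: "partial_deriv i (\<lambda>y. c (snd X) * tf_shift g X y)
      = (\<lambda>y. 1 * (c (snd X) * tf_shift (partial_deriv i g) X y) + 1 * (?c' (snd X) * tf_shift g X y))"
      by (simp add: fun_eq_iff)
    have "iter_deriv (is @ [i]) (\<lambda>y. c (snd X) * tf_shift g X y)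
      = iter_deriv is (\<lambda>y. 1 * (c (snd X) * tf_shift (partial_deriv i g) X y) + 1 * (?c' (snd X) * tf_shift g X y))"
      unfolding iter_deriv_snoc pd ..
    also have "\<dots> = (\<lambda>y. iter_deriv is (\<lambda>y. c (snd X) * tf_shift (partial_deriv i g) X y) y
        + iter_deriv is (\<lambda>y. ?c' (snd X) * tf_shift g X y) y)"
      by (subst iter_deriv_lin[OF sm sm]) (auto intro: smooth_partial_deriv snoc)
    finally show ?thesis .
  qed
  have "continuous_on UNIV ?c'" using snoc(3) by (intro continuous_intros)
  from snoc(1)[OF smooth_partial_deriv[OF snoc(2)] snoc(3)] snoc(1)[OF snoc(2) this]
  show ?case unfolding eq case_prod_beta by (rule continuous_on_add)
qed

lemma continuous_iter_deriv_tf_shift: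
  "smooth g \<Longrightarrow> continuous_on UNIV (\<lambda>(X, y). iter_deriv is (tf_shift g X) y)"
  using continuous_iter_deriv_tf_shift_poly[of g "\<lambda>_. 1" "is"] by simp

text \<open>A test function with explicit rates. The main instance is the conjugate of the window; in the
  uniqueness of densities it is the window itself.\<close>

locale window =
  fixes g :: "real ^ 'd::{finite,linorder} \<Rightarrow> complex" and K h b :: real
  assumes bound_g: "deriv_bound (\<lambda>y. K * gauss b y) h g" and pos: "h > 0" "b > 0"
begin

lemma K_nonneg: "K \<ge> 0" using deriv_boundD(4)[OF bound_g, of 0] by simp

lemma smooth_g: "smooth g" using bound_g by (rule deriv_boundD)

lemma cont_g: "continuous_on S g" using smooth_g by (rule smooth_continuous)

lemma norm_g: "cmod (g y) \<le> K * gauss b y" using bound_g by (rule deriv_boundD)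

definition h' :: "real \<Rightarrow> real" where "h' \<epsilon> = h + 1 / sqrt (2 * \<epsilon>)"
definition b' :: "real \<Rightarrow> real" where "b' \<epsilon> = b * \<epsilon> / (b + \<epsilon>)"

lemma h'_pos: "\<epsilon> > 0 \<Longrightarrow> h' \<epsilon> > 0" and b'_pos: "\<epsilon> > 0 \<Longrightarrow> b' \<epsilon> > 0"
  using pos by (simp_all add: h'_def b'_def add_pos_pos)

text \<open>The growth rate \<open>\<epsilon>\<close> of the shifts is arbitrarily small, at the price of a larger step.\<close>

lemma deriv_bound_tf_shift:
  assumes "\<epsilon> > 0"
  shows "deriv_bound (\<lambda>y. K * exp (\<epsilon> * (norm X)\<^sup>2) * gauss (b' \<epsilon>) y) (h' \<epsilon>) (tf_shift g X)"
proof -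
  have "deriv_bound (\<lambda>y. K * gauss b (y - fst X) * exp (\<epsilon> * (norm (snd X))\<^sup>2)) (h + 1 / sqrt (2 * \<epsilon>)) (tf_shift g X)"
    unfolding tf_shift_def
    by (rule deriv_bound_mult[OF deriv_bound_translate[OF bound_g] deriv_bound_modulation]) (use assms pos in auto)
  thus ?thesis unfolding h'_def
  proof (rule deriv_bound_mono)
    fix y
    have "b' \<epsilon> * (norm y)\<^sup>2 \<le> b * (norm (y - fst X))\<^sup>2 + \<epsilon> * (norm (fst X))\<^sup>2"
      using harmonic_norm_ineq[of b \<epsilon> "y - fst X" "fst X"] pos assms by (simp add: b'_def)
    moreover have "(norm X)\<^sup>2 = (norm (fst X))\<^sup>2 + (norm (snd X))\<^sup>2" by (simp add: norm_prod_def)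
    ultimately have "- b * (norm (y - fst X))\<^sup>2 + \<epsilon> * (norm (snd X))\<^sup>2 \<le> \<epsilon> * (norm X)\<^sup>2 + - b' \<epsilon> * (norm y)\<^sup>2"
      by (simp add: algebra_simps)
    hence "gauss b (y - fst X) * exp (\<epsilon> * (norm (snd X))\<^sup>2) \<le> exp (\<epsilon> * (norm X)\<^sup>2) * gauss (b' \<epsilon>) y"
      by (simp flip: exp_add)
    from mult_left_mono[OF this K_nonneg]
    show "K * gauss b (y - fst X) * exp (\<epsilon> * (norm (snd X))\<^sup>2) \<le> K * exp (\<epsilon> * (norm X)\<^sup>2) * gauss (b' \<epsilon>) y"
      by (simp add: mult_ac)
  qed (use pos assms in auto)
qed

text \<open>The shifts are integrated against coefficients: over the frequencies to compute the Fourier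
  transform in the definition of the short-time Fourier transform, and over the phase space in the
  reproducing formula.\<close>

lemma gs_family_weighted:
  fixes w :: "'p::euclidean_space \<Rightarrow> complex" and \<tau> :: "'p \<Rightarrow> (real ^ 'd::_) \<times> (real ^ 'd::_)"
  assumes "\<epsilon> > 0" "continuous_on UNIV w" "continuous_on UNIV \<tau>"
  shows "gs_family (\<lambda>z y. w z * tf_shift g (\<tau> z) y) (\<lambda>z. cmod (w z) * (K * exp (\<epsilon> * (norm (\<tau> z))\<^sup>2))) (h' \<epsilon>) (b' \<epsilon>)"
proof
  have lin: "iter_deriv is (\<lambda>y. w z * tf_shift g (\<tau> z) y) = (\<lambda>y. w z * iter_deriv is (tf_shift g (\<tau> z)) y)" for "is" z
    using iter_deriv_lin[OF smooth_tf_shift[OF smooth_g] smooth_zero, of "is" "w z" "\<tau> z" 0] by simp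
  show "deriv_bound (\<lambda>y. cmod (w z) * (K * exp (\<epsilon> * (norm (\<tau> z))\<^sup>2)) * gauss (b' \<epsilon>) y) (h' \<epsilon>) (\<lambda>y. w z * tf_shift g (\<tau> z) y)" for z
    unfolding deriv_bound_def lin
  proof (intro conjI allI)
    show "smooth (\<lambda>y. w z * tf_shift g (\<tau> z) y)"
      using smooth_lin[OF smooth_tf_shift[OF smooth_g] smooth_zero, of "w z" "\<tau> z" 0] by simp
    fix "is" :: "'d list" and y :: "real ^ 'd::_"
    from mult_left_mono[OF deriv_boundD(2)[OF deriv_bound_tf_shift[OF assms(1), of "\<tau> z"], of "is" y] norm_ge_zero[of "w z"]]
    show "cmod (w z * iter_deriv is (tf_shift g (\<tau> z)) y) \<le> cmod (w z) * (K * exp (\<epsilon> * (norm (\<tau> z))\<^sup>2)) * gauss (b' \<epsilon>) y * (h' \<epsilon> ^ length is * sqrt (fact (length is)))"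
      by (simp add: norm_mult mult_ac)
  qed
  show "continuous_on UNIV (\<lambda>(z, y). iter_deriv is (\<lambda>y. w z * tf_shift g (\<tau> z) y) y)" for "is"
  proof -
    have "continuous_on UNIV (\<lambda>q :: 'p \<times> (real ^ 'd::_). case (\<tau> (fst q), snd q) of (X, y) \<Rightarrow> iter_deriv is (tf_shift g X) y)"
      by (rule continuous_on_compose2[OF continuous_iter_deriv_tf_shift[OF smooth_g]])
        (auto intro!: continuous_intros continuous_on_compose2[OF assms(3)])
    moreover have "continuous_on UNIV (\<lambda>q :: 'p \<times> (real ^ 'd::_). w (fst q))"
      by (rule continuous_on_compose2[OF assms(2)]) (auto intro!: continuous_intros)
    ultimately show ?thesis unfolding lin case_prod_beta by (auto intro: continuous_on_mult)
  qed
  show "continuous_on UNIV (\<lambda>z. cmod (w z) * (K * exp (\<epsilon> * (norm (\<tau> z))\<^sup>2)))"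
    using assms by (intro continuous_intros)
qed (use assms h'_pos b'_pos in auto)

lemma tf_shift_in_gs_S: "tf_shift g X \<in> gs_S (1/2)"
  by (rule deriv_bound_imp_gs_S[OF deriv_bound_tf_shift[of 1]]) (use h'_pos[of 1] b'_pos[of 1] in auto)

lemma continuous_functional_tf_shift:
  assumes "u \<in> gs_S_dual (1/2)"
  shows "continuous_on A (\<lambda>X. u (tf_shift g X))"
proof -
  interpret G: gs_family "\<lambda>z y. 1 * tf_shift g z y" "\<lambda>z. cmod 1 * (K * exp (1 * (norm z)\<^sup>2))" "h' 1" "b' 1"
    by (rule gs_family_weighted[of 1 "\<lambda>_. 1" "\<lambda>z. z"]) auto
  show ?thesis using G.continuous_functional[OF assms] by simp
qed

lemma functional_tf_shift_growth:
  assumes "u \<in> gs_S_dual (1/2)" "\<epsilon> > 0"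
  obtains C where "C > 0" "\<And>X. cmod (u (tf_shift g X)) \<le> C * exp (\<epsilon> * (norm X)\<^sup>2)"
proof -
  obtain C where C: "C > 0" "\<And>M f. deriv_bound (\<lambda>x. M * gauss (b' \<epsilon>) x) (h' \<epsilon>) f \<Longrightarrow> cmod (u f) \<le> C * M"
    by (rule gs_S_dual_bound[OF assms(1), of "h' \<epsilon>" "b' \<epsilon>"]) (use h'_pos[OF assms(2)] b'_pos[OF assms(2)] in auto)
  have "cmod (u (tf_shift g X)) \<le> (C * K + 1) * exp (\<epsilon> * (norm X)\<^sup>2)" for X
  proof -
    have "cmod (u (tf_shift g X)) \<le> C * (K * exp (\<epsilon> * (norm X)\<^sup>2))" by (rule C(2)[OF deriv_bound_tf_shift[OF assms(2)]])
    also have "\<dots> \<le> (C * K + 1) * exp (\<epsilon> * (norm X)\<^sup>2)" by (simp add: algebra_simps)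
    finally show ?thesis .
  qed
  moreover have "C * K + 1 > 0" using C(1) K_nonneg by (simp add: add_nonneg_pos)
  ultimately show ?thesis using that by blast
qed

end

lemma gs_S_imp_window:
  assumes "g \<in> gs_S (1/2)"
  obtains K h b where "window g K h b"
  using gs_S_imp_deriv_bound[OF assms] unfolding window_def by metis

section \<open>The short-time Fourier transform of an ultradistribution\<close>

definition fourier_const :: "'d::finite itself \<Rightarrow> real" where
  "fourier_const d = (2 * pi) powr (- real CARD('d) / 2)"

text \<open>The product of the difference of two densities with a translate of \<open>\<phi>\<close> has vanishing Fourier
  transform, because modulated translates of \<open>\<phi>\<close> are test functions. By Fourier inversion the product
  vanishes.\<close>

lemma dist_density_eq:
  fixes u :: "(real ^ 'd::{finite,linorder} \<Rightarrow> complex) \<Rightarrow> complex" and \<phi> G :: "real ^ 'd::_ \<Rightarrow> complex"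
  assumes \<phi>: "\<phi> \<in> gs_S (1/2)" "\<phi> \<noteq> (\<lambda>_. 0)"
    and G: "continuous_on UNIV G" "\<And>\<psi>. \<psi> \<in> gs_S (1/2) \<Longrightarrow> integrable lborel (\<lambda>\<xi>. G \<xi> * \<psi> \<xi>) \<and> u \<psi> = (LINT \<xi>|lborel. G \<xi> * \<psi> \<xi>)"
  shows "dist_density u = G"
  unfolding dist_density_def
proof (rule the_equality)
  show "continuous_on UNIV G \<and> (\<forall>\<psi>\<in>gs_S (1/2). integrable lborel (\<lambda>\<xi>. G \<xi> * \<psi> \<xi>) \<and> u \<psi> = (LINT \<xi>|lborel. G \<xi> * \<psi> \<xi>))"
    using G by blast
next
  fix F assume F: "continuous_on UNIV F \<and> (\<forall>\<psi>\<in>gs_S (1/2). integrable lborel (\<lambda>\<xi>. F \<xi> * \<psi> \<xi>) \<and> u \<psi> = (LINT \<xi>|lborel. F \<xi> * \<psi> \<xi>))"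
  obtain K h b where "window \<phi> K h b" using gs_S_imp_window[OF \<phi>(1)] by blast
  then interpret window \<phi> K h b .
  obtain y where y: "\<phi> y \<noteq> 0" using \<phi>(2) by auto
  show "F = G"
  proof
    fix \<xi>1 :: "real ^ 'd::_"
    \<comment> \<open>The translate of \<open>\<phi>\<close> by \<open>a\<close> does not vanish at \<open>\<xi>1\<close>.\<close>
    define a where "a = \<xi>1 - y"
    define H where "H = (\<lambda>\<xi>. (F \<xi> - G \<xi>) * \<phi> (\<xi> - a))"
    have diff: "integrable lborel (\<lambda>\<xi>. (F \<xi> - G \<xi>) * tf_shift \<phi> (a, \<eta>) \<xi>)" "(LINT \<xi>|lborel. (F \<xi> - G \<xi>) * tf_shift \<phi> (a, \<eta>) \<xi>) = 0" for \<eta>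
    proof -
      have S: "tf_shift \<phi> (a, \<eta>) \<in> gs_S (1/2)" by (rule tf_shift_in_gs_S)
      have FS: "integrable lborel (\<lambda>\<xi>. F \<xi> * tf_shift \<phi> (a, \<eta>) \<xi>)" "u (tf_shift \<phi> (a, \<eta>)) = (LINT \<xi>|lborel. F \<xi> * tf_shift \<phi> (a, \<eta>) \<xi>)"
        using F S by blast+
      show "integrable lborel (\<lambda>\<xi>. (F \<xi> - G \<xi>) * tf_shift \<phi> (a, \<eta>) \<xi>)" "(LINT \<xi>|lborel. (F \<xi> - G \<xi>) * tf_shift \<phi> (a, \<eta>) \<xi>) = 0"
        using FS G(2)[OF S] by (simp_all add: left_diff_distrib)
    qed
    have "integrable lborel H" using diff(1)[of 0] by (simp add: H_def tf_shift_def)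
    moreover have "isCont H \<xi>1"
    proof -
      have "continuous_on UNIV (\<lambda>\<xi>. \<phi> (\<xi> - a))"
        by (rule continuous_on_compose2[OF cont_g[of UNIV]]) (auto intro!: continuous_intros)
      hence "continuous_on UNIV H" unfolding H_def using F G(1) by (intro continuous_intros) auto
      thus ?thesis by (simp add: continuous_on_eq_continuous_at)
    qed
    moreover have H0: "(\<lambda>\<eta>. LINT \<xi>|lborel. H \<xi> * cis (- (\<xi> \<bullet> \<eta>))) = (\<lambda>_. 0)"
      using diff(2) by (simp add: H_def tf_shift_def fun_eq_iff mult.assoc)
    moreover have "(LINT \<xi>|lborel. H \<xi> * cis (- (\<xi> \<bullet> \<eta>))) = 0" for \<eta>
      using fun_cong[OF H0] .
    ultimately have "complex_of_real ((2 * pi) ^ DIM((real ^ 'd::_))) * H \<xi>1 = 0"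
      using Fourier_inversion[of H \<xi>1] by simp
    hence "H \<xi>1 = 0" by simp
    thus "F \<xi>1 = G \<xi>1" using y by (simp add: H_def a_def)
  qed
qed

text \<open>The shifted conjugate window times the Fourier transform of \<open>\<psi>\<close> is the superposition of the
  shifts with coefficients \<open>\<psi>\<close>. The functional commutes with the superposition, so the density is its
  value at the shifts.\<close>

theorem stft_eq:
  fixes u :: "(real ^ 'd::{finite,linorder} \<Rightarrow> complex) \<Rightarrow> complex"
  assumes \<phi>: "\<phi> \<in> gs_S (1/2)" "\<phi> \<noteq> (\<lambda>_. 0)" and u: "u \<in> gs_S_dual (1/2)"
    and win: "window (\<lambda>y. cnj (\<phi> y)) K h b"
  shows "stft \<phi> u X = complex_of_real (fourier_const TYPE('d)) * u (tf_shift (\<lambda>y. cnj (\<phi> y)) X)"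
proof -
  interpret window "\<lambda>y. cnj (\<phi> y)" K h b by (rule win)
  obtain x \<xi> where X: "X = (x, \<xi>)" by force
  let ?c = "complex_of_real (fourier_const TYPE('d))"
  let ?g = "\<lambda>y. cnj (\<phi> y)"
  let ?G = "\<lambda>\<xi>. ?c * u (tf_shift ?g (x, \<xi>))"
  have "dist_density (dist_fourier (dist_mult u (\<lambda>y. cnj (\<phi> (y - x))))) = ?G"
  proof (rule dist_density_eq[OF \<phi>])
    show "continuous_on UNIV ?G"
      by (intro continuous_intros continuous_on_compose2[OF continuous_functional_tf_shift[OF u, of UNIV]]) auto
    fix \<psi> :: "real ^ 'd::_ \<Rightarrow> complex" assume \<psi>: "\<psi> \<in> gs_S (1/2)"
    obtain L l a where "window \<psi> L l a" using gs_S_imp_window[OF \<psi>] by blast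
    then interpret \<psi>: window \<psi> L l a .
    define \<epsilon> where "\<epsilon> = a / 2"
    have e: "\<epsilon> > 0" using \<psi>.pos by (simp add: \<epsilon>_def)
    let ?w = "\<lambda>\<xi>. ?c * \<psi> \<xi>"
    let ?\<kappa> = "\<lambda>\<xi>. cmod (?w \<xi>) * (K * exp (\<epsilon> * (norm (x, \<xi>))\<^sup>2))"
    interpret F: gs_family "\<lambda>\<xi> y. ?w \<xi> * tf_shift ?g (x, \<xi>) y" ?\<kappa> "h' \<epsilon>" "b' \<epsilon>"
      by (rule gs_family_weighted[OF e]) (auto intro!: continuous_intros \<psi>.cont_g)
    have int: "integrable lborel ?\<kappa>"
    proof (rule Bochner_Integration.integrable_bound)
      show "integrable lborel (\<lambda>\<xi> :: real ^ 'd::_. cmod ?c * L * K * exp (\<epsilon> * (norm x)\<^sup>2) * gauss (a / 2) \<xi>)"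
        by (intro integrable_mult_right gaussian_integral) (use \<psi>.pos in simp)
      show "?\<kappa> \<in> borel_measurable lborel" using borel_measurable_continuous_onI[OF F.cont_\<kappa>] by simp
      show "AE \<xi> in lborel. norm (?\<kappa> \<xi>) \<le> norm (cmod ?c * L * K * exp (\<epsilon> * (norm x)\<^sup>2) * gauss (a / 2) \<xi>)"
      proof (rule AE_I2)
        fix \<xi> :: "real ^ 'd::_"
        have "?\<kappa> \<xi> \<le> (cmod ?c * (L * gauss a \<xi>)) * (K * exp (\<epsilon> * (norm (x, \<xi>))\<^sup>2))"
          using \<psi>.norm_g[of \<xi>] K_nonneg by (intro mult_right_mono) (auto simp: norm_mult intro: mult_left_mono)
        also have "\<dots> = cmod ?c * L * K * (gauss a \<xi> * exp (\<epsilon> * (norm (x, \<xi>))\<^sup>2))" by (simp only: mult_ac)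
        also have "gauss a \<xi> * exp (\<epsilon> * (norm (x, \<xi>))\<^sup>2) = exp (\<epsilon> * (norm x)\<^sup>2) * gauss (a / 2) \<xi>"
          by (simp add: norm_prod_def \<epsilon>_def algebra_simps flip: exp_add)
        finally show "norm (?\<kappa> \<xi>) \<le> norm (cmod ?c * L * K * exp (\<epsilon> * (norm x)\<^sup>2) * gauss (a / 2) \<xi>)"
          using F.\<kappa>_nonneg[of \<xi>] by (simp only: real_norm_def mult.assoc)
      qed
    qed
    have uw: "u (\<lambda>y. ?w \<xi> * tf_shift ?g (x, \<xi>) y) = ?G \<xi> * \<psi> \<xi>" for \<xi>
      using gs_S_dual_lin[OF u tf_shift_in_gs_S gs_S_zero, of "?w \<xi>" "(x, \<xi>)" 0] by (simp add: mult_ac)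
    have "dist_fourier (dist_mult u (\<lambda>y. cnj (\<phi> (y - x)))) \<psi> = u (\<lambda>y. LINT \<xi>|lborel. ?w \<xi> * tf_shift ?g (x, \<xi>) y)"
    proof -
      have "cnj (\<phi> (y - x)) * fourier \<psi> y = (LINT \<xi>|lborel. ?w \<xi> * tf_shift ?g (x, \<xi>) y)" for y
      proof -
        have "(LINT \<xi>|lborel. ?w \<xi> * tf_shift ?g (x, \<xi>) y) = (LINT \<xi>|lborel. (?c * cnj (\<phi> (y - x))) * (\<psi> \<xi> * cis (- (\<xi> \<bullet> y))))"
          by (simp add: tf_shift_def inner_commute mult_ac)
        also have "\<dots> = (?c * cnj (\<phi> (y - x))) * (LINT \<xi>|lborel. \<psi> \<xi> * cis (- (\<xi> \<bullet> y)))"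
          by (rule integral_mult_right_zero)
        finally show ?thesis by (simp add: fourier_def fourier_const_def mult_ac)
      qed
      thus ?thesis by (simp add: dist_fourier_def dist_mult_def)
    qed
    thus "integrable lborel (\<lambda>\<xi>. ?G \<xi> * \<psi> \<xi>) \<and>
        dist_fourier (dist_mult u (\<lambda>y. cnj (\<phi> (y - x)))) \<psi> = (LINT \<xi>|lborel. ?G \<xi> * \<psi> \<xi>)"
      using F.functional_integral[OF int u] unfolding uw by simp
  qed
  thus ?thesis by (simp add: stft_def X)
qed

section \<open>The reproducing inequality\<close>

lemma norm_exp_shift_le:
  fixes z y x :: "'a::real_inner"
  assumes "\<beta> > 0"
  shows "gauss \<beta> (z + y - x) \<le> exp (\<beta> * (norm y)\<^sup>2) * gauss (\<beta> / 2) (z - x)"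
proof -
  have "(1/2) * (norm (z - x))\<^sup>2 \<le> (norm (z + y - x))\<^sup>2 + (norm y)\<^sup>2"
    using harmonic_norm_ineq[of 1 1 "z + y - x" "- y"] by (simp add: algebra_simps)
  from mult_left_mono[OF this, of \<beta>] assms show ?thesis by (simp add: algebra_simps flip: exp_add)
qed

text \<open>Differentiate the constant function \<open>y \<mapsto> \<integral> F(t + y) dt\<close> at \<open>0\<close>.\<close>

lemma integral_partial_deriv_eq_0:
  fixes F :: "real ^ 'd::finite \<Rightarrow> complex"
  assumes F: "smooth F" and \<beta>: "\<beta> > 0"
    and F0: "\<And>t. cmod (F t) \<le> M * gauss \<beta> (t - x)"
    and F1: "\<And>i t. cmod (partial_deriv i F t) \<le> M * gauss \<beta> (t - x)"
  shows "(LINT t|lborel. partial_deriv i F t) = 0"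
proof -
  have M: "M \<ge> 0" using order_trans[OF norm_ge_zero F0[of x]] by simp
  have Fm: "F \<in> borel_measurable borel" using smooth_continuous[OF F, of UNIV] by (rule borel_measurable_continuous_onI)
  have dm: "partial_deriv i F \<in> borel_measurable borel" for i
    using smooth_continuous[OF smooth_partial_deriv[OF F], of UNIV] by (rule borel_measurable_continuous_onI)
  have intF: "integrable lborel F"
    by (rule Bochner_Integration.integrable_bound[OF integrable_mult_right[OF gaussian_integral_shift(1)[OF \<beta>, of x], of M]])
      (use Fm F0 M in \<open>auto simp: abs_mult\<close>)
  let ?k = "\<lambda>z. real CARD('d) * (M * (exp \<beta> * gauss (\<beta> / 2) (z - x)))"
  have "((\<lambda>y. LINT z|lborel. F (z - (- y))) has_derivative (\<lambda>v. LINT z|lborel. frechet_derivative F (at (z - (- 0))) v)) (at (0 :: real ^ 'd))"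
  proof (rule has_derivative_integral_dominated[where k = ?k])
    show "integrable lborel (\<lambda>z. F (z - (- y)))" for y using lborel_integral_shift(2)[OF Fm, of "- y"] intF by simp
    show "((\<lambda>y. F (z - (- y))) has_derivative frechet_derivative F (at (z - (- y)))) (at y)" for z y :: "real ^ 'd"
    proof -
      have "((\<lambda>y. z - (- y)) has_derivative (\<lambda>v. v)) (at y)" by (auto intro!: derivative_eq_intros)
      from has_derivative_compose[OF this smooth_has_derivative[OF F]] show ?thesis .
    qed
    show "cmod (frechet_derivative F (at (z - (- y))) v) \<le> ?k z * norm v" if "y \<in> ball 0 1" for z y v
    proof -
      have "cmod (frechet_derivative F (at (z - (- y))) v) \<le> real CARD('d) * (M * gauss \<beta> (z - (- y) - x)) * norm v"
        by (rule norm_frechet_derivative_le[OF F F1])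
      also have "\<dots> \<le> ?k z * norm v"
      proof -
        have "(norm y)\<^sup>2 \<le> 1" using that by (simp add: power_le_one)
        hence "exp (\<beta> * (norm y)\<^sup>2) \<le> exp \<beta>" using \<beta> by simp
        hence "exp (\<beta> * (norm y)\<^sup>2) * gauss (\<beta> / 2) (z - x) \<le> exp \<beta> * gauss (\<beta> / 2) (z - x)"
          by (rule mult_right_mono) simp
        from order_trans[OF norm_exp_shift_le[OF \<beta>, of z y x] this]
        have "gauss \<beta> (z - (- y) - x) \<le> exp \<beta> * gauss (\<beta> / 2) (z - x)"
          by (simp only: diff_minus_eq_add)
        thus ?thesis using M by (intro mult_right_mono mult_left_mono) auto
      qed
      finally show ?thesis .
    qed
    show "(\<lambda>z. frechet_derivative F (at (z - (- 0))) v) \<in> borel_measurable lborel" for v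
      using dm by (simp add: frechet_derivative_eq_sum_partial_deriv[OF F])
    show "integrable lborel ?k" using \<beta> by (intro integrable_mult_right gaussian_integral_shift) simp
  qed (use M in simp)
  moreover have "(\<lambda>y. LINT z|lborel. F (z - (- y))) = (\<lambda>y. LINT z|lborel. F z)"
    using lborel_integral_shift(1)[OF Fm] by blast
  ultimately have "((\<lambda>y. LINT z|lborel. F z) has_derivative (\<lambda>v. LINT z|lborel. frechet_derivative F (at z) v)) (at (0 :: real ^ 'd))" by simp
  moreover have "((\<lambda>y. LINT z|lborel. F z) has_derivative (\<lambda>v. 0)) (at (0 :: real ^ 'd))" by simp
  ultimately have "(\<lambda>v. LINT z|lborel. frechet_derivative F (at z) v) = (\<lambda>v. 0)"
    by (rule has_derivative_unique)
  from fun_cong[OF this, of "axis i 1"] show ?thesis by (simp add: partial_deriv_def)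
qed

text \<open>Integration by parts in the direction of the largest coordinate of \<open>\<eta>\<close> gives bounds on all
  powers of that coordinate, hence Gaussian decay of the Fourier integral.\<close>

lemma Fourier_integral_decay:
  fixes p :: "real ^ 'd::finite \<Rightarrow> complex"
  assumes p: "deriv_bound (\<lambda>t. M * gauss \<beta> (t - x)) H p" and \<beta>: "\<beta> > 0" and H: "H > 0"
  shows "cmod (LINT t|lborel. p t * cis (- (t \<bullet> \<eta>)))
    \<le> sqrt 2 * (M * sqrt (pi / \<beta>) ^ CARD('d)) * exp (- (norm \<eta>)\<^sup>2 / (4 * real CARD('d) * H\<^sup>2))"
proof -
  have M: "M \<ge> 0" using deriv_boundD(4)[OF p, of x] by simp
  have sm: "smooth (iter_deriv is p)" for "is" by (intro smooth_iter_deriv deriv_boundD(1)[OF p])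
  have step: "(LINT t|lborel. iter_deriv (i # is) p t * cis (- (t \<bullet> \<eta>)))
      = \<i> * complex_of_real (\<eta> $ i) * (LINT t|lborel. iter_deriv is p t * cis (- (t \<bullet> \<eta>)))" for i "is"
  proof -
    let ?q = "iter_deriv is p" and ?e = "\<lambda>t. cis (- (t \<bullet> \<eta>))"
    define c where "c = (\<lambda>js :: 'd list. H ^ length js * sqrt (fact (length js)))"
    have c: "c js \<ge> 0" for js using H by (simp add: c_def)
    have bnd: "cmod (iter_deriv js p t) \<le> (M * c js) * gauss \<beta> (t - x)" for js t
      using deriv_boundD(2)[OF p, of js t] by (simp add: c_def mult_ac)
    define M' where "M' = M * c (i # is) + M * c is + norm \<eta> * (M * c is)"
    have pd: "partial_deriv j (\<lambda>t. ?q t * ?e t) = (\<lambda>t. partial_deriv j ?q t * ?e t - \<i> * complex_of_real (\<eta> $ j) * (?q t * ?e t))" for j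
    proof
      fix t
      have d: "?q differentiable (at t)" "?e differentiable (at t)"
        by (rule smooth_differentiable[OF sm], rule smooth_differentiable[OF smooth_modulation])
      show "partial_deriv j (\<lambda>t. ?q t * ?e t) t = partial_deriv j ?q t * ?e t - \<i> * complex_of_real (\<eta> $ j) * (?q t * ?e t)"
        using partial_deriv_unique[OF has_derivative_modulation[of 1 \<eta> t], of j]
        unfolding partial_deriv_mult[OF d] by (simp add: inner_axis' algebra_simps)
    qed
    have cc: "c (j # is) = c (i # is)" for j by (simp add: c_def)
    have q0: "cmod (?q t * ?e t) \<le> (M * c is) * gauss \<beta> (t - x)" for t using bnd by (simp add: norm_mult)
    have zero: "(LINT t|lborel. partial_deriv i (\<lambda>t. ?q t * ?e t) t) = 0"
    proof (rule integral_partial_deriv_eq_0[OF smooth_mult[OF sm smooth_modulation] \<beta>])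
      fix t and j
      let ?E = "gauss \<beta> (t - x)"
      have nn: "M * c (i # is) \<ge> 0" "M * c is \<ge> 0" "norm \<eta> * (M * c is) \<ge> 0" using M c by simp_all
      show "cmod (?q t * ?e t) \<le> M' * ?E"
      proof (rule order_trans[OF q0 mult_right_mono])
        show "M * c is \<le> M'" using nn by (simp add: M'_def)
      qed simp
      have "cmod (partial_deriv j (\<lambda>t. ?q t * ?e t) t) \<le> cmod (partial_deriv j ?q t * ?e t) + cmod (\<i> * complex_of_real (\<eta> $ j) * (?q t * ?e t))"
        unfolding pd by (rule norm_triangle_ineq4)
      also have "\<dots> \<le> (M * c (i # is)) * ?E + norm \<eta> * ((M * c is) * ?E)"
      proof (rule add_mono)
        show "cmod (partial_deriv j ?q t * ?e t) \<le> (M * c (i # is)) * ?E" using bnd[of "j # is" t] by (simp add: norm_mult cc[of j])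
        have "cmod (\<i> * complex_of_real (\<eta> $ j) * (?q t * ?e t)) = \<bar>\<eta> $ j\<bar> * cmod (?q t * ?e t)" by (simp add: norm_mult)
        also have "\<dots> \<le> norm \<eta> * ((M * c is) * ?E)" by (rule mult_mono[OF component_le_norm_cart q0]) (rule norm_ge_zero)+
        finally show "cmod (\<i> * complex_of_real (\<eta> $ j) * (?q t * ?e t)) \<le> norm \<eta> * ((M * c is) * ?E)" .
      qed
      also have "\<dots> = (M * c (i # is) + norm \<eta> * (M * c is)) * ?E" by (simp only: distrib_right mult.assoc)
      also have "\<dots> \<le> M' * ?E"
        by (rule mult_right_mono) (use nn in \<open>simp_all add: M'_def\<close>)
      finally show "cmod (partial_deriv j (\<lambda>t. ?q t * ?e t) t) \<le> M' * ?E" .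
    qed
    have int: "integrable lborel (\<lambda>t. iter_deriv js p t * ?e t)" for js
    proof (rule Bochner_Integration.integrable_bound[OF integrable_mult_right[OF gaussian_integral_shift(1)[OF \<beta>, of x], of "M * c js"]])
      show "(\<lambda>t. iter_deriv js p t * ?e t) \<in> borel_measurable lborel"
        using borel_measurable_continuous_onI[OF smooth_continuous[OF smooth_mult[OF sm smooth_modulation], of UNIV]] by simp
      show "AE t in lborel. norm (iter_deriv js p t * ?e t) \<le> norm (M * c js * gauss \<beta> (t - x))"
        using bnd[of js] M c[of js] by (intro AE_I2) (simp add: norm_mult abs_mult)
    qed
    have "0 = (LINT t|lborel. partial_deriv i ?q t * ?e t - \<i> * complex_of_real (\<eta> $ i) * (?q t * ?e t))"
      using zero unfolding pd by simp
    also have "\<dots> = (LINT t|lborel. partial_deriv i ?q t * ?e t) - \<i> * complex_of_real (\<eta> $ i) * (LINT t|lborel. ?q t * ?e t)"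
      using int[of "i # is"] int[of "is"] by (simp add: mult.assoc)
    finally show ?thesis by simp
  qed
  obtain i where i: "(norm \<eta>)\<^sup>2 \<le> real CARD('d) * (\<eta> $ i)\<^sup>2" using norm_sq_le_max_component by blast
  let ?P = "LINT t|lborel. p t * cis (- (t \<bullet> \<eta>))" and ?W = "M * sqrt (pi / \<beta>) ^ CARD('d)"
  have power: "\<bar>\<eta> $ i\<bar> ^ n * cmod ?P \<le> ?W * H ^ n * sqrt (fact n)" for n
  proof -
    have "\<bar>\<eta> $ i\<bar> ^ n * cmod ?P = cmod (LINT t|lborel. iter_deriv (replicate n i) p t * cis (- (t \<bullet> \<eta>)))"
      by (induct n) (simp_all only: replicate_Suc step, simp_all add: norm_mult)
    also have "\<dots> \<le> (LINT t|lborel. (M * (H ^ n * sqrt (fact n))) * gauss \<beta> (t - x))"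
    proof (rule order_trans[OF integral_norm_bound integral_mono'])
      show "integrable lborel (\<lambda>t. (M * (H ^ n * sqrt (fact n))) * gauss \<beta> (t - x))"
        by (intro integrable_mult_right gaussian_integral_shift \<beta>)
      show "cmod (iter_deriv (replicate n i) p t * cis (- (t \<bullet> \<eta>))) \<le> (M * (H ^ n * sqrt (fact n))) * gauss \<beta> (t - x)" for t
        using deriv_boundD(2)[OF p, of "replicate n i" t] by (simp add: norm_mult mult_ac)
    qed (use M H in simp)
    also have "\<dots> = (M * (H ^ n * sqrt (fact n))) * sqrt (pi / \<beta>) ^ CARD('d)"
      unfolding integral_mult_right_zero gaussian_integral_shift(2)[OF \<beta>] by simp
    finally show ?thesis by (simp add: mult_ac)
  qed
  have "cmod ?P \<le> sqrt 2 * ?W * exp (- (\<bar>\<eta> $ i\<bar>\<^sup>2 / (4 * H\<^sup>2)))"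
    by (rule gaussian_decay_if_power_bounds[OF _ _ H power]) (use M \<beta> in auto)
  also have "\<dots> \<le> sqrt 2 * ?W * exp (- (norm \<eta>)\<^sup>2 / (4 * real CARD('d) * H\<^sup>2))"
  proof (rule mult_left_mono)
    have "(norm \<eta>)\<^sup>2 / (4 * real CARD('d) * H\<^sup>2) \<le> (real CARD('d) * (\<eta> $ i)\<^sup>2) / (4 * real CARD('d) * H\<^sup>2)"
      using i by (rule divide_right_mono) simp
    thus "exp (- (\<bar>\<eta> $ i\<bar>\<^sup>2 / (4 * H\<^sup>2))) \<le> exp (- (norm \<eta>)\<^sup>2 / (4 * real CARD('d) * H\<^sup>2))" by simp
  qed (use M \<beta> in simp)
  finally show ?thesis .
qed

context window begin

definition pairing :: "(real ^ 'd::_) \<times> (real ^ 'd::_) \<Rightarrow> (real ^ 'd::_) \<times> (real ^ 'd::_) \<Rightarrow> complex" where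
  "pairing X Z = (LINT t|lborel. tf_shift g X t * cnj (tf_shift g Z t))"

text \<open>The decay in the position comes from that of the window and the decay in the frequency from
  the derivative bounds, which the product of two shifted windows inherits.\<close>

lemma pairing_decay:
  obtains A a where "A > 0" "a > 0" "\<And>X Z. cmod (pairing X Z) \<le> A * gauss a (X - Z)"
proof -
  define A where "A = sqrt 2 * (K\<^sup>2 * sqrt (pi / (b / 2)) ^ CARD('d)) + 1"
  define a where "a = min (b / 4) (1 / (4 * real CARD('d) * (2 * h)\<^sup>2))"
  have A: "A > 0" unfolding A_def using pos by (intro add_nonneg_pos) auto
  have a: "a > 0" "a \<le> b / 4" "a \<le> 1 / (4 * real CARD('d) * (2 * h)\<^sup>2)" using pos by (auto simp: a_def)
  have "cmod (pairing X Z) \<le> A * gauss a (X - Z)" for X Z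
  proof -
    obtain x \<xi> where X: "X = (x, \<xi>)" by force
    obtain x' \<xi>' where Z: "Z = (x', \<xi>')" by force
    let ?p = "\<lambda>t. g (t - x) * cnj (g (t - x'))"
    have "deriv_bound (\<lambda>t. (K * gauss b (t - x)) * (K * gauss b (t - x'))) (h + h) ?p"
      by (rule deriv_bound_mult[OF deriv_bound_translate[OF bound_g] deriv_bound_cnj[OF deriv_bound_translate[OF bound_g]]]) (use pos in auto)
    hence p: "deriv_bound (\<lambda>t. (K\<^sup>2 * gauss (b / 4) (x - x')) * gauss (b / 2) (t - x)) (2 * h) ?p"
    proof (rule deriv_bound_mono)
      fix t
      have "(1/2) * (norm (x - x'))\<^sup>2 \<le> (norm (t - x))\<^sup>2 + (norm (t - x'))\<^sup>2"
        using harmonic_norm_ineq[of 1 1 "x - t" "t - x'"] by (simp add: norm_minus_commute)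
      from mult_left_mono[OF this, of "b / 2"]
      have "(b / 4) * (norm (x - x'))\<^sup>2 \<le> (b / 2) * (norm (t - x))\<^sup>2 + (b / 2) * (norm (t - x'))\<^sup>2"
        using pos by (simp add: algebra_simps)
      moreover have "(b / 2) * (norm (t - x'))\<^sup>2 \<le> b * (norm (t - x'))\<^sup>2" using pos by simp
      ultimately have "- b * (norm (t - x))\<^sup>2 + - b * (norm (t - x'))\<^sup>2 \<le> - (b / 4) * (norm (x - x'))\<^sup>2 + - (b / 2) * (norm (t - x))\<^sup>2"
        by (simp add: algebra_simps)
      hence "gauss b (t - x) * gauss b (t - x') \<le> gauss (b / 4) (x - x') * gauss (b / 2) (t - x)"
        unfolding exp_add[symmetric] by (simp only: exp_le_cancel_iff)
      from mult_left_mono[OF this, of "K\<^sup>2"]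
      show "(K * gauss b (t - x)) * (K * gauss b (t - x'))
        \<le> (K\<^sup>2 * gauss (b / 4) (x - x')) * gauss (b / 2) (t - x)"
        by (simp add: power2_eq_square mult_ac)
    qed (use pos in auto)
    have "pairing X Z = (LINT t|lborel. ?p t * cis (- (t \<bullet> (\<xi> - \<xi>'))))"
      unfolding pairing_def X Z tf_shift_def
      by (rule Bochner_Integration.integral_cong[OF refl]) (simp add: cis_cnj inner_diff_right mult_ac cis_mult)
    also have "cmod \<dots> \<le> sqrt 2 * ((K\<^sup>2 * gauss (b / 4) (x - x')) * sqrt (pi / (b / 2)) ^ CARD('d)) * exp (- (norm (\<xi> - \<xi>'))\<^sup>2 / (4 * real CARD('d) * (2 * h)\<^sup>2))"
      by (rule Fourier_integral_decay[OF p]) (use pos in auto)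
    also have "\<dots> = (sqrt 2 * (K\<^sup>2 * sqrt (pi / (b / 2)) ^ CARD('d))) * (gauss (b / 4) (x - x') * exp (- (norm (\<xi> - \<xi>'))\<^sup>2 / (4 * real CARD('d) * (2 * h)\<^sup>2)))"
      by (simp only: mult_ac)
    also have "\<dots> \<le> A * gauss a (X - Z)"
    proof (rule mult_mono)
      have "(norm (X - Z))\<^sup>2 = (norm (x - x'))\<^sup>2 + (norm (\<xi> - \<xi>'))\<^sup>2" by (simp add: X Z norm_prod_def)
      moreover have "a * (norm (x - x'))\<^sup>2 \<le> (b / 4) * (norm (x - x'))\<^sup>2" using a by (intro mult_right_mono) auto
      moreover have "a * (norm (\<xi> - \<xi>'))\<^sup>2 \<le> (1 / (4 * real CARD('d) * (2 * h)\<^sup>2)) * (norm (\<xi> - \<xi>'))\<^sup>2"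
        using a by (intro mult_right_mono) auto
      ultimately have "- (b / 4) * (norm (x - x'))\<^sup>2 + - (norm (\<xi> - \<xi>'))\<^sup>2 / (4 * real CARD('d) * (2 * h)\<^sup>2) \<le> - a * (norm (X - Z))\<^sup>2"
        by (simp add: algebra_simps)
      thus "gauss (b / 4) (x - x') * exp (- (norm (\<xi> - \<xi>'))\<^sup>2 / (4 * real CARD('d) * (2 * h)\<^sup>2)) \<le> gauss a (X - Z)"
        unfolding exp_add[symmetric] by (simp only: exp_le_cancel_iff)
    qed (use A in \<open>auto simp: A_def\<close>)
    finally show ?thesis .
  qed
  thus ?thesis using that A a by blast
qed

lemma norm_tf_shift: "cmod (tf_shift g X t) \<le> K * gauss b (t - fst X)" "cmod (tf_shift g X t) \<le> K"
proof -
  show 1: "cmod (tf_shift g X t) \<le> K * gauss b (t - fst X)"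
    using norm_g[of "t - fst X"] by (simp add: tf_shift_def norm_mult)
  have "K * gauss b (t - fst X) \<le> K * 1" using pos K_nonneg by (intro mult_left_mono) auto
  with 1 show "cmod (tf_shift g X t) \<le> K" by simp
qed

lemma cont_tf_shift: "continuous_on A (tf_shift g X)"
  by (rule smooth_continuous[OF smooth_tf_shift[OF smooth_g]])

lemma integrable_tf_shift: "integrable lborel (tf_shift g X)"
proof (rule Bochner_Integration.integrable_bound[OF integrable_mult_right[OF gaussian_integral_shift(1)[OF pos(2), of "fst X"], of K]])
  show "tf_shift g X \<in> borel_measurable lborel" using borel_measurable_continuous_onI[OF cont_tf_shift] by simp
  show "AE t in lborel. norm (tf_shift g X t) \<le> norm (K * gauss b (t - fst X))"
    using norm_tf_shift(1) K_nonneg by (intro AE_I2) (simp add: abs_mult)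
qed

lemma continuous_pairing: "continuous_on UNIV (pairing X)"
proof (rule continuous_at_imp_continuous_on, rule ballI, rule continuous_at_sequentiallyI)
  fix Z0 and Z :: "nat \<Rightarrow> (real ^ 'd::_) \<times> (real ^ 'd::_)" assume Z: "Z \<longlonglongrightarrow> Z0"
  show "(\<lambda>n. pairing X (Z n)) \<longlonglongrightarrow> pairing X Z0"
    unfolding pairing_def
  proof (rule integral_dominated_convergence[where w = "\<lambda>t. cmod (tf_shift g X t) * K"])
    have meas: "(\<lambda>t. tf_shift g X t * cnj (tf_shift g Y t)) \<in> borel_measurable lborel" for Y
      using borel_measurable_continuous_onI[OF continuous_on_mult[OF cont_tf_shift continuous_on_cnj[OF cont_tf_shift]]] by simp
    show "(\<lambda>t. tf_shift g X t * cnj (tf_shift g Z0 t)) \<in> borel_measurable lborel"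
      "(\<lambda>t. tf_shift g X t * cnj (tf_shift g (Z n) t)) \<in> borel_measurable lborel" for n by (rule meas)+
    show "integrable lborel (\<lambda>t. cmod (tf_shift g X t) * K)"
      by (intro integrable_mult_left integrable_norm integrable_tf_shift)
    show "AE t in lborel. (\<lambda>n. tf_shift g X t * cnj (tf_shift g (Z n) t)) \<longlonglongrightarrow> tf_shift g X t * cnj (tf_shift g Z0 t)"
    proof (rule AE_I2)
      fix t
      have "continuous_on UNIV (\<lambda>Y. tf_shift g Y t)"
        using continuous_on_compose2[OF continuous_iter_deriv_tf_shift[OF smooth_g, of "[]"], of UNIV "\<lambda>Y. (Y, t)"]
        by (simp add: continuous_on_Pair)
      hence "isCont (\<lambda>Y. tf_shift g Y t) Z0" by (simp add: continuous_on_eq_continuous_at del: split_paired_All)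
      from isCont_tendsto_compose[OF this Z]
      show "(\<lambda>n. tf_shift g X t * cnj (tf_shift g (Z n) t)) \<longlonglongrightarrow> tf_shift g X t * cnj (tf_shift g Z0 t)"
        by (intro tendsto_mult tendsto_const tendsto_cnj)
    qed
    show "AE t in lborel. norm (tf_shift g X t * cnj (tf_shift g (Z n) t)) \<le> cmod (tf_shift g X t) * K" for n
      by (intro AE_I2) (simp add: norm_mult mult_left_mono norm_tf_shift(2))
  qed
qed

text \<open>In the frequency, \<open>pairing X (x', \<cdot>)\<close> is the conjugate of a Fourier transform, so the inversion
  formula is used for the conjugate function.\<close>

lemma pairing_inversion:
  "(LINT \<xi>|lborel. pairing X (x', \<xi>) * cis (- (y \<bullet> \<xi>)))
    = complex_of_real ((2 * pi) ^ CARD('d)) * (tf_shift g X y * cnj (g (y - x')))"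
proof -
  let ?q = "\<lambda>t. cnj (tf_shift g X t) * g (t - x')"
  have gc: "continuous_on UNIV (\<lambda>t. g (t - x'))"
    by (rule continuous_on_compose2[OF cont_g[of UNIV]]) (auto intro!: continuous_intros)
  have ng: "cmod (g (t - x')) \<le> K" for t using norm_tf_shift(2)[of "(x', 0)" t] by (simp add: tf_shift_def)
  have q: "integrable lborel ?q"
    by (rule integrable_times_bounded_continuous[OF _ gc ng]) (use integrable_tf_shift in \<open>simp only: integrable_cnj\<close>)
  have qc: "isCont ?q y"
    using continuous_on_mult[OF continuous_on_cnj[OF cont_tf_shift[of UNIV X]] gc] by (simp add: continuous_on_eq_continuous_at)
  have hat: "(LINT t|lborel. ?q t * cis (- (t \<bullet> \<xi>))) = cnj (pairing X (x', \<xi>))" for \<xi>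
    unfolding pairing_def Bochner_Integration.integral_cnj[symmetric]
    by (rule Bochner_Integration.integral_cong[OF refl]) (simp add: tf_shift_def)
  obtain A a where Aa: "A > 0" "a > 0" "\<And>X Z. cmod (pairing X Z) \<le> A * gauss a (X - Z)"
    using pairing_decay by blast
  have cp: "continuous_on UNIV (\<lambda>\<xi>. pairing X (x', \<xi>))"
    by (rule continuous_on_compose2[OF continuous_pairing[of X]]) (auto intro!: continuous_intros)
  have int: "integrable lborel (\<lambda>\<xi>. cnj (pairing X (x', \<xi>)))"
  proof (rule Bochner_Integration.integrable_bound[OF integrable_mult_right[OF gaussian_integral_shift(1)[OF Aa(2), of "snd X"], of A]])
    show "(\<lambda>\<xi>. cnj (pairing X (x', \<xi>))) \<in> borel_measurable lborel"
      using borel_measurable_continuous_onI[OF continuous_on_cnj[OF cp]] by simp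
    show "AE \<xi> in lborel. norm (cnj (pairing X (x', \<xi>))) \<le> norm (A * gauss a (\<xi> - snd X))"
    proof (rule AE_I2)
      fix \<xi> :: "real ^ 'd::_"
      have "(norm (\<xi> - snd X))\<^sup>2 \<le> (norm (X - (x', \<xi>)))\<^sup>2"
        by (cases X) (simp add: norm_prod_def norm_minus_commute)
      hence "A * gauss a (X - (x', \<xi>)) \<le> A * gauss a (\<xi> - snd X)"
        using Aa by (intro mult_left_mono) auto
      thus "norm (cnj (pairing X (x', \<xi>))) \<le> norm (A * gauss a (\<xi> - snd X))"
        using order_trans[OF Aa(3)[of X "(x', \<xi>)"]] Aa(1) by (simp add: abs_mult)
    qed
  qed
  have "(LINT \<xi>|lborel. cnj (pairing X (x', \<xi>)) * cis (y \<bullet> \<xi>)) = complex_of_real ((2 * pi) ^ CARD('d)) * ?q y"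
    using Fourier_inversion[OF q qc] int unfolding hat by simp
  hence "cnj (LINT \<xi>|lborel. cnj (pairing X (x', \<xi>)) * cis (y \<bullet> \<xi>)) = cnj (complex_of_real ((2 * pi) ^ CARD('d)) * ?q y)"
    by (rule arg_cong)
  thus ?thesis unfolding Bochner_Integration.integral_cnj[symmetric] by (simp add: cis_cnj del: Bochner_Integration.integral_cnj)
qed

text \<open>The reflection comes from the translates \<open>g (y - x')\<close> being integrated over \<open>x'\<close>; it spares a
  reflection of the integral.\<close>

definition energy :: real where
  "energy = (LINT s|lborel. (cmod (g (- s)))\<^sup>2)"

lemma energy_pos:
  assumes "g \<noteq> (\<lambda>_. 0)"
  shows "energy > 0"
proof -
  let ?f = "\<lambda>s. (cmod (g (- s)))\<^sup>2"
  have fc: "continuous_on UNIV ?f"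
    by (intro continuous_intros continuous_on_compose2[OF cont_g[of UNIV]]) auto
  have int: "integrable lborel ?f"
  proof (rule Bochner_Integration.integrable_bound[OF integrable_mult_right[OF gaussian_integral(1)[OF pos(2)], of "K * K"]])
    show "?f \<in> borel_measurable lborel" using borel_measurable_continuous_onI[OF fc] by simp
    show "AE s in lborel. norm (?f s) \<le> norm (K * K * gauss b (s :: real ^ 'd::_))"
    proof (rule AE_I2)
      fix s :: "real ^ 'd::_"
      have "cmod (g (- s)) \<le> K" using norm_tf_shift(2)[of "(0, 0)" "- s"] by (simp add: tf_shift_def)
      hence "cmod (g (- s)) * cmod (g (- s)) \<le> K * (K * gauss b s)"
        using norm_g[of "- s"] K_nonneg by (intro mult_mono) auto
      thus "norm (?f s) \<le> norm (K * K * gauss b s)" by (simp add: power2_eq_square abs_mult mult.assoc)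
    qed
  qed
  have "energy \<noteq> 0"
  proof
    assume "energy = 0"
    hence "AE s in lborel. ?f s = 0"
      using integral_nonneg_eq_0_iff_AE[OF int] by (simp add: energy_def)
    moreover have "{s. ?f s \<noteq> 0} \<in> sets lborel"
      using borel_measurable_continuous_onI[OF fc] by measurable
    ultimately have "{s. ?f s \<noteq> 0} \<in> null_sets lborel"
      by (simp add: AE_iff_null_sets[symmetric] AE_iff_null)
    hence "negligible {s. ?f s \<noteq> 0}"
      by (simp add: negligible_iff_null_sets null_sets_completionI)
    moreover have "open {s. ?f s \<noteq> 0}"
      using open_Collect_neq[OF fc continuous_on_const, of 0] by simp
    ultimately have "{s. ?f s \<noteq> 0} = {}" using open_not_negligible by blast
    hence "g (- s) = 0" for s by simp
    from this[of "- s" for s] have "g = (\<lambda>_. 0)" by auto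
    thus False using assms by simp
  qed
  moreover have "energy \<ge> 0" unfolding energy_def by (intro integral_nonneg_AE) auto
  ultimately show ?thesis by simp
qed

lemma pairing_gs_family:
  assumes "\<epsilon> > 0"
  shows "gs_family (\<lambda>Z y. pairing X Z * tf_shift g Z y) (\<lambda>Z. cmod (pairing X Z) * (K * exp (\<epsilon> * (norm Z)\<^sup>2))) (h' \<epsilon>) (b' \<epsilon>)"
  using gs_family_weighted[OF assms continuous_pairing, of "\<lambda>Z. Z"] by simp

lemma integrable_pairing_majorant:
  obtains \<epsilon> where "\<epsilon> > 0" "\<And>X. integrable lborel (\<lambda>Z. cmod (pairing X Z) * (K * exp (\<epsilon> * (norm Z)\<^sup>2)))"
proof -
  obtain A a where Aa: "A > 0" "a > 0" "\<And>X Z. cmod (pairing X Z) \<le> A * gauss a (X - Z)"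
    using pairing_decay by blast
  define \<epsilon> where "\<epsilon> = a / 4"
  have e: "\<epsilon> > 0" using Aa by (simp add: \<epsilon>_def)
  have a2: "a / 2 > 0" using Aa by simp
  have "integrable lborel (\<lambda>Z. cmod (pairing X Z) * (K * exp (\<epsilon> * (norm Z)\<^sup>2)))" for X
  proof (rule Bochner_Integration.integrable_bound[OF integrable_mult_right[OF gaussian_integral_shift(1)[OF a2, of X], of "A * K * exp ((a / 2) * (norm X)\<^sup>2)"]])
    interpret G: gs_family "\<lambda>Z y. pairing X Z * tf_shift g Z y" "\<lambda>Z. cmod (pairing X Z) * (K * exp (\<epsilon> * (norm Z)\<^sup>2))" "h' \<epsilon>" "b' \<epsilon>"
      by (rule pairing_gs_family[OF e])
    show "(\<lambda>Z. cmod (pairing X Z) * (K * exp (\<epsilon> * (norm Z)\<^sup>2))) \<in> borel_measurable lborel"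
      using borel_measurable_continuous_onI[OF G.cont_\<kappa>] by simp
    show "AE Z in lborel. norm (cmod (pairing X Z) * (K * exp (\<epsilon> * (norm Z)\<^sup>2))) \<le> norm (A * K * exp (a / 2 * (norm X)\<^sup>2) * gauss (a / 2) (Z - X))"
    proof (rule AE_I2)
      fix Z :: "(real ^ 'd::_) \<times> (real ^ 'd::_)"
      have "(1/2) * (norm Z)\<^sup>2 \<le> (norm (Z - X))\<^sup>2 + (norm X)\<^sup>2"
        using harmonic_norm_ineq[of 1 1 "Z - X" X] by simp
      from mult_left_mono[OF this, of "a / 2"] Aa(2)
      have "- a * (norm (X - Z))\<^sup>2 + \<epsilon> * (norm Z)\<^sup>2 \<le> a / 2 * (norm X)\<^sup>2 + - (a / 2) * (norm (Z - X))\<^sup>2"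
        by (simp add: \<epsilon>_def algebra_simps norm_minus_commute)
      hence le: "gauss a (X - Z) * exp (\<epsilon> * (norm Z)\<^sup>2) \<le> exp (a / 2 * (norm X)\<^sup>2) * gauss (a / 2) (Z - X)"
        unfolding exp_add[symmetric] by (simp only: exp_le_cancel_iff)
      have "cmod (pairing X Z) * (K * exp (\<epsilon> * (norm Z)\<^sup>2)) \<le> (A * gauss a (X - Z)) * (K * exp (\<epsilon> * (norm Z)\<^sup>2))"
        using Aa(3) K_nonneg by (intro mult_right_mono) auto
      also have "\<dots> = A * K * (gauss a (X - Z) * exp (\<epsilon> * (norm Z)\<^sup>2))" by (simp only: mult_ac)
      also have "\<dots> \<le> A * K * (exp (a / 2 * (norm X)\<^sup>2) * gauss (a / 2) (Z - X))"
        using Aa(1) K_nonneg by (intro mult_left_mono le) auto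
      finally show "norm (cmod (pairing X Z) * (K * exp (\<epsilon> * (norm Z)\<^sup>2))) \<le> norm (A * K * exp (a / 2 * (norm X)\<^sup>2) * gauss (a / 2) (Z - X))"
        using G.\<kappa>_nonneg[of Z] Aa(1) K_nonneg by (simp only: real_norm_def mult.assoc)
    qed
  qed
  thus ?thesis using that e by blast
qed

text \<open>Integrating first over the frequencies gives \<open>(2\<pi>)\<^sup>d \<Phi>\<^sub>X(y) |g(y - x')|\<^sup>2\<close> by Fourier inversion.\<close>

lemma tf_shift_reproducing:
  "(LINT Z|lborel. pairing X Z * tf_shift g Z y) = complex_of_real ((2 * pi) ^ CARD('d) * energy) * tf_shift g X y"
proof -
  obtain \<epsilon> where e: "\<epsilon> > 0" "\<And>X. integrable lborel (\<lambda>Z. cmod (pairing X Z) * (K * exp (\<epsilon> * (norm Z)\<^sup>2)))"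
    using integrable_pairing_majorant by blast
  interpret G: gs_family "\<lambda>Z y. pairing X Z * tf_shift g Z y" "\<lambda>Z. cmod (pairing X Z) * (K * exp (\<epsilon> * (norm Z)\<^sup>2))" "h' \<epsilon>" "b' \<epsilon>"
    by (rule pairing_gs_family[OF e(1)])
  have int: "integrable (lborel \<Otimes>\<^sub>M lborel) (\<lambda>Z. pairing X Z * tf_shift g Z y)"
    using G.integrable_iter_deriv[OF e(2), of "[]" y] by (simp add: lborel_prod)
  have "(LINT Z|lborel. pairing X Z * tf_shift g Z y) = (LINT x'|lborel. LINT \<xi>|lborel. pairing X (x', \<xi>) * tf_shift g (x', \<xi>) y)"
    using lborel_pair.integral_fst'[OF int] by (simp add: lborel_prod)
  also have "\<dots> = (LINT x'|lborel. g (y - x') * (LINT \<xi>|lborel. pairing X (x', \<xi>) * cis (- (y \<bullet> \<xi>))))"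
    unfolding integral_mult_right_zero[symmetric] by (simp add: tf_shift_def mult_ac)
  also have "\<dots> = (LINT x'|lborel. (complex_of_real ((2 * pi) ^ CARD('d)) * tf_shift g X y) * complex_of_real ((cmod (g (y - x')))\<^sup>2))"
    unfolding pairing_inversion
    by (rule Bochner_Integration.integral_cong[OF refl]) (simp add: complex_norm_square mult_ac del: of_real_power)
  also have "\<dots> = (complex_of_real ((2 * pi) ^ CARD('d)) * tf_shift g X y) * (LINT x'|lborel. complex_of_real ((cmod (g (y - x')))\<^sup>2))"
    by (rule integral_mult_right_zero)
  also have "(LINT x'|lborel. complex_of_real ((cmod (g (y - x')))\<^sup>2)) = complex_of_real energy"
  proof -
    have "continuous_on UNIV (\<lambda>s. (cmod (g (- s)))\<^sup>2)"
      by (intro continuous_intros continuous_on_compose2[OF cont_g[of UNIV]]) auto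
    from lborel_integral_shift(1)[OF borel_measurable_continuous_onI[OF this], of y]
    have "(LINT x'|lborel. (cmod (g (y - x')))\<^sup>2) = energy" by (simp add: energy_def)
    thus ?thesis by (simp only: integral_complex_of_real)
  qed
  finally show ?thesis by (simp add: mult_ac)
qed

text \<open>The functional is applied under the integral sign in the reproducing formula.\<close>

lemma reproducing_inequality:
  assumes "g \<noteq> (\<lambda>_. 0)"
  obtains A a where "A > 0" "a > 0" "\<And>u X. u \<in> gs_S_dual (1/2) \<Longrightarrow>
    ennreal (cmod (u (tf_shift g X))) \<le> (\<integral>\<^sup>+ Z. ennreal (A * gauss a (X - Z) * cmod (u (tf_shift g Z))) \<partial>lborel)"
proof -
  obtain A a where Aa: "A > 0" "a > 0" "\<And>X Z. cmod (pairing X Z) \<le> A * gauss a (X - Z)"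
    using pairing_decay by blast
  define c where "c = (2 * pi) ^ CARD('d) * energy"
  have c: "c > 0" using energy_pos[OF assms] by (simp add: c_def)
  have "ennreal (cmod (u (tf_shift g X))) \<le> (\<integral>\<^sup>+ Z. ennreal (A / c * gauss a (X - Z) * cmod (u (tf_shift g Z))) \<partial>lborel)"
    if u: "u \<in> gs_S_dual (1/2)" for u X
  proof -
    obtain \<epsilon> where e: "\<epsilon> > 0" "\<And>X. integrable lborel (\<lambda>Z. cmod (pairing X Z) * (K * exp (\<epsilon> * (norm Z)\<^sup>2)))"
      using integrable_pairing_majorant by blast
    interpret G: gs_family "\<lambda>Z y. pairing X Z * tf_shift g Z y" "\<lambda>Z. cmod (pairing X Z) * (K * exp (\<epsilon> * (norm Z)\<^sup>2))" "h' \<epsilon>" "b' \<epsilon>"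
      by (rule pairing_gs_family[OF e(1)])
    have lin: "u (\<lambda>y. w * tf_shift g Z y) = w * u (tf_shift g Z)" for w Z
      using gs_S_dual_lin[OF u tf_shift_in_gs_S gs_S_zero, of w Z 0] by simp
    have "complex_of_real c * u (tf_shift g X) = u (\<lambda>y. complex_of_real c * tf_shift g X y)" by (rule lin[symmetric])
    also have "\<dots> = u (\<lambda>y. LINT Z|lborel. pairing X Z * tf_shift g Z y)" by (simp only: tf_shift_reproducing c_def)
    also have "\<dots> = (LINT Z|lborel. pairing X Z * u (tf_shift g Z))"
      using G.functional_integral(2)[OF e(2) u] by (simp only: lin)
    finally have eq: "u (tf_shift g X) = (LINT Z|lborel. pairing X Z * u (tf_shift g Z)) / complex_of_real c"
      using c by (simp add: field_simps)
    have int: "integrable lborel (\<lambda>Z. pairing X Z * u (tf_shift g Z))"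
      using G.functional_integral(1)[OF e(2) u] by (simp only: lin)
    have "u (tf_shift g X) = (LINT Z|lborel. pairing X Z * u (tf_shift g Z) / complex_of_real c)"
      unfolding eq by simp
    hence "ennreal (cmod (u (tf_shift g X))) \<le> (\<integral>\<^sup>+ Z. ennreal (cmod (pairing X Z * u (tf_shift g Z) / complex_of_real c)) \<partial>lborel)"
      using integral_norm_bound_ennreal[of lborel "\<lambda>Z. pairing X Z * u (tf_shift g Z) / complex_of_real c"] int by simp
    also have "\<dots> \<le> (\<integral>\<^sup>+ Z. ennreal (A / c * gauss a (X - Z) * cmod (u (tf_shift g Z))) \<partial>lborel)"
    proof (intro nn_integral_mono ennreal_leI)
      fix Z
      have "cmod (pairing X Z) * cmod (u (tf_shift g Z)) \<le> (A * gauss a (X - Z)) * cmod (u (tf_shift g Z))"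
        using Aa(3) by (intro mult_right_mono) auto
      from divide_right_mono[OF this, of c] c
      show "cmod (pairing X Z * u (tf_shift g Z) / complex_of_real c) \<le> A / c * gauss a (X - Z) * cmod (u (tf_shift g Z))"
        by (simp add: norm_mult norm_divide)
    qed
    finally show ?thesis .
  qed
  thus ?thesis using that[of "A / c" a] Aa c by simp
qed

text \<open>For \<open>r < 1\<close> the factor \<open>|V|\<^bsup>1-r\<^esup>\<close> in the reproducing inequality is estimated by the supremum of
  \<open>|V|\<close> against a slowly decaying Gaussian around the given point. That supremum is finite by the
  growth bound, and the same inequality then bounds it in terms of itself.\<close>

lemma subaveraging_inequality:
  assumes "g \<noteq> (\<lambda>_. 0)" and r: "0 < r" "r \<le> 1"
  obtains A \<gamma> where "A > 0" "\<gamma> > 0" "\<And>u X. u \<in> gs_S_dual (1/2) \<Longrightarrow>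
    ennreal (cmod (u (tf_shift g X)) powr r)
      \<le> (\<integral>\<^sup>+ Z. ennreal (A * gauss \<gamma> (X - Z) * cmod (u (tf_shift g Z)) powr r) \<partial>lborel)"
proof -
  obtain A a where Aa: "A > 0" "a > 0" "\<And>u X. u \<in> gs_S_dual (1/2) \<Longrightarrow>
    ennreal (cmod (u (tf_shift g X))) \<le> (\<integral>\<^sup>+ Z. ennreal (A * gauss a (X - Z) * cmod (u (tf_shift g Z))) \<partial>lborel)"
    using reproducing_inequality[OF assms(1)] by blast
  \<comment> \<open>The exponent \<open>\<gamma>\<close> below is positive if and only if \<open>(1-r)\<epsilon> < ra\<close>.\<close>
  define \<epsilon> where "\<epsilon> = a * r / 2"
  define \<gamma> where "\<gamma> = a * \<epsilon> / (a + \<epsilon>) - (1 - r) * \<epsilon>"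
  have e: "\<epsilon> > 0" using Aa r by (simp add: \<epsilon>_def)
  have "a + \<epsilon> = a * (1 + r / 2)" by (simp add: \<epsilon>_def algebra_simps)
  hence "a / (a + \<epsilon>) = 1 / (1 + r / 2)" using Aa(2) by simp
  moreover have "1 - r < 1 / (1 + r / 2)"
  proof -
    have eq: "(1 - r) * (1 + r / 2) = 1 - (r + r * r) / 2" by (simp add: field_simps)
    have "0 < r + r * r" using r by (simp add: add_pos_pos)
    hence "(1 - r) * (1 + r / 2) < 1" unfolding eq by simp
    thus ?thesis using r by (subst pos_less_divide_eq) auto
  qed
  ultimately have "1 - r < a / (a + \<epsilon>)" by simp
  hence "\<epsilon> * (1 - r) < \<epsilon> * (a / (a + \<epsilon>))" using e by (rule mult_strict_left_mono)
  hence \<gamma>: "\<gamma> > 0" by (simp add: \<gamma>_def mult.commute)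
  have "ennreal (cmod (u (tf_shift g X0)) powr r)
      \<le> (\<integral>\<^sup>+ Z. ennreal (A * gauss \<gamma> (X0 - Z) * cmod (u (tf_shift g Z)) powr r) \<partial>lborel)"
    if u: "u \<in> gs_S_dual (1/2)" for u X0
  proof -
    define V where "V = (\<lambda>X. cmod (u (tf_shift g X)))"
    define J where "J = (\<integral>\<^sup>+ Z. ennreal (A * gauss \<gamma> (X0 - Z) * V Z powr r) \<partial>lborel)"
    have V0: "V X \<ge> 0" for X by (simp add: V_def)
    define W where "W = (\<lambda>X. V X * gauss \<epsilon> (X - X0))"
    have e2: "\<epsilon> / 2 > 0" using e by simp
    obtain C where C: "C > 0" "\<And>X. V X \<le> C * exp (\<epsilon> / 2 * (norm X)\<^sup>2)"
      using functional_tf_shift_growth[OF u e2] unfolding V_def by blast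
    have "bdd_above (range W)"
    proof (rule bdd_aboveI2)
      fix X
      have "(1/2) * (norm X)\<^sup>2 \<le> (norm (X - X0))\<^sup>2 + (norm X0)\<^sup>2"
        using harmonic_norm_ineq[of 1 1 "X - X0" X0] by simp
      from mult_left_mono[OF this, of \<epsilon>] e
      have "\<epsilon> / 2 * (norm X)\<^sup>2 + - \<epsilon> * (norm (X - X0))\<^sup>2 \<le> \<epsilon> * (norm X0)\<^sup>2" by (simp add: algebra_simps)
      hence le: "exp (\<epsilon> / 2 * (norm X)\<^sup>2) * gauss \<epsilon> (X - X0) \<le> exp (\<epsilon> * (norm X0)\<^sup>2)"
        unfolding exp_add[symmetric] by (simp only: exp_le_cancel_iff)
      have "W X \<le> C * exp (\<epsilon> / 2 * (norm X)\<^sup>2) * gauss \<epsilon> (X - X0)"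
        unfolding W_def using C(2) by (intro mult_right_mono) auto
      also have "\<dots> \<le> C * exp (\<epsilon> * (norm X0)\<^sup>2)" using mult_left_mono[OF le, of C] C(1) by (simp add: mult.assoc)
      finally show "W X \<le> C * exp (\<epsilon> * (norm X0)\<^sup>2)" .
    qed
    hence WM: "W X \<le> Sup (range W)" for X by (intro cSup_upper) auto
    define M where "M = Sup (range W)"
    have M0: "M \<ge> 0" using order_trans[OF _ WM[of X0]] V0 by (simp add: M_def W_def)
    have VM: "V Z \<le> M * exp (\<epsilon> * (norm (Z - X0))\<^sup>2)" for Z
    proof -
      have "V Z = W Z * exp (\<epsilon> * (norm (Z - X0))\<^sup>2)" by (simp add: W_def mult.assoc flip: exp_add)
      thus ?thesis using WM[of Z] by (simp add: M_def)
    qed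
    \<comment> \<open>The inequality for the supremum \<open>M\<close> in terms of itself.\<close>
    have key: "ennreal (W X) \<le> ennreal (M powr (1 - r)) * J" if "M > 0" for X
    proof -
      have "ennreal (W X) = ennreal (gauss \<epsilon> (X - X0)) * ennreal (V X)"
        by (simp add: W_def ennreal_mult'' mult.commute V0)
      also have "\<dots> \<le> ennreal (gauss \<epsilon> (X - X0)) * (\<integral>\<^sup>+ Z. ennreal (A * gauss a (X - Z) * V Z) \<partial>lborel)"
        unfolding V_def by (intro mult_left_mono Aa(3)[OF u]) auto
      also have "\<dots> = (\<integral>\<^sup>+ Z. ennreal (gauss \<epsilon> (X - X0)) * ennreal (A * gauss a (X - Z) * V Z) \<partial>lborel)"
      proof (rule nn_integral_cmult[symmetric])
        have "V \<in> borel_measurable borel" unfolding V_def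
          using borel_measurable_continuous_onI[OF continuous_functional_tf_shift[OF u]] by simp
        thus "(\<lambda>Z. ennreal (A * gauss a (X - Z) * V Z)) \<in> borel_measurable lborel" by measurable
      qed
      also have "\<dots> \<le> (\<integral>\<^sup>+ Z. ennreal (M powr (1 - r)) * ennreal (A * gauss \<gamma> (X0 - Z) * V Z powr r) \<partial>lborel)"
      proof (rule nn_integral_mono)
        fix Z
        have "(a * \<epsilon> / (a + \<epsilon>)) * (norm (Z - X0))\<^sup>2 \<le> a * (norm (X - Z))\<^sup>2 + \<epsilon> * (norm (X - X0))\<^sup>2"
          using harmonic_norm_ineq[of a \<epsilon> "Z - X" "X - X0"] Aa(2) e by (simp add: norm_minus_commute)
        hence "- \<epsilon> * (norm (X - X0))\<^sup>2 + - a * (norm (X - Z))\<^sup>2 + (1 - r) * (\<epsilon> * (norm (Z - X0))\<^sup>2) \<le> - \<gamma> * (norm (X0 - Z))\<^sup>2"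
          by (simp add: \<gamma>_def algebra_simps norm_minus_commute)
        hence ex: "gauss \<epsilon> (X - X0) * gauss a (X - Z) * exp ((1 - r) * (\<epsilon> * (norm (Z - X0))\<^sup>2)) \<le> gauss \<gamma> (X0 - Z)"
          unfolding exp_add[symmetric] by (simp only: exp_le_cancel_iff)
        have V1: "V Z \<le> V Z powr r * (M powr (1 - r) * exp ((1 - r) * (\<epsilon> * (norm (Z - X0))\<^sup>2)))"
        proof (cases "V Z = 0")
          case False
          hence pos: "V Z > 0" using V0[of Z] by simp
          have "V Z = V Z powr r * V Z powr (1 - r)" using pos by (simp flip: powr_add)
          also have "V Z powr (1 - r) \<le> (M * exp (\<epsilon> * (norm (Z - X0))\<^sup>2)) powr (1 - r)"
            using VM V0 r by (intro powr_mono2) auto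
          also have "\<dots> = M powr (1 - r) * exp ((1 - r) * (\<epsilon> * (norm (Z - X0))\<^sup>2))"
            using M0 by (simp add: powr_mult exp_powr_real mult.commute)
          finally show ?thesis by (simp add: mult_left_mono)
        qed simp
        have "gauss \<epsilon> (X - X0) * (A * gauss a (X - Z) * V Z)
          \<le> gauss \<epsilon> (X - X0) * (A * gauss a (X - Z) * (V Z powr r * (M powr (1 - r) * exp ((1 - r) * (\<epsilon> * (norm (Z - X0))\<^sup>2)))))"
          using Aa(1) by (intro mult_left_mono V1) auto
        also have "\<dots> = (M powr (1 - r) * A * V Z powr r) * (gauss \<epsilon> (X - X0) * gauss a (X - Z) * exp ((1 - r) * (\<epsilon> * (norm (Z - X0))\<^sup>2)))"
          by (simp only: mult_ac)
        also have "\<dots> \<le> (M powr (1 - r) * A * V Z powr r) * gauss \<gamma> (X0 - Z)"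
          using Aa(1) by (intro mult_left_mono ex) auto
        finally have "gauss \<epsilon> (X - X0) * (A * gauss a (X - Z) * V Z)
           \<le> M powr (1 - r) * (A * gauss \<gamma> (X0 - Z) * V Z powr r)" by (simp add: mult_ac)
        thus "ennreal (gauss \<epsilon> (X - X0)) * ennreal (A * gauss a (X - Z) * V Z)
          \<le> ennreal (M powr (1 - r)) * ennreal (A * gauss \<gamma> (X0 - Z) * V Z powr r)"
          using Aa(1) V0 by (simp add: ennreal_mult'[symmetric] ennreal_leI)
      qed
      also have "\<dots> = ennreal (M powr (1 - r)) * J"
        unfolding J_def
      proof (rule nn_integral_cmult)
        have [measurable]: "V \<in> borel_measurable borel" unfolding V_def
          using borel_measurable_continuous_onI[OF continuous_functional_tf_shift[OF u]] by simp
        show "(\<lambda>Z. ennreal (A * gauss \<gamma> (X0 - Z) * V Z powr r)) \<in> borel_measurable lborel" by measurable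
      qed
      finally show ?thesis .
    qed
    have "ennreal (V X0 powr r) \<le> J"
    proof (cases "M = 0 \<or> J = \<infinity>")
      case True
      have "M = 0 \<Longrightarrow> V X0 = 0" using VM[of X0] V0[of X0] by simp
      thus ?thesis using True by auto
    next
      case False
      hence M: "M > 0" using M0 by simp
      obtain j where j: "J = ennreal j" "j \<ge> 0" using False by (cases J) auto
      have "W X \<le> M powr (1 - r) * j" for X
        using key[OF M, of X] j by (simp add: ennreal_mult'[symmetric])
      hence "M \<le> M powr (1 - r) * j" unfolding M_def by (intro cSup_least) auto
      moreover have "M powr (1 - r) * M powr r = M" using M by (simp flip: powr_add)
      ultimately have "M powr (1 - r) * M powr r \<le> M powr (1 - r) * j" by simp
      hence "M powr r \<le> j" using M by simp
      moreover have "V X0 powr r \<le> M powr r" using VM[of X0] V0[of X0] r by (intro powr_mono2) auto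
      ultimately show ?thesis using j by (simp add: ennreal_leI)
    qed
    thus ?thesis unfolding J_def V_def .
  qed
  thus ?thesis using that[of A \<gamma>] Aa(1) \<gamma> by blast
qed

end

section \<open>Moderate weights\<close>

text \<open>The majorant \<open>v\<close> is bounded only almost everywhere on compact sets. Every small \<open>z\<close> is a sum of
  two points at which \<open>v\<close> is bounded, so the estimate holds at every point after applying it twice.\<close>

lemma moderate_weight_local_bound:
  fixes \<omega> :: "'a::euclidean_space \<Rightarrow> real"
  assumes "\<omega> \<in> moderate_weights"
  obtains D where "D \<ge> 1" "\<And>x z. norm z \<le> 1/2 \<Longrightarrow> \<omega> (x + z) \<le> D * \<omega> x"
proof -
  obtain v C where pos: "\<And>x. 0 < \<omega> x" "\<And>x. 0 < v x" and v: "Linf_loc v" and mod: "\<And>x y. \<omega> (x + y) \<le> C * \<omega> x * v y"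
    using assms unfolding moderate_weights_def weight_def by blast
  have C: "C > 0"
  proof -
    have "0 < C * (\<omega> 0 * v 0)" using less_le_trans[OF pos(1) mod[of 0 0]] by (simp add: mult_ac)
    moreover have "0 < \<omega> 0 * v 0" using pos by simp
    ultimately show ?thesis by (simp add: zero_less_mult_iff)
  qed
  obtain M where "AE x in lebesgue. x \<in> cball (0::'a) 1 \<longrightarrow> \<bar>v x\<bar> \<le> M"
    using v unfolding Linf_loc_def using compact_cball by blast
  then obtain N where N: "negligible N" "\<And>x. x \<in> cball (0::'a) 1 \<Longrightarrow> x \<notin> N \<Longrightarrow> v x \<le> M"
  proof -
    from \<open>AE x in lebesgue. x \<in> cball (0::'a) 1 \<longrightarrow> \<bar>v x\<bar> \<le> M\<close> obtain N where
      N: "N \<in> null_sets lebesgue" "{x \<in> space lebesgue. \<not> (x \<in> cball (0::'a) 1 \<longrightarrow> \<bar>v x\<bar> \<le> M)} \<subseteq> N"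
      unfolding eventually_ae_filter by blast
    show ?thesis
    proof (rule that[of N])
      show "negligible N" using N(1) by (simp add: negligible_iff_null_sets)
      fix x assume "x \<in> cball (0::'a) 1" "x \<notin> N"
      hence "\<bar>v x\<bar> \<le> M" using N(2) by auto
      thus "v x \<le> M" by simp
    qed
  qed
  have le: "\<omega> (x + z) \<le> (C * M)\<^sup>2 * \<omega> x" if z: "norm z \<le> 1/2" for x z
  proof -
    have "negligible ((\<lambda>y. z - y) ` N)"
    proof (rule negligible_differentiable_image_negligible[OF order_refl N(1)])
      show "(\<lambda>y. z - y) differentiable_on N" by (simp add: differentiable_on_def)
    qed
    hence "negligible (N \<union> (\<lambda>y. z - y) ` N)" using N(1) by (rule negligible_Un[rotated])
    moreover have "\<not> negligible (ball (0::'a) (1/2))" by (intro open_not_negligible) auto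
    ultimately obtain y where y: "y \<in> ball (0::'a) (1/2)" "y \<notin> N" "y \<notin> (\<lambda>y. z - y) ` N"
      using negligible_subset by blast
    have "z - y \<notin> N"
    proof
      assume "z - y \<in> N"
      hence "z - (z - y) \<in> (\<lambda>y. z - y) ` N" by blast
      thus False using y(3) by simp
    qed
    moreover have "norm (z - y) \<le> 1" using norm_triangle_ineq4[of z y] z y(1) by simp
    ultimately have 2: "v (z - y) \<le> M" by (intro N(2)) auto
    have 1: "v y \<le> M" using y by (intro N(2)) auto
    have M: "M > 0" using less_le_trans[OF pos(2) 1] .
    have "\<omega> (x + z) = \<omega> ((x + y) + (z - y))" by (simp add: algebra_simps)
    also have "\<dots> \<le> C * \<omega> (x + y) * v (z - y)" by (rule mod)
    also have "\<dots> \<le> C * (C * \<omega> x * M) * M"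
    proof (intro mult_mono mult_left_mono)
      have "C * \<omega> x * v y \<le> C * \<omega> x * M" using C pos 1 by (intro mult_left_mono) (auto intro: less_imp_le)
      thus "\<omega> (x + y) \<le> C * \<omega> x * M" using mod[of x y] by simp
    qed (use C pos 2 M in \<open>auto intro: less_imp_le mult_nonneg_nonneg\<close>)
    finally show ?thesis by (simp add: power2_eq_square mult_ac)
  qed
  have "\<omega> 0 * 1 \<le> \<omega> 0 * (C * M)\<^sup>2" using le[of 0 0] by (simp add: mult.commute)
  hence "1 \<le> (C * M)\<^sup>2" using pos(1)[of 0] by (simp only: mult_le_cancel_left_pos)
  thus ?thesis using that le by blast
qed

text \<open>A path of \<open>n \<le> 2|z| + 2\<close> steps of length at most \<open>1/2\<close> leads from \<open>x\<close> to \<open>x + z\<close>.\<close>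

lemma moderate_weight_exponential_bound:
  fixes \<omega> :: "'a::euclidean_space \<Rightarrow> real"
  assumes "\<omega> \<in> moderate_weights"
  obtains B a where "B > 0" "a \<ge> 0" "\<And>x z. \<omega> (x + z) \<le> B * exp (a * norm z) * \<omega> x"
proof -
  have pos: "0 < \<omega> x" for x using assms unfolding moderate_weights_def weight_def by blast
  obtain D where D: "D \<ge> 1" "\<And>x z. norm z \<le> 1/2 \<Longrightarrow> \<omega> (x + z) \<le> D * \<omega> x"
    using moderate_weight_local_bound[OF assms] by blast
  have iter: "\<omega> (x + real n *\<^sub>R z) \<le> D ^ n * \<omega> x" if "norm z \<le> 1/2" for x z n
  proof (induct n)
    case (Suc n)
    have "\<omega> (x + real (Suc n) *\<^sub>R z) = \<omega> ((x + real n *\<^sub>R z) + z)" by (simp add: algebra_simps)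
    also have "\<dots> \<le> D * \<omega> (x + real n *\<^sub>R z)" by (rule D(2)[OF that])
    also have "\<dots> \<le> D * (D ^ n * \<omega> x)" using Suc D(1) by (intro mult_left_mono) auto
    finally show ?case by simp
  qed simp
  have "\<omega> (x + z) \<le> D\<^sup>2 * exp (2 * ln D * norm z) * \<omega> x" for x z
  proof -
    define n where "n = Suc (nat \<lceil>2 * norm z\<rceil>)"
    have n: "2 * norm z \<le> real n" "real n \<le> 2 * norm z + 2" "n > 0" unfolding n_def by (simp_all, linarith+)
    have "norm ((1 / real n) *\<^sub>R z) \<le> 1/2" using n by (simp add: field_simps)
    from iter[OF this, of x n] have "\<omega> (x + z) \<le> D ^ n * \<omega> x" using n by simp
    also have "D ^ n = D powr real n" using D(1) by (simp add: powr_realpow)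
    also have "\<dots> \<le> D powr (2 * norm z + 2)" using n D(1) by (intro powr_mono) auto
    also have "D powr (2 * norm z + 2) = D powr 2 * D powr (2 * norm z)" by (simp add: powr_add)
    also have "D powr 2 * D powr (2 * norm z) = D\<^sup>2 * exp (2 * ln D * norm z)"
    proof -
      have "D powr (2 * norm z) = exp (2 * ln D * norm z)" using D(1) by (simp add: powr_def mult_ac)
      thus ?thesis using D(1) by simp
    qed
    finally show ?thesis using pos[of x] by simp
  qed
  thus ?thesis using that[of "D\<^sup>2" "2 * ln D"] D(1) by simp
qed

text \<open>The infimal convolution \<open>inf\<^sub>z B exp(a|x - z|) \<omega>(z)\<close> inherits the growth of the exponential. Unlike
  \<open>\<omega>\<close>, which is only Lebesgue measurable, it is continuous, so its restrictions to lines can be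
  integrated.\<close>

lemma moderate_weight_regularization:
  fixes \<omega> :: "'a::euclidean_space \<Rightarrow> real"
  assumes "\<omega> \<in> moderate_weights"
  obtains \<omega>' c a where "c > 0" "a \<ge> 0" "continuous_on UNIV \<omega>'" "\<And>x. 0 < \<omega>' x" "\<And>x. \<omega> x \<le> \<omega>' x" "\<And>x. \<omega>' x \<le> c * \<omega> x"
    "\<And>x z. \<omega>' x \<le> exp (a * norm (x - z)) * \<omega>' z"
proof -
  have pos: "0 < \<omega> x" for x using assms unfolding moderate_weights_def weight_def by blast
  obtain B a where Ba: "B > 0" "a \<ge> 0" "\<And>x z. \<omega> (x + z) \<le> B * exp (a * norm z) * \<omega> x"
    using moderate_weight_exponential_bound[OF assms] by blast
  define S where "S = (\<lambda>x z. B * exp (a * norm (x - z)) * \<omega> z)"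
  define W where "W = (\<lambda>x. Inf (range (S x)))"
  have S: "\<omega> x \<le> S x z" for x z using Ba(3)[of z "x - z"] by (simp add: S_def)
  have bdd: "bdd_below (range (S x))" for x by (rule bdd_belowI2[of _ "\<omega> x"]) (rule S)
  have 1: "\<omega> x \<le> W x" for x unfolding W_def by (rule cInf_greatest) (auto intro: S)
  have Wle: "W x \<le> S x z" for x z unfolding W_def by (rule cInf_lower[OF _ bdd]) simp
  have 2: "W x \<le> B * \<omega> x" for x using Wle[of x x] by (simp add: S_def)
  have 3: "W x \<le> exp (a * norm (x - z)) * W z" for x z
  proof -
    have "exp (- (a * norm (x - z))) * W x \<le> W z"
    proof -
      have "exp (- (a * norm (x - z))) * W x \<le> Inf (range (S z))"
      proof (rule cInf_greatest)
      fix s assume "s \<in> range (S z)"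
      then obtain t where t: "s = S z t" by blast
      have "W x \<le> S x t" by (rule Wle)
      also have "\<dots> \<le> exp (a * norm (x - z)) * S z t"
      proof -
        have "norm (x - t) \<le> norm (x - z) + norm (z - t)" using norm_triangle_ineq[of "x - z" "z - t"] by simp
        from mult_left_mono[OF this Ba(2)] have "exp (a * norm (x - t)) \<le> exp (a * norm (x - z)) * exp (a * norm (z - t))"
          by (simp add: distrib_left flip: exp_add)
        from mult_left_mono[OF this, of "B * \<omega> t"] show ?thesis using Ba(1) pos[of t] by (simp add: S_def mult_ac)
      qed
      finally have "exp (- (a * norm (x - z))) * W x \<le> exp (- (a * norm (x - z))) * (exp (a * norm (x - z)) * S z t)"
        by (intro mult_left_mono) auto
      thus "exp (- (a * norm (x - z))) * W x \<le> s" unfolding t mult.assoc[symmetric] exp_add[symmetric] by simp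
      qed auto
      thus ?thesis by (simp add: W_def)
    qed
    hence "exp (a * norm (x - z)) * (exp (- (a * norm (x - z))) * W x) \<le> exp (a * norm (x - z)) * W z"
      by (intro mult_left_mono) auto
    thus ?thesis unfolding mult.assoc[symmetric] exp_add[symmetric] by simp
  qed
  have "isCont W x0" for x0
    unfolding isCont_def
  proof (rule tendsto_sandwich)
    show "\<forall>\<^sub>F x in at x0. exp (- (a * norm (x0 - x))) * W x0 \<le> W x"
    proof (rule always_eventually, rule allI)
      fix x
      have "exp (- (a * norm (x0 - x))) * W x0 \<le> exp (- (a * norm (x0 - x))) * (exp (a * norm (x0 - x)) * W x)"
        by (intro mult_left_mono 3) auto
      thus "exp (- (a * norm (x0 - x))) * W x0 \<le> W x" unfolding mult.assoc[symmetric] exp_add[symmetric] by simp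
    qed
    show "\<forall>\<^sub>F x in at x0. W x \<le> exp (a * norm (x - x0)) * W x0" using 3 by (intro always_eventually) auto
    have "((\<lambda>x. exp (- (a * norm (x0 - x))) * W x0) \<longlongrightarrow> exp (- (a * norm (x0 - x0))) * W x0) (at x0)"
      by (intro tendsto_intros)
    thus "((\<lambda>x. exp (- (a * norm (x0 - x))) * W x0) \<longlongrightarrow> W x0) (at x0)" by simp
    have "((\<lambda>x. exp (a * norm (x - x0)) * W x0) \<longlongrightarrow> exp (a * norm (x0 - x0)) * W x0) (at x0)"
      by (intro tendsto_intros)
    thus "((\<lambda>x. exp (a * norm (x - x0)) * W x0) \<longlongrightarrow> W x0) (at x0)" by simp
  qed
  hence "continuous_on UNIV W" by (simp add: continuous_on_eq_continuous_at)
  thus ?thesis using that[of B a W] Ba 1 2 3 less_le_trans[OF pos 1] by blast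
qed

section \<open>One-variable quasi-norms\<close>

subsection \<open>Powers in the extended half-line\<close>

lemma epow_top [simp]: "epow top a = top"
  by (simp add: epow_def infinity_ennreal_def)

lemma epow_ennreal: "x \<ge> 0 \<Longrightarrow> epow (ennreal x) a = ennreal (x powr a)"
  by (simp add: epow_def infinity_ennreal_def)

lemma epow_0 [simp]: "epow 0 a = 0"
  using epow_ennreal[of 0 a] by simp

lemma epow_1 [simp]: "epow x 1 = x"
  by (cases x) (simp_all add: epow_ennreal)

lemma epow_one [simp]: "epow 1 a = 1"
  using epow_ennreal[of 1 a] by simp

lemma epow_mono: "a > 0 \<Longrightarrow> x \<le> y \<Longrightarrow> epow x a \<le> epow y a"
  by (cases x; cases y) (auto simp: epow_ennreal ennreal_leI powr_mono2 top_unique)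

lemma epow_epow: "a > 0 \<Longrightarrow> epow (epow x a) b = epow x (a * b)"
  by (cases x) (simp_all add: epow_ennreal powr_powr)

lemma epow_inverse: "a > 0 \<Longrightarrow> epow (epow x a) (1 / a) = x" "a > 0 \<Longrightarrow> epow (epow x (1 / a)) a = x"
  by (simp_all add: epow_epow)

lemma epow_eq_0_iff: "a > 0 \<Longrightarrow> epow x a = 0 \<longleftrightarrow> x = 0"
  by (cases x) (auto simp: epow_ennreal)

lemma epow_mult: "a > 0 \<Longrightarrow> epow (x * y) a = epow x a * epow y a"
proof (cases "x = 0 \<or> y = 0")
  case False
  assume "a > 0"
  with False show ?thesis
    by (cases x; cases y) (auto simp: ennreal_mult_top ennreal_top_mult epow_ennreal epow_eq_0_iff powr_mult ennreal_mult'[symmetric])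
qed auto

lemma borel_measurable_epow [measurable (raw)]:
  assumes f: "f \<in> borel_measurable M"
  shows "(\<lambda>x. epow (f x) a) \<in> borel_measurable M"
proof -
  have "(\<lambda>x. epow x a) \<in> borel_measurable borel"
    unfolding epow_def infinity_ennreal_def by (rule measurable_If) auto
  from measurable_compose[OF f this] show ?thesis .
qed

lemma ennreal_mult_inverse: "a \<noteq> 0 \<Longrightarrow> a \<noteq> top \<Longrightarrow> a * inverse a = (1 :: ennreal)"
  using ennreal_divide_self[of a] by (simp add: divide_ennreal_def less_top)

lemma epow_mono_iff: "a > 0 \<Longrightarrow> epow x a \<le> epow y a \<longleftrightarrow> x \<le> y"
  using epow_mono[of a x y] epow_mono[of "1 / a" "epow x a" "epow y a"] by (auto simp: epow_inverse)

lemma epow_tangent: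
  assumes q: "q \<ge> 1" and l: "l > 0"
  shows "ennreal (q * l powr (q - 1)) * x \<le> epow x q + ennreal ((q - 1) * l powr q)"
proof (cases x)
  case (real r)
  have "q * l powr (q - 1) * r \<le> r powr q + (q - 1) * l powr q"
  proof (cases "r = 0")
    case False
    with real have r: "r > 0" by simp
    have "(r powr q) powr (1 / q) * (l powr q) powr (1 - 1 / q) \<le> (1 / q) * r powr q + (1 - 1 / q) * l powr q"
      by (rule Youngs_inequality_0) (use q r l in auto)
    moreover have "q * (1 - 1 / q) = q - 1" using q by (simp add: field_simps)
    ultimately have "r * l powr (q - 1) \<le> (1 / q) * r powr q + (1 - 1 / q) * l powr q"
      using q r by (simp add: powr_powr)
    from mult_left_mono[OF this, of q] q
    have "q * (r * l powr (q - 1)) \<le> r powr q + (q * (1 - 1 / q)) * l powr q"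
      by (simp add: distrib_left mult.assoc[symmetric])
    thus ?thesis unfolding \<open>q * (1 - 1 / q) = q - 1\<close> by (simp add: mult_ac)
  qed (use q in auto)
  moreover have "0 \<le> r powr q + (q - 1) * l powr q" using q by simp
  ultimately show ?thesis
    using real q by (simp add: epow_ennreal ennreal_mult'[symmetric] ennreal_plus[symmetric] ennreal_leI del: ennreal_plus)
qed simp

text \<open>Comparison with the tangents at all finite points below the mean, so that the mean may be
  infinite.\<close>

lemma Jensen_epow:
  assumes [measurable]: "w \<in> borel_measurable M" "f \<in> borel_measurable M"
    and w: "(\<integral>\<^sup>+ s. w s \<partial>M) \<le> 1" and q: "q \<ge> 1"
  shows "epow (\<integral>\<^sup>+ s. w s * f s \<partial>M) q \<le> (\<integral>\<^sup>+ s. w s * epow (f s) q \<partial>M)"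
proof -
  let ?R = "\<integral>\<^sup>+ s. w s * epow (f s) q \<partial>M" and ?m = "\<integral>\<^sup>+ s. w s * f s \<partial>M"
  have *: "ennreal (l powr q) \<le> ?R" if l: "l > 0" "ennreal l \<le> ?m" for l
  proof -
    have "ennreal (l powr q) + ennreal ((q - 1) * l powr q) = ennreal (q * l powr (q - 1)) * ennreal l"
    proof -
      have "l powr (q - 1) * l = l powr q" using l(1) powr_add[of l "q - 1" 1] by simp
      hence "l powr q + (q - 1) * l powr q = (q * l powr (q - 1)) * l" by (simp add: algebra_simps)
      thus ?thesis using q l(1)
        by (simp only: ennreal_mult'[symmetric] ennreal_plus[symmetric] mult_nonneg_nonneg powr_ge_zero diff_ge_0_iff_ge less_imp_le)
    qed
    also have "\<dots> \<le> ennreal (q * l powr (q - 1)) * ?m" by (intro mult_left_mono l) auto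
    also have "\<dots> = (\<integral>\<^sup>+ s. w s * (ennreal (q * l powr (q - 1)) * f s) \<partial>M)"
      by (subst nn_integral_cmult[symmetric]) (auto intro!: nn_integral_cong simp: mult_ac)
    also have "\<dots> \<le> (\<integral>\<^sup>+ s. w s * epow (f s) q + ennreal ((q - 1) * l powr q) * w s \<partial>M)"
    proof (rule nn_integral_mono)
      fix s
      from mult_left_mono[OF epow_tangent[OF q l(1), of "f s"], of "w s"]
      show "w s * (ennreal (q * l powr (q - 1)) * f s) \<le> w s * epow (f s) q + ennreal ((q - 1) * l powr q) * w s"
        by (simp add: distrib_left mult.commute)
    qed
    also have "\<dots> = ?R + ennreal ((q - 1) * l powr q) * (\<integral>\<^sup>+ s. w s \<partial>M)"
      by (simp add: nn_integral_add nn_integral_cmult)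
    also have "\<dots> \<le> ?R + ennreal ((q - 1) * l powr q) * 1" by (intro add_left_mono mult_left_mono w) auto
    finally show ?thesis by (simp add: add.commute[of _ "ennreal ((q - 1) * l powr q)"])
  qed
  show ?thesis
  proof (cases ?m)
    case (real m)
    thus ?thesis using *[of m] by (cases "m = 0") (simp_all add: epow_ennreal)
  next
    case top
    have "?R = top"
    proof (rule ccontr)
      assume "?R \<noteq> top"
      then obtain r where r: "?R = ennreal r" "r \<ge> 0" by (cases ?R) auto
      have "ennreal (((r + 1) powr (1 / q)) powr q) \<le> ennreal r"
        using *[of "(r + 1) powr (1 / q)"] top r by simp
      thus False using q r by (simp add: powr_powr)
    qed
    thus ?thesis by simp
  qed
qed

subsection \<open>Essential suprema and measurability\<close>

lemma AE_le_Limsup: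
  fixes f :: "'a \<Rightarrow> ennreal"
  shows "AE x in M. f x \<le> Limsup (ae_filter M) f"
proof (cases "Limsup (ae_filter M) f = top")
  case False
  let ?L = "Limsup (ae_filter M) f"
  have "AE x in M. f x < ?L + ennreal (1 / real (Suc n))" for n
  proof (rule Limsup_lessD)
    show "?L < ?L + ennreal (1 / real (Suc n))" using False
      by (cases ?L) (auto simp: ennreal_plus[symmetric] ennreal_less_iff simp del: ennreal_plus)
  qed
  hence "AE x in M. \<forall>n. f x < ?L + ennreal (1 / real (Suc n))" by (simp add: AE_all_countable)
  thus ?thesis
  proof eventually_elim
    case (elim x)
    show ?case
    proof (rule ennreal_le_epsilon)
      fix e :: real assume "e > 0"
      then obtain n where n: "1 / real (Suc n) < e" using nat_approx_posE by blast
      have "f x \<le> ?L + ennreal (1 / real (Suc n))" using elim less_imp_le by blast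
      also have "\<dots> \<le> ?L + ennreal e" using n by (intro add_left_mono ennreal_leI) auto
      finally show "f x \<le> ?L + ennreal e" .
    qed
  qed
qed simp

lemma Limsup_ae_le_iff: "Limsup (ae_filter M) f \<le> (c :: ennreal) \<longleftrightarrow> (AE x in M. f x \<le> c)"
proof
  assume c: "Limsup (ae_filter M) f \<le> c"
  show "AE x in M. f x \<le> c" using AE_le_Limsup[of f M] by eventually_elim (use c in auto)
qed (rule Limsup_bounded)

lemma Lp_qnorm_finite: "p \<noteq> \<infinity> \<Longrightarrow> Lp_qnorm p g = epow (\<integral>\<^sup>+ t. epow (g t) (enn2real p) \<partial>lborel) (1 / enn2real p)"
  by (simp add: Lp_qnorm_def)

lemma Lp_qnorm_infinite: "Lp_qnorm \<infinity> g = Limsup (ae_filter lborel) g"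
  by (simp add: Lp_qnorm_def)

lemma enn2real_pos: "0 < p \<Longrightarrow> p \<noteq> \<infinity> \<Longrightarrow> 0 < enn2real p"
  by (simp add: enn2real_positive_iff less_top)

lemma Lp_qnorm_mono:
  assumes "0 < p" "\<And>t. f t \<le> g t"
  shows "Lp_qnorm p f \<le> Lp_qnorm p g"
proof (cases "p = \<infinity>")
  case True
  show ?thesis unfolding True Lp_qnorm_infinite by (intro Limsup_mono always_eventually allI assms(2))
next
  case False
  thus ?thesis using enn2real_pos[OF assms(1) False]
    by (simp add: Lp_qnorm_finite epow_mono nn_integral_mono assms(2))
qed

text \<open>The essential supremum is at most \<open>c\<close> if and only if a certain integral vanishes, and integrals
  depend measurably on parameters.\<close>

lemma Lp_qnorm_measurable:
  assumes [measurable]: "(\<lambda>(y, t). g y t) \<in> borel_measurable (M \<Otimes>\<^sub>M lborel)"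
  shows "(\<lambda>y. Lp_qnorm p (g y)) \<in> borel_measurable M"
proof (cases "p = \<infinity>")
  case True
  show ?thesis
    unfolding True Lp_qnorm_infinite
  proof (rule borel_measurableI_le)
    fix c :: ennreal
    have eq: "Limsup (ae_filter lborel) (g y) \<le> c \<longleftrightarrow> (\<integral>\<^sup>+ t. indicator {u. \<not> u \<le> c} (g y t) \<partial>lborel) = 0" if y: "y \<in> space M" for y
    proof -
      have [measurable]: "g y \<in> borel_measurable lborel"
        using measurable_Pair2[OF assms y] by simp
      have "(\<integral>\<^sup>+ t. indicator {u. \<not> u \<le> c} (g y t) \<partial>lborel) = 0 \<longleftrightarrow> (AE t in lborel. indicator {u. \<not> u \<le> c} (g y t) = (0::ennreal))"
        by (rule nn_integral_0_iff_AE) measurable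
      also have "\<dots> \<longleftrightarrow> (AE t in lborel. g y t \<le> c)" by (simp add: indicator_def)
      finally show ?thesis by (simp add: Limsup_ae_le_iff)
    qed
    have [measurable]: "(\<lambda>y. \<integral>\<^sup>+ t. indicator {u. \<not> u \<le> c} (g y t) \<partial>lborel) \<in> borel_measurable M"
      by measurable
    have "{y \<in> space M. Limsup (ae_filter lborel) (g y) \<le> c} = {y \<in> space M. (\<integral>\<^sup>+ t. indicator {u. \<not> u \<le> c} (g y t) \<partial>lborel) = (0::ennreal)}"
      using eq by auto
    also have "\<dots> \<in> sets M" by measurable
    finally show "{y \<in> space M. Limsup (ae_filter lborel) (g y) \<le> c} \<in> sets M" .
  qed
next
  case False
  show ?thesis unfolding Lp_qnorm_finite[OF False] by measurable
qed

subsection \<open>Minkowski's integral inequality\<close>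

text \<open>Let \<open>A(s)\<close> be the norm of \<open>g(\<cdot>,s)\<close> and \<open>I = \<integral> k A\<close>. Jensen's inequality for the probability density
  \<open>k A / I\<close> and the function \<open>g(t,\<cdot>) / A\<close>, integrated over \<open>t\<close>, gives the bound \<open>1\<close> for the norm of the
  left-hand side divided by \<open>I\<close>. The left-hand side need not be finite in advance.\<close>

lemma Minkowski_Lp_qnorm:
  fixes g :: "real \<Rightarrow> real \<Rightarrow> ennreal"
  assumes g[measurable]: "(\<lambda>(t, s). g t s) \<in> borel_measurable (lborel \<Otimes>\<^sub>M lborel)"
    and k[measurable]: "k \<in> borel_measurable lborel" and k1: "(\<integral>\<^sup>+ s. k s \<partial>lborel) \<le> 1" and p: "1 \<le> p"
  shows "Lp_qnorm p (\<lambda>t. \<integral>\<^sup>+ s. k s * g t s \<partial>lborel) \<le> (\<integral>\<^sup>+ s. k s * Lp_qnorm p (\<lambda>t. g t s) \<partial>lborel)"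
proof -
  let ?H = "\<lambda>t. \<integral>\<^sup>+ s. k s * g t s \<partial>lborel" and ?A = "\<lambda>s. Lp_qnorm p (\<lambda>t. g t s)"
  have gs[measurable]: "(\<lambda>(s, t). g t s) \<in> borel_measurable (lborel \<Otimes>\<^sub>M lborel)"
    using measurable_compose[OF measurable_pair_swap' g] by (simp add: case_prod_beta)
  have A[measurable]: "?A \<in> borel_measurable lborel" by (rule Lp_qnorm_measurable) measurable
  show ?thesis
  proof (cases "p = \<infinity>")
    case True
    have 1: "AE s in lborel. AE t in lborel. g t s \<le> ?A s"
      unfolding True Lp_qnorm_infinite by (intro AE_I2 AE_le_Limsup)
    have "AE t in lborel. AE s in lborel. g t s \<le> ?A s"
    proof -
      have "{x \<in> space (lborel \<Otimes>\<^sub>M lborel). g (snd x) (fst x) \<le> ?A (fst x)} \<in> sets (lborel \<Otimes>\<^sub>M lborel)"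
      proof -
        have [measurable]: "(\<lambda>x. g (snd x) (fst x)) \<in> borel_measurable (lborel \<Otimes>\<^sub>M lborel)"
          using gs unfolding case_prod_beta' .
        show ?thesis by measurable
      qed
      from lborel_pair.AE_commute[OF this]
      have "(AE s in lborel. AE t in lborel. g t s \<le> ?A s) \<longleftrightarrow> (AE t in lborel. AE s in lborel. g t s \<le> ?A s)" .
      thus ?thesis using 1 by simp
    qed
    hence "AE t in lborel. ?H t \<le> (\<integral>\<^sup>+ s. k s * ?A s \<partial>lborel)"
    proof eventually_elim
      case (elim t)
      show ?case by (rule nn_integral_mono_AE) (use elim in eventually_elim, auto intro: mult_left_mono)
    qed
    thus ?thesis unfolding True Lp_qnorm_infinite by (rule Limsup_bounded)
  next
    case False
    define q where "q = enn2real p"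
    have "1 \<le> q" using p False unfolding q_def by (cases p) (auto simp: ennreal_le_iff2 simp flip: ennreal_1)
    hence q: "q \<ge> 1" "q > 0" by auto
    have Aq: "epow (?A s) q = (\<integral>\<^sup>+ t. epow (g t s) q \<partial>lborel)" for s
      using q by (simp add: Lp_qnorm_finite[OF False] q_def[symmetric] epow_inverse)
    have "Lp_qnorm p ?H \<le> (\<integral>\<^sup>+ s. k s * ?A s \<partial>lborel) + ennreal \<delta>" if \<delta>: "\<delta> > 0" for \<delta>
    proof -
      \<comment> \<open>Adding \<open>\<delta>\<close> makes the denominator positive.\<close>
      define A' where "A' = (\<lambda>s. ?A s + ennreal \<delta>)"
      have [measurable]: "A' \<in> borel_measurable lborel" unfolding A'_def by measurable
      have A'0: "A' s \<noteq> 0" for s using \<delta> by (simp add: A'_def)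
      define I where "I = (\<integral>\<^sup>+ s. k s * A' s \<partial>lborel)"
      have "I = (\<integral>\<^sup>+ s. k s * ?A s \<partial>lborel) + (\<integral>\<^sup>+ s. k s \<partial>lborel) * ennreal \<delta>"
        unfolding I_def A'_def by (simp add: distrib_left nn_integral_add nn_integral_multc)
      also have "\<dots> \<le> (\<integral>\<^sup>+ s. k s * ?A s \<partial>lborel) + 1 * ennreal \<delta>"
        by (intro add_left_mono mult_right_mono k1) auto
      finally have I_le: "I \<le> (\<integral>\<^sup>+ s. k s * ?A s \<partial>lborel) + ennreal \<delta>" by simp
      have "Lp_qnorm p ?H \<le> I"
      proof (cases "I = top")
        case I: False
        show ?thesis
        proof (cases "I = 0")
          case True
          hence "AE s in lborel. k s * A' s = 0" unfolding I_def by (simp add: nn_integral_0_iff_AE)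
          hence k0: "AE s in lborel. k s = 0" by eventually_elim (use A'0 in auto)
          have "?H t = 0" for t
          proof -
            have "?H t = (\<integral>\<^sup>+ s. 0 \<partial>(lborel :: real measure))" by (rule nn_integral_cong_AE) (use k0 in eventually_elim, auto)
            thus ?thesis by simp
          qed
          thus ?thesis by (simp add: Lp_qnorm_finite[OF False])
        next
          case I0: False
          define w where "w = (\<lambda>s. k s * A' s / I)"
          have [measurable]: "w \<in> borel_measurable lborel" unfolding w_def by measurable
          have w1: "(\<integral>\<^sup>+ s. w s \<partial>lborel) \<le> 1"
            unfolding w_def using I I0 by (simp add: nn_integral_divide I_def[symmetric] ennreal_divide_self less_top)
          have "AE s in lborel. k s * A' s \<noteq> top"
            using nn_integral_PInf_AE[of "\<lambda>s. k s * A' s" lborel] I unfolding I_def by (simp add: infinity_ennreal_def)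
          hence wf: "AE s in lborel. \<forall>t. k s * g t s / I = w s * (g t s / A' s)"
          proof eventually_elim
            case (elim s)
            show ?case
            proof
              fix t
              show "k s * g t s / I = w s * (g t s / A' s)"
              proof (cases "k s = 0")
                case False
                hence A't: "A' s \<noteq> top" using elim by (auto simp: ennreal_mult_top)
                have "w s * (g t s / A' s) = (k s * g t s / I) * (A' s * inverse (A' s))"
                  unfolding w_def divide_ennreal_def by (simp only: mult_ac)
                thus ?thesis using ennreal_mult_inverse[OF A'0 A't] by simp
              qed (simp add: w_def)
            qed
          qed
          have HI: "epow (?H t / I) q \<le> (\<integral>\<^sup>+ s. w s * epow (g t s / A' s) q \<partial>lborel)" for t
          proof -
            have [measurable]: "g t \<in> borel_measurable lborel" using measurable_Pair2[OF g] by simp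
            have "?H t / I = (\<integral>\<^sup>+ s. k s * g t s / I \<partial>lborel)" by (rule nn_integral_divide[symmetric]) measurable
            also have "\<dots> = (\<integral>\<^sup>+ s. w s * (g t s / A' s) \<partial>lborel)"
              by (rule nn_integral_cong_AE) (use wf in eventually_elim, auto)
            finally show ?thesis using Jensen_epow[of w lborel "\<lambda>s. g t s / A' s" q] w1 q by simp
          qed
          have "(\<integral>\<^sup>+ t. epow (?H t / I) q \<partial>lborel) \<le> (\<integral>\<^sup>+ t. \<integral>\<^sup>+ s. w s * epow (g t s / A' s) q \<partial>lborel \<partial>lborel)"
            by (intro nn_integral_mono HI)
          also have "\<dots> = (\<integral>\<^sup>+ s. \<integral>\<^sup>+ t. w s * epow (g t s / A' s) q \<partial>lborel \<partial>lborel)"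
            by (rule lborel_pair.Fubini') measurable
          also have "\<dots> \<le> (\<integral>\<^sup>+ s. w s \<partial>lborel)"
          proof (rule nn_integral_mono)
            fix s
            have [measurable]: "(\<lambda>t. g t s) \<in> borel_measurable lborel" using measurable_Pair1[OF g] by simp
            have "(\<integral>\<^sup>+ t. w s * epow (g t s / A' s) q \<partial>lborel) = w s * (\<integral>\<^sup>+ t. epow (g t s) q * epow (inverse (A' s)) q \<partial>lborel)"
              using q by (simp add: nn_integral_cmult divide_ennreal_def epow_mult)
            also have "\<dots> = w s * epow (?A s * inverse (A' s)) q"
              using q by (simp add: nn_integral_multc Aq epow_mult)
            also have "\<dots> \<le> w s * epow 1 q"
            proof (intro mult_left_mono epow_mono q)
              have "?A s * inverse (A' s) \<le> A' s * inverse (A' s)" by (intro mult_right_mono) (auto simp: A'_def)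
              also have "\<dots> \<le> 1"
                using A'0[of s] by (cases "A' s = top") (simp_all add: ennreal_mult_inverse)
              finally show "?A s * inverse (A' s) \<le> 1" .
            qed auto
            finally show "(\<integral>\<^sup>+ t. w s * epow (g t s / A' s) q \<partial>lborel) \<le> w s" by simp
          qed
          finally have "(\<integral>\<^sup>+ t. epow (?H t / I) q \<partial>lborel) \<le> 1" using w1 by simp
          hence "(\<integral>\<^sup>+ t. epow (?H t / I) q \<partial>lborel) * epow I q \<le> 1 * epow I q" by (rule mult_right_mono) simp
          also have "(\<integral>\<^sup>+ t. epow (?H t / I) q \<partial>lborel) * epow I q = (\<integral>\<^sup>+ t. epow (?H t / I) q * epow I q \<partial>lborel)"
            by (rule nn_integral_multc[symmetric]) measurable
          also have "\<dots> = (\<integral>\<^sup>+ t. epow (?H t) q \<partial>lborel)"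
          proof (rule nn_integral_cong)
            fix t
            have "?H t / I * I = ?H t"
              using ennreal_mult_inverse[OF I0 I] by (simp add: divide_ennreal_def mult.assoc mult.commute[of "inverse I"])
            thus "epow (?H t / I) q * epow I q = epow (?H t) q" using q by (simp only: epow_mult[symmetric])
          qed
          finally have "(\<integral>\<^sup>+ t. epow (?H t) q \<partial>lborel) \<le> epow I q" by simp
          from epow_mono[OF _ this, of "1 / q"] show ?thesis
            using q by (simp add: Lp_qnorm_finite[OF False] q_def[symmetric] epow_inverse)
        qed
      qed simp
      thus ?thesis using I_le by (rule order_trans)
    qed
    thus ?thesis by (rule ennreal_le_epsilon)
  qed
qed

section \<open>Convolution with a kernel in one variable\<close>

locale conv_kernel =
  fixes \<kappa> :: "real \<Rightarrow> ennreal"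
  assumes meas[measurable]: "\<kappa> \<in> borel_measurable borel"
    and le1: "\<And>t. \<kappa> t \<le> 1"
    and int1: "\<And>t. (\<integral>\<^sup>+ s. \<kappa> (t - s) \<partial>lborel) \<le> 1"
    and int2: "\<And>s. (\<integral>\<^sup>+ t. \<kappa> (t - s) \<partial>lborel) \<le> 1"
begin

text \<open>Jensen's inequality bounds the convolution both in \<open>L\<^sup>\<infinity>\<close> and in \<open>L\<^bsup>p1\<^esup>\<close> by the \<open>L\<^bsup>p1\<^esup>\<close> norm; the
  exponents between follow by interpolation.\<close>

lemma Young_Lp_qnorm:
  assumes g[measurable]: "g \<in> borel_measurable lborel" and p: "1 \<le> p1" "p1 \<le> p2"
  shows "Lp_qnorm p2 (\<lambda>t. \<integral>\<^sup>+ s. \<kappa> (t - s) * g s \<partial>lborel) \<le> Lp_qnorm p1 g"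
proof -
  let ?T = "\<lambda>t. \<integral>\<^sup>+ s. \<kappa> (t - s) * g s \<partial>lborel" and ?N = "Lp_qnorm p1 g"
  show ?thesis
  proof (cases "p1 = \<infinity>")
    case True
    hence True2: "p2 = \<infinity>" using p by (simp add: infinity_ennreal_def top_unique)
    have ae: "AE s in lborel. g s \<le> ?N" unfolding True Lp_qnorm_infinite by (rule AE_le_Limsup)
    have "?T t \<le> ?N" for t
    proof -
      have "?T t \<le> (\<integral>\<^sup>+ s. \<kappa> (t - s) * ?N \<partial>lborel)"
        by (rule nn_integral_mono_AE) (use ae in eventually_elim, auto intro: mult_left_mono)
      also have "\<dots> = (\<integral>\<^sup>+ s. \<kappa> (t - s) \<partial>lborel) * ?N" by (rule nn_integral_multc) measurable
      also have "\<dots> \<le> 1 * ?N" by (intro mult_right_mono int1) auto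
      finally show ?thesis by simp
    qed
    thus ?thesis unfolding True2 Lp_qnorm_infinite by (intro Limsup_bounded always_eventually) auto
  next
    case False
    define q where "q = enn2real p1"
    have "1 \<le> q" using p(1) False unfolding q_def by (cases p1) (auto simp: ennreal_le_iff2 simp flip: ennreal_1)
    hence q: "q \<ge> 1" "q > 0" by auto
    let ?G = "\<integral>\<^sup>+ s. epow (g s) q \<partial>lborel"
    have N: "?N = epow ?G (1 / q)" by (simp add: Lp_qnorm_finite[OF False] q_def)
    have NG: "epow ?N q = ?G" using q by (simp add: N epow_inverse)
    have jensen: "epow (?T t) q \<le> (\<integral>\<^sup>+ s. \<kappa> (t - s) * epow (g s) q \<partial>lborel)" for t
      by (rule Jensen_epow[OF _ _ int1 q(1)]) measurable
    have sup: "?T t \<le> ?N" for t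
    proof -
      have "epow (?T t) q \<le> (\<integral>\<^sup>+ s. 1 * epow (g s) q \<partial>lborel)"
        by (rule order_trans[OF jensen]) (intro nn_integral_mono mult_right_mono le1, auto)
      hence "epow (?T t) q \<le> epow ?N q" by (simp add: NG)
      thus ?thesis using q by (simp add: epow_mono_iff)
    qed
    have Lq: "(\<integral>\<^sup>+ t. epow (?T t) q \<partial>lborel) \<le> ?G"
    proof -
      have "(\<integral>\<^sup>+ t. epow (?T t) q \<partial>lborel) \<le> (\<integral>\<^sup>+ t. \<integral>\<^sup>+ s. \<kappa> (t - s) * epow (g s) q \<partial>lborel \<partial>lborel)"
        by (intro nn_integral_mono jensen)
      also have "\<dots> = (\<integral>\<^sup>+ s. \<integral>\<^sup>+ t. \<kappa> (t - s) * epow (g s) q \<partial>lborel \<partial>lborel)"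
        by (rule lborel_pair.Fubini') measurable
      also have "\<dots> = (\<integral>\<^sup>+ s. (\<integral>\<^sup>+ t. \<kappa> (t - s) \<partial>lborel) * epow (g s) q \<partial>lborel)"
        by (intro nn_integral_cong nn_integral_multc) measurable
      also have "\<dots> \<le> (\<integral>\<^sup>+ s. 1 * epow (g s) q \<partial>lborel)" by (intro nn_integral_mono mult_right_mono int2) auto
      finally show ?thesis by simp
    qed
    show ?thesis
    proof (cases "p2 = \<infinity>")
      case True
      show ?thesis unfolding True Lp_qnorm_infinite by (intro Limsup_bounded always_eventually allI sup)
    next
      case False2: False
      define q' where "q' = enn2real p2"
      have qq: "q \<le> q'" unfolding q_def q'_def using p(2) False2 by (intro enn2real_mono) (auto simp: less_top)
      have "(\<integral>\<^sup>+ t. epow (?T t) q' \<partial>lborel) \<le> epow ?N q'"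
      proof (cases "q = q'")
        case True
        thus ?thesis using Lq NG by simp
      next
        case neq: False
        define d where "d = q' - q"
        have d: "d > 0" "q' = d + q" using qq neq by (auto simp: d_def)
        have split: "epow x (d + q) = epow x d * epow x q" for x
          using d q by (cases x) (auto simp: epow_ennreal powr_add ennreal_mult'[symmetric])
        have "(\<integral>\<^sup>+ t. epow (?T t) q' \<partial>lborel) \<le> (\<integral>\<^sup>+ t. epow ?N d * epow (?T t) q \<partial>lborel)"
          unfolding d(2) split by (intro nn_integral_mono mult_right_mono epow_mono sup d) auto
        also have "\<dots> = epow ?N d * (\<integral>\<^sup>+ t. epow (?T t) q \<partial>lborel)" by (rule nn_integral_cmult) measurable
        also have "\<dots> \<le> epow ?N d * epow ?N q" unfolding NG by (intro mult_left_mono Lq) auto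
        finally show ?thesis by (simp only: split d(2))
      qed
      from epow_mono[OF _ this, of "1 / q'"] show ?thesis
        using q qq by (simp add: Lp_qnorm_finite[OF False2] q'_def[symmetric] epow_inverse)
    qed
  qed
qed

end

section \<open>Mixed quasi-norms and convolutions in all variables\<close>

text \<open>The quasi-norms act on functions of a coordinate sequence, of which only finitely many entries
  matter.\<close>

abbreviation coord_space :: "(nat \<Rightarrow> real) measure" where
  "coord_space \<equiv> PiM UNIV (\<lambda>_. borel)"

lemma measurable_fun_upd_coord:
  assumes "f \<in> measurable M coord_space" "h \<in> borel_measurable M"
  shows "(\<lambda>x. (f x)(k := h x)) \<in> measurable M coord_space"
  by (rule measurable_fun_upd[where J = UNIV]) (use assms in auto)

lemma measurable_slice:
  assumes "G \<in> borel_measurable coord_space"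
  shows "(\<lambda>(y, t). G (y(k := t))) \<in> borel_measurable (coord_space \<Otimes>\<^sub>M lborel)"
proof -
  have "(\<lambda>q :: (nat \<Rightarrow> real) \<times> real. (fst q)(k := snd q)) \<in> measurable (coord_space \<Otimes>\<^sub>M lborel) coord_space"
    by (intro measurable_fun_upd_coord) simp_all
  from measurable_compose[OF this assms] show ?thesis by (simp add: case_prod_beta')
qed

lemma space_coord_space: "y \<in> space coord_space"
  by (simp add: space_PiM)

lemma measurable_slice1:
  assumes "G \<in> borel_measurable coord_space"
  shows "(\<lambda>t. G (y(k := t))) \<in> borel_measurable borel"
  using measurable_Pair2[OF measurable_slice[OF assms, of k] space_coord_space[of y]] by simp

lemma measurable_slice2:
  assumes "G \<in> borel_measurable coord_space"
  shows "(\<lambda>(t, s). G (y(k := t, j := s))) \<in> borel_measurable (lborel \<Otimes>\<^sub>M lborel)"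
proof -
  have "(\<lambda>q :: real \<times> real. (y(k := fst q))(j := snd q)) \<in> measurable (lborel \<Otimes>\<^sub>M lborel) coord_space"
    by (intro measurable_fun_upd_coord) (simp_all add: space_coord_space)
  from measurable_compose[OF this assms] show ?thesis by (simp add: case_prod_beta')
qed

lemma iter_qnorm_measurable:
  "G \<in> borel_measurable coord_space \<Longrightarrow> iter_qnorm p k G \<in> borel_measurable coord_space"
proof (induct k)
  case (Suc k)
  show ?case unfolding iter_qnorm.simps
    by (rule Lp_qnorm_measurable[OF measurable_slice[OF Suc(1)[OF Suc(2)], of "Suc k"]])
qed simp

lemma iter_qnorm_mono:
  assumes "\<And>j. j \<in> {1..k} \<Longrightarrow> 0 < p j" "\<And>y. F y \<le> G y"
  shows "iter_qnorm p k F y \<le> iter_qnorm p k G y"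
  using assms(1)
proof (induct k arbitrary: y)
  case (Suc k)
  show ?case unfolding iter_qnorm.simps by (rule Lp_qnorm_mono) (use Suc in auto)
qed (simp add: assms(2))

lemma Lp_qnorm_epow:
  assumes r: "r > 0" and p: "0 < p"
  shows "Lp_qnorm p g = epow (Lp_qnorm (p / ennreal r) (\<lambda>t. epow (g t) r)) (1 / r)"
proof (cases "p = \<infinity>")
  case True
  have 1: "p / ennreal r = \<infinity>" using True r by (simp add: infinity_ennreal_def ennreal_top_divide)
  have "epow (Limsup (ae_filter lborel) (\<lambda>t. epow (g t) r)) (1 / r) = Limsup (ae_filter lborel) g" (is "?l = ?r")
  proof (rule antisym)
    have "AE t in lborel. epow (g t) r \<le> epow ?r r" using AE_le_Limsup[of g lborel] by eventually_elim (rule epow_mono[OF r])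
    from epow_mono[OF _ Limsup_bounded[OF this], of "1 / r"] show "?l \<le> ?r" using r by (simp add: epow_inverse)
    have "AE t in lborel. g t \<le> ?l"
      using AE_le_Limsup[of "\<lambda>t. epow (g t) r" lborel]
    proof eventually_elim
      case (elim t)
      from epow_mono[OF _ elim, of "1 / r"] show ?case using r by (simp add: epow_inverse)
    qed
    thus "?r \<le> ?l" by (rule Limsup_bounded)
  qed
  thus ?thesis unfolding 1 unfolding True Lp_qnorm_infinite by simp
next
  case False
  obtain q where q: "p = ennreal q" "q > 0" using p False by (cases p) auto
  have d: "p / ennreal r = ennreal (q / r)" using q r by (simp add: divide_ennreal)
  have qr: "q / r > 0" using q r by simp
  have "Lp_qnorm p g = epow (\<integral>\<^sup>+ t. epow (g t) q \<partial>lborel) (1 / q)"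
    using q by (simp add: Lp_qnorm_def infinity_ennreal_def)
  moreover have "Lp_qnorm (p / ennreal r) (\<lambda>t. epow (g t) r) = epow (\<integral>\<^sup>+ t. epow (epow (g t) r) (q / r) \<partial>lborel) (1 / (q / r))"
    unfolding d using qr by (simp add: Lp_qnorm_def infinity_ennreal_def)
  ultimately show ?thesis using q r by (simp add: epow_epow)
qed

text \<open>This reduces quasi-norms with exponents at least \<open>r\<close> to norms with exponents at least \<open>1\<close>.\<close>

lemma iter_qnorm_epow:
  assumes r: "r > 0" and "\<And>j. j \<in> {1..k} \<Longrightarrow> 0 < p j"
  shows "iter_qnorm p k G y = epow (iter_qnorm (\<lambda>j. p j / ennreal r) k (\<lambda>y. epow (G y) r) y) (1 / r)"
  using assms(2)
proof (induct k arbitrary: y)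
  case 0
  show ?case using r by (simp add: epow_inverse)
next
  case (Suc k)
  have "iter_qnorm p (Suc k) G y = Lp_qnorm (p (Suc k)) (\<lambda>t. epow (iter_qnorm (\<lambda>j. p j / ennreal r) k (\<lambda>y. epow (G y) r) (y(Suc k := t))) (1 / r))"
    using Suc by simp
  also have "\<dots> = epow (Lp_qnorm (p (Suc k) / ennreal r) (\<lambda>t. iter_qnorm (\<lambda>j. p j / ennreal r) k (\<lambda>y. epow (G y) r) (y(Suc k := t)))) (1 / r)"
    using r Suc(2)[of "Suc k"] by (subst Lp_qnorm_epow[OF r]) (simp_all add: epow_inverse)
  finally show ?case by simp
qed

lemma Lp_qnorm_cmult:
  assumes [measurable]: "g \<in> borel_measurable lborel" and p: "0 < p"
  shows "Lp_qnorm p (\<lambda>t. c * g t) \<le> c * Lp_qnorm p g"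
proof (cases "p = \<infinity>")
  case True
  have "AE t in lborel. c * g t \<le> c * Limsup (ae_filter lborel) g"
    using AE_le_Limsup[of g lborel] by eventually_elim (rule mult_left_mono, auto)
  thus ?thesis unfolding True Lp_qnorm_infinite by (rule Limsup_bounded)
next
  case False
  let ?q = "enn2real p"
  have q: "?q > 0" by (rule enn2real_pos[OF p False])
  thus ?thesis by (simp add: Lp_qnorm_finite[OF False] epow_mult nn_integral_cmult epow_inverse)
qed

lemma iter_qnorm_cmult:
  assumes "G \<in> borel_measurable coord_space" "\<And>j. j \<in> {1..k} \<Longrightarrow> 0 < p j"
  shows "iter_qnorm p k (\<lambda>y. c * G y) y \<le> c * iter_qnorm p k G y"
  using assms(2)
proof (induct k arbitrary: y)
  case (Suc k)
  have "iter_qnorm p (Suc k) (\<lambda>y. c * G y) y \<le> Lp_qnorm (p (Suc k)) (\<lambda>t. c * iter_qnorm p k G (y(Suc k := t)))"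
    unfolding iter_qnorm.simps by (rule Lp_qnorm_mono) (use Suc in auto)
  also have "\<dots> \<le> c * Lp_qnorm (p (Suc k)) (\<lambda>t. iter_qnorm p k G (y(Suc k := t)))"
    by (rule Lp_qnorm_cmult) (use Suc(2) measurable_slice1[OF iter_qnorm_measurable[OF assms(1)]] in auto)
  finally show ?case by simp
qed simp

primrec iter_int :: "nat list \<Rightarrow> ((nat \<Rightarrow> real) \<Rightarrow> ennreal) \<Rightarrow> (nat \<Rightarrow> real) \<Rightarrow> ennreal" where
  "iter_int [] G y = G y"
| "iter_int (j # js) G y = (\<integral>\<^sup>+ s. iter_int js G (y(j := s)) \<partial>lborel)"

lemma iter_int_measurable:
  "G \<in> borel_measurable coord_space \<Longrightarrow> iter_int js G \<in> borel_measurable coord_space"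
proof (induct js)
  case Nil
  moreover have "iter_int [] G = G" by (rule ext) simp
  ultimately show ?case by simp
next
  case (Cons j js)
  have "iter_int (j # js) G = (\<lambda>y. \<integral>\<^sup>+ s. iter_int js G (y(j := s)) \<partial>lborel)" by (rule ext) simp
  thus ?case using lborel.borel_measurable_nn_integral[OF measurable_slice[OF Cons(1)[OF Cons(2)], of j]]
    by (simp only:)
qed

lemma iter_int_cmult:
  assumes "G \<in> borel_measurable coord_space" "j \<notin> set js"
  shows "iter_int js (\<lambda>z. c (z j) * G z) y = c (y j) * iter_int js G y"
  using assms(2)
proof (induct js arbitrary: y)
  case (Cons i js)
  have m: "(\<lambda>s. iter_int js G (y(i := s))) \<in> borel_measurable lborel"
    using measurable_slice1[OF iter_int_measurable[OF assms(1), of js], of y i] by simp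
  have "iter_int (i # js) (\<lambda>z. c (z j) * G z) y = (\<integral>\<^sup>+ s. c (y j) * iter_int js G (y(i := s)) \<partial>lborel)"
    using Cons by simp
  also have "\<dots> = c (y j) * (\<integral>\<^sup>+ s. iter_int js G (y(i := s)) \<partial>lborel)" by (rule nn_integral_cmult[OF m])
  finally show ?case by simp
qed simp

context conv_kernel begin

definition conv :: "nat \<Rightarrow> ((nat \<Rightarrow> real) \<Rightarrow> ennreal) \<Rightarrow> (nat \<Rightarrow> real) \<Rightarrow> ennreal" where
  "conv j G y = (\<integral>\<^sup>+ s. \<kappa> (y j - s) * G (y(j := s)) \<partial>lborel)"

abbreviation convs :: "nat list \<Rightarrow> ((nat \<Rightarrow> real) \<Rightarrow> ennreal) \<Rightarrow> (nat \<Rightarrow> real) \<Rightarrow> ennreal" where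
  "convs js G \<equiv> foldr conv js G"

lemma conv_measurable:
  assumes "G \<in> borel_measurable coord_space"
  shows "conv j G \<in> borel_measurable coord_space"
proof -
  have [measurable]: "(\<lambda>q. G ((fst q)(j := snd q))) \<in> borel_measurable (coord_space \<Otimes>\<^sub>M lborel)"
    using measurable_slice[OF assms, of j] by (simp add: case_prod_beta')
  have "(\<lambda>q. \<kappa> (fst q j - snd q) * G ((fst q)(j := snd q))) \<in> borel_measurable (coord_space \<Otimes>\<^sub>M lborel)"
    by measurable
  thus ?thesis unfolding conv_def[abs_def]
    by (intro lborel.borel_measurable_nn_integral) (simp add: case_prod_beta')
qed

lemma convs_measurable: "G \<in> borel_measurable coord_space \<Longrightarrow> convs js G \<in> borel_measurable coord_space"
  by (induct js) (auto intro: conv_measurable)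

lemma conv_mono: "(\<And>y. F y \<le> G y) \<Longrightarrow> conv j F y \<le> conv j G y"
  unfolding conv_def by (intro nn_integral_mono mult_left_mono) auto

lemma Lp_qnorm_conv:
  assumes "G \<in> borel_measurable coord_space" "1 \<le> p1" "p1 \<le> p2"
  shows "Lp_qnorm p2 (\<lambda>t. conv k G (y(k := t))) \<le> Lp_qnorm p1 (\<lambda>t. G (y(k := t)))"
  unfolding conv_def using Young_Lp_qnorm[of "\<lambda>t. G (y(k := t))" p1 p2] measurable_slice1[OF assms(1), of y k] assms(2,3) by simp

lemma Lp_qnorm_conv_other:
  assumes G: "G \<in> borel_measurable coord_space" and p: "1 \<le> p" and "j \<noteq> k"
  shows "Lp_qnorm p (\<lambda>t. conv j G (y(k := t))) \<le> conv j (\<lambda>y. Lp_qnorm p (\<lambda>t. G (y(k := t)))) y"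
proof -
  have "Lp_qnorm p (\<lambda>t. conv j G (y(k := t))) = Lp_qnorm p (\<lambda>t. \<integral>\<^sup>+ s. \<kappa> (y j - s) * G (y(k := t, j := s)) \<partial>lborel)"
    using assms(3) by (simp add: conv_def)
  also have "\<dots> \<le> (\<integral>\<^sup>+ s. \<kappa> (y j - s) * Lp_qnorm p (\<lambda>t. G (y(k := t, j := s))) \<partial>lborel)"
    by (rule Minkowski_Lp_qnorm[OF measurable_slice2[OF G] _ int1 p]) measurable
  finally show ?thesis using assms(3) by (simp add: conv_def fun_upd_twist)
qed

lemma Lp_qnorm_convs_other:
  assumes G: "G \<in> borel_measurable coord_space" and p: "1 \<le> p" and "k \<notin> set js"
  shows "Lp_qnorm p (\<lambda>t. convs js G (y(k := t))) \<le> convs js (\<lambda>y. Lp_qnorm p (\<lambda>t. G (y(k := t)))) y"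
  using assms(3)
proof (induct js arbitrary: y)
  case (Cons j js)
  have "Lp_qnorm p (\<lambda>t. convs (j # js) G (y(k := t))) \<le> conv j (\<lambda>y. Lp_qnorm p (\<lambda>t. convs js G (y(k := t)))) y"
    unfolding foldr_Cons comp_apply by (rule Lp_qnorm_conv_other[OF convs_measurable[OF G] p]) (use Cons in simp)
  also have "\<dots> \<le> conv j (convs js (\<lambda>y. Lp_qnorm p (\<lambda>t. G (y(k := t))))) y"
    by (rule conv_mono, rule Cons(1)) (use Cons(2) in simp)
  finally show ?case by (simp only: foldr_Cons comp_apply)
qed simp

text \<open>The variables are treated from the innermost outwards: Young's inequality raises the exponent
  of the current variable, and Minkowski's inequality carries its quasi-norm past the convolutions
  in the remaining ones.\<close>

lemma iter_qnorm_convs_le: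
  assumes G: "G \<in> borel_measurable coord_space"
    and p: "\<And>j. j \<in> {1..n} \<Longrightarrow> 1 \<le> p1 j" "\<And>j. j \<in> {1..n} \<Longrightarrow> p1 j \<le> p2 j" and "k \<le> n"
  shows "iter_qnorm p2 k (convs [1..<Suc n] G) y \<le> convs [Suc k..<Suc n] (iter_qnorm p1 k G) y"
  using assms(4)
proof (induct k arbitrary: y)
  case (Suc k)
  let ?I = "iter_qnorm p1 k G"
  have I: "?I \<in> borel_measurable coord_space" by (rule iter_qnorm_measurable[OF G])
  have k: "Suc k \<in> {1..n}" using Suc by simp
  have p1: "1 \<le> p1 (Suc k)" and p2: "p1 (Suc k) \<le> p2 (Suc k)" using p[OF k] by auto
  have pos: "0 < p2 (Suc k)" using p1 p2 by (meson less_le_trans zero_less_one)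
  have up: "[Suc k..<Suc n] = Suc k # [Suc (Suc k)..<Suc n]" using Suc(2) by (simp add: upt_rec)
  have "iter_qnorm p2 (Suc k) (convs [1..<Suc n] G) y \<le> Lp_qnorm (p2 (Suc k)) (\<lambda>t. convs [Suc k..<Suc n] ?I (y(Suc k := t)))"
    unfolding iter_qnorm.simps by (rule Lp_qnorm_mono[OF pos]) (use Suc in auto)
  also have "\<dots> \<le> Lp_qnorm (p1 (Suc k)) (\<lambda>t. convs [Suc (Suc k)..<Suc n] ?I (y(Suc k := t)))"
    unfolding up foldr_Cons comp_apply by (rule Lp_qnorm_conv[OF convs_measurable[OF I] p1 p2])
  also have "\<dots> \<le> convs [Suc (Suc k)..<Suc n] (\<lambda>y. Lp_qnorm (p1 (Suc k)) (\<lambda>t. ?I (y(Suc k := t)))) y"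
    by (rule Lp_qnorm_convs_other[OF I p1]) simp
  finally show ?case by simp
qed simp

lemma prod_kernel_measurable:
  assumes "G \<in> borel_measurable coord_space"
  shows "(\<lambda>z. prod_list (map (\<lambda>i. \<kappa> (y i - z i)) js) * G z) \<in> borel_measurable coord_space"
proof -
  have "(\<lambda>z. prod_list (map (\<lambda>i. \<kappa> (y i - z i)) js)) \<in> borel_measurable coord_space"
    by (induct js) simp_all
  thus ?thesis using assms by (rule borel_measurable_times_ennreal)
qed

lemma convs_eq_iter_int:
  assumes G: "G \<in> borel_measurable coord_space" and "distinct js"
  shows "convs js G y = iter_int js (\<lambda>z. prod_list (map (\<lambda>i. \<kappa> (y i - z i)) js) * G z) y"
  using assms(2)
proof (induct js arbitrary: y)
  case (Cons j js)
  let ?P = "\<lambda>y z. prod_list (map (\<lambda>i. \<kappa> (y i - z i)) js) * G z"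
  have j: "j \<notin> set js" using Cons by simp
  have P: "?P (y(j := s)) = ?P y" for s using j by (intro ext arg_cong2[where f = "(*)"] arg_cong[where f = prod_list]) auto
  have "convs (j # js) G y = (\<integral>\<^sup>+ s. \<kappa> (y j - s) * iter_int js (?P y) (y(j := s)) \<partial>lborel)"
  proof -
    have d: "distinct js" using Cons(2) by simp
    have "convs js G (y(j := s)) = iter_int js (?P y) (y(j := s))" for s
      using Cons(1)[OF d, of "y(j := s)"] unfolding P .
    thus ?thesis by (simp only: foldr_Cons comp_apply conv_def[of j "convs js G"])
  qed
  also have "\<dots> = (\<integral>\<^sup>+ s. iter_int js (\<lambda>z. \<kappa> (y j - z j) * ?P y z) (y(j := s)) \<partial>lborel)"
    by (simp add: iter_int_cmult[OF prod_kernel_measurable[OF G] j, of "\<lambda>t. \<kappa> (y j - t)"])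
  finally show ?case by (simp add: mult.assoc)
qed simp

end

lemma nn_integral_PiM_eq_iter_int:
  fixes e :: "nat \<Rightarrow> 'b"
  assumes G: "G \<in> borel_measurable coord_space" and "distinct js" "inj_on e (set js)"
  shows "(\<integral>\<^sup>+ f. G (\<lambda>k. if k \<in> set js then f (e k) else y k) \<partial>(\<Pi>\<^sub>M b\<in>e ` set js. lborel)) = iter_int js G y"
  using assms(2,3)
proof (induct js arbitrary: y)
  case Nil
  show ?case by (simp add: PiM_empty nn_integral_count_space_finite)
next
  case (Cons j js)
  interpret product_sigma_finite "\<lambda>_ :: 'b. lborel :: real measure" by standard
  let ?F = "\<lambda>f. G (\<lambda>k. if k \<in> set (j # js) then f (e k) else y k)"
  have ej: "e j \<notin> e ` set js" using Cons by auto
  have "(\<lambda>f k. if k \<in> set (j # js) then f (e k) else y k) \<in> measurable (\<Pi>\<^sub>M b\<in>insert (e j) (e ` set js). lborel) coord_space"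
  proof (rule measurable_PiM_single')
    fix k :: nat
    show "(\<lambda>f. if k \<in> set (j # js) then f (e k) else y k) \<in> borel_measurable (\<Pi>\<^sub>M b\<in>insert (e j) (e ` set js). lborel)"
    proof (cases "k \<in> set (j # js)")
      case True
      hence "e k \<in> insert (e j) (e ` set js)" by auto
      from measurable_component_singleton[OF this, of "\<lambda>_. lborel"] True show ?thesis by simp
    qed simp
  qed (simp add: space_PiM)
  from measurable_compose[OF this G]
  have F: "?F \<in> borel_measurable (\<Pi>\<^sub>M b\<in>insert (e j) (e ` set js). lborel)" .
  have upd: "?F (f(e j := s)) = G (\<lambda>k. if k \<in> set js then f (e k) else (y(j := s)) k)" for f s
  proof (rule arg_cong[where f = G], rule ext)
    fix k
    show "(if k \<in> set (j # js) then (f(e j := s)) (e k) else y k) = (if k \<in> set js then f (e k) else (y(j := s)) k)"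
    proof (cases "k = j")
      case False
      have "k \<in> set js \<Longrightarrow> e k \<noteq> e j" using ej by (metis imageI)
      thus ?thesis using False by simp
    qed (use Cons(2) in simp)
  qed
  have "(\<integral>\<^sup>+ f. ?F f \<partial>(\<Pi>\<^sub>M b\<in>e ` set (j # js). lborel)) = (\<integral>\<^sup>+ s. \<integral>\<^sup>+ f. ?F (f(e j := s)) \<partial>(\<Pi>\<^sub>M b\<in>e ` set js. lborel) \<partial>lborel)"
    using product_nn_integral_insert_rev[OF _ ej F] by simp
  also have "\<dots> = (\<integral>\<^sup>+ s. iter_int js G (y(j := s)) \<partial>lborel)"
    unfolding upd using Cons by (intro nn_integral_cong Cons(1)) auto
  finally show ?case by simp
qed

lemma nn_integral_lborel_eq_iter_int:
  fixes H :: "'a::euclidean_space \<Rightarrow> ennreal"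
  assumes H: "H \<in> borel_measurable borel" and "distinct js" and e: "bij_betw e (set js) Basis"
  shows "(\<integral>\<^sup>+ x. H x \<partial>lborel) = iter_int js (\<lambda>z. H (\<Sum>k\<in>set js. z k *\<^sub>R e k)) y"
proof -
  have inj: "inj_on e (set js)" and im: "e ` set js = Basis" using e by (auto simp: bij_betw_def)
  let ?G = "\<lambda>z. H (\<Sum>k\<in>set js. z k *\<^sub>R e k)"
  have "(\<lambda>z :: nat \<Rightarrow> real. \<Sum>k\<in>set js. z k *\<^sub>R e k) \<in> borel_measurable coord_space" by measurable
  from measurable_compose[OF this H] have G: "?G \<in> borel_measurable coord_space" .
  have T: "(\<lambda>f. \<Sum>b\<in>Basis. f b *\<^sub>R (b :: 'a)) \<in> measurable (\<Pi>\<^sub>M b\<in>Basis. lborel) borel" by measurable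
  have "(\<integral>\<^sup>+ x. H x \<partial>lborel) = (\<integral>\<^sup>+ x. H x \<partial>distr (\<Pi>\<^sub>M b\<in>Basis. lborel) borel (\<lambda>f. \<Sum>b\<in>Basis. f b *\<^sub>R b))"
    by (simp only: lborel_eq[symmetric])
  also have "\<dots> = (\<integral>\<^sup>+ f. H (\<Sum>b\<in>Basis. f b *\<^sub>R b) \<partial>(\<Pi>\<^sub>M b\<in>Basis. lborel))"
    by (rule nn_integral_distr[OF T]) (use H in simp)
  also have "\<dots> = (\<integral>\<^sup>+ f. ?G (\<lambda>k. if k \<in> set js then f (e k) else y k) \<partial>(\<Pi>\<^sub>M b\<in>e ` set js. lborel))"
  proof -
    have "(\<Sum>b\<in>Basis. f b *\<^sub>R b) = (\<Sum>k\<in>set js. f (e k) *\<^sub>R e k)" for f :: "'a \<Rightarrow> real"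
      using sum.reindex_bij_betw[OF e, of "\<lambda>b. f b *\<^sub>R b"] by simp
    thus ?thesis unfolding im by simp
  qed
  also have "\<dots> = iter_int js ?G y" by (rule nn_integral_PiM_eq_iter_int[OF G assms(2) inj])
  finally show ?thesis .
qed

text \<open>The factor makes both the supremum and the integral at most \<open>1\<close>.\<close>

definition gauss_kernel :: "real \<Rightarrow> real \<Rightarrow> ennreal" where
  "gauss_kernel \<gamma> t = ennreal (min 1 (sqrt (\<gamma> / pi)) * exp (- \<gamma> * t\<^sup>2))"

lemma conv_kernel_gauss:
  assumes "\<gamma> > 0"
  shows "conv_kernel (gauss_kernel \<gamma>)"
proof
  let ?c = "min 1 (sqrt (\<gamma> / pi))"
  have c: "0 \<le> ?c" using assms by simp
  show m: "gauss_kernel \<gamma> \<in> borel_measurable borel" unfolding gauss_kernel_def[abs_def] by measurable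
  show "gauss_kernel \<gamma> t \<le> 1" for t
  proof -
    have "?c * exp (- \<gamma> * t\<^sup>2) \<le> 1 * 1" using assms by (intro mult_mono) auto
    thus ?thesis unfolding gauss_kernel_def by (simp add: ennreal_le_1)
  qed
  have total: "(\<integral>\<^sup>+ t. gauss_kernel \<gamma> t \<partial>lborel) \<le> 1"
  proof -
    have g: "integrable lborel (\<lambda>t :: real. gauss \<gamma> t)" "(LINT t|lborel. gauss \<gamma> (t :: real)) = sqrt (pi / \<gamma>)"
      using gaussian_integral[OF assms, where 'a = real] by simp_all
    have "(\<integral>\<^sup>+ t. gauss_kernel \<gamma> t \<partial>lborel) = ennreal (LINT t|lborel. ?c * gauss \<gamma> (t :: real))"
      unfolding gauss_kernel_def using g(1) c by (subst nn_integral_eq_integral[symmetric]) auto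
    also have "(LINT t|lborel. ?c * gauss \<gamma> (t :: real)) = ?c * sqrt (pi / \<gamma>)"
      by (simp only: integral_mult_right_zero g(2))
    also have "\<dots> \<le> sqrt (\<gamma> / pi) * sqrt (pi / \<gamma>)" using assms by (intro mult_right_mono) auto
    also have "\<dots> = 1" using assms by (simp flip: real_sqrt_mult)
    finally show ?thesis by (simp add: ennreal_le_1 ennreal_leI)
  qed
  have even: "gauss_kernel \<gamma> (t - s) = gauss_kernel \<gamma> (s - t)" for s t by (simp add: gauss_kernel_def power2_commute)
  have shift: "(\<integral>\<^sup>+ t. gauss_kernel \<gamma> (t - s) \<partial>lborel) \<le> 1" for s
  proof -
    have "(\<integral>\<^sup>+ t. gauss_kernel \<gamma> t \<partial>lborel) = (\<integral>\<^sup>+ t. gauss_kernel \<gamma> t \<partial>distr lborel borel ((+) (- s)))"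
      by (simp add: lborel_distr_plus)
    also have "\<dots> = (\<integral>\<^sup>+ t. gauss_kernel \<gamma> (- s + t) \<partial>lborel)"
      by (rule nn_integral_distr) (use m in simp_all)
    finally show ?thesis using total by simp
  qed
  show "(\<integral>\<^sup>+ t. gauss_kernel \<gamma> (t - s) \<partial>lborel) \<le> 1" "(\<integral>\<^sup>+ t. gauss_kernel \<gamma> (s - t) \<partial>lborel) \<le> 1" for s
    using shift[of s] even[of s] by simp_all
qed

text \<open>Gaussians factor into the coordinates, so that a Gaussian convolution on the whole space is an
  iterated one.\<close>

lemma gaussian_convolution_eq_convs:
  fixes H :: "'a::euclidean_space \<Rightarrow> ennreal"
  assumes H: "H \<in> borel_measurable borel" and "distinct js" and e: "bij_betw e (set js) Basis" and "\<gamma> > 0"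
  defines "m \<equiv> \<lambda>z. \<Sum>k\<in>set js. z k *\<^sub>R e k" and "c \<equiv> min 1 (sqrt (\<gamma> / pi))"
  shows "(\<integral>\<^sup>+ Z. ennreal (c ^ length js * gauss \<gamma> (m y - Z)) * H Z \<partial>lborel)
    = conv_kernel.convs (gauss_kernel \<gamma>) js (\<lambda>z. H (m z)) y"
proof -
  interpret conv_kernel "gauss_kernel \<gamma>" by (rule conv_kernel_gauss[OF assms(4)])
  have inj: "inj_on e (set js)" and im: "e ` set js = Basis" using e by (auto simp: bij_betw_def)
  have m: "m \<in> borel_measurable coord_space" unfolding m_def by measurable
  have Hm: "(\<lambda>z. H (m z)) \<in> borel_measurable coord_space" by (rule measurable_compose[OF m H])
  have me: "m z \<bullet> e k = z k" if "k \<in> set js" for z k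
  proof -
    have "m z \<bullet> e k = (\<Sum>i\<in>set js. z i * (if i = k then 1 else 0))"
      unfolding m_def inner_sum_left inner_scaleR_left
    proof (rule sum.cong[OF refl])
      fix i assume "i \<in> set js"
      moreover have "e i \<in> Basis" "e k \<in> Basis" using im that \<open>i \<in> set js\<close> by auto
      ultimately show "z i * (e i \<bullet> e k) = z i * (if i = k then 1 else 0)"
        using inj that by (auto simp: inner_Basis inj_on_eq_iff)
    qed
    also have "\<dots> = (\<Sum>i\<in>set js. if i = k then z i else 0)" by (rule sum.cong) auto
    finally show ?thesis using that by simp
  qed
  have nrm: "(norm (m y - m z))\<^sup>2 = (\<Sum>k\<in>set js. (y k - z k)\<^sup>2)" for z
  proof -
    have "(norm (m y - m z))\<^sup>2 = (\<Sum>k\<in>set js. ((m y - m z) \<bullet> e k)\<^sup>2)"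
      unfolding norm_sq_Basis using sum.reindex_bij_betw[OF e, of "\<lambda>b. ((m y - m z) \<bullet> b)\<^sup>2"] by simp
    also have "\<dots> = (\<Sum>k\<in>set js. (y k - z k)\<^sup>2)" by (rule sum.cong) (auto simp: inner_diff_left me)
    finally show ?thesis .
  qed
  have c: "c \<ge> 0" using assms(4) by (simp add: c_def)
  have "prod_list (map (\<lambda>i. gauss_kernel \<gamma> (y i - z i)) js) = ennreal (c ^ length js * gauss \<gamma> (m y - m z))" for z
  proof -
    have "prod_list (map (\<lambda>i. gauss_kernel \<gamma> (y i - z i)) js) = ennreal (c ^ length js * exp (- \<gamma> * sum_list (map (\<lambda>k. (y k - z k)\<^sup>2) js)))"
    proof (induct js)
      case (Cons i js)
      let ?S = "sum_list (map (\<lambda>k. (y k - z k)\<^sup>2) js)"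
      have ex: "exp (- \<gamma> * ((y i - z i)\<^sup>2 + ?S)) = exp (- \<gamma> * (y i - z i)\<^sup>2) * exp (- \<gamma> * ?S)"
        by (simp only: distrib_left exp_add)
      have "prod_list (map (\<lambda>i. gauss_kernel \<gamma> (y i - z i)) (i # js))
          = ennreal (c * exp (- \<gamma> * (y i - z i)\<^sup>2)) * ennreal (c ^ length js * exp (- \<gamma> * ?S))"
        using Cons by (simp add: gauss_kernel_def c_def)
      also have "\<dots> = ennreal ((c * exp (- \<gamma> * (y i - z i)\<^sup>2)) * (c ^ length js * exp (- \<gamma> * ?S)))"
        using c by (intro ennreal_mult[symmetric]) auto
      also have "(c * exp (- \<gamma> * (y i - z i)\<^sup>2)) * (c ^ length js * exp (- \<gamma> * ?S))
          = c ^ length (i # js) * exp (- \<gamma> * ((y i - z i)\<^sup>2 + ?S))"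
        unfolding ex by (simp only: length_Cons power_Suc mult_ac)
      finally show ?case by simp
    qed simp
    thus ?thesis using assms(2) by (simp add: nrm sum_list_distinct_conv_sum_set)
  qed
  hence "convs js (\<lambda>z. H (m z)) y = iter_int js (\<lambda>z. ennreal (c ^ length js * gauss \<gamma> (m y - m z)) * H (m z)) y"
    by (simp add: convs_eq_iter_int[OF Hm assms(2)])
  also have "\<dots> = (\<integral>\<^sup>+ Z. ennreal (c ^ length js * gauss \<gamma> (m y - Z)) * H Z \<partial>lborel)"
    unfolding m_def by (rule nn_integral_lborel_eq_iter_int[OF _ assms(2) e, symmetric]) (use H in measurable)
  finally show ?thesis by simp
qed

section \<open>Embeddings of modulation spaces\<close>

lemma nth_index_bij: "bij_betw (nth_index :: nat \<Rightarrow> 'd::{finite,linorder}) {1..CARD('d)} UNIV"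
proof -
  let ?xs = "sorted_list_of_set (UNIV :: 'd set)"
  have l: "length ?xs = CARD('d)" by simp
  have "bij_betw (\<lambda>i. ?xs ! i) {..<length ?xs} (set ?xs)" by (rule bij_betw_nth) auto
  hence 1: "bij_betw (\<lambda>i. ?xs ! i) {..<CARD('d)} UNIV" unfolding l by simp
  have 2: "bij_betw (\<lambda>j. j - 1) {1..CARD('d)} {..<CARD('d)}"
    by (rule bij_betw_byWitness[where f' = Suc]) auto
  from bij_betw_trans[OF 2 1] show ?thesis by (simp add: nth_index_def[abs_def] o_def)
qed

lemma phase_basis_bij:
  "bij_betw (phase_basis :: nat \<Rightarrow> (real ^ 'd::{finite,linorder}) \<times> (real ^ 'd::_)) {1..2 * CARD('d)} Basis"
proof -
  let ?d = "CARD('d)"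
  let ?n = "nth_index :: nat \<Rightarrow> 'd"
  have inj: "inj_on ?n {1..?d}" and im: "?n ` {1..?d} = UNIV" using nth_index_bij by (auto simp: bij_betw_def)
  have neq: "nth_index i \<noteq> (nth_index j :: 'd)" if "i \<in> {1..?d}" "j \<in> {1..?d}" "i \<noteq> j" for i j
    using inj_on_eq_iff[OF inj that(1,2)] that(3) by simp
  have injp: "inj_on (phase_basis :: nat \<Rightarrow> (real ^ 'd::_) \<times> (real ^ 'd::_)) {1..2 * ?d}"
  proof (rule inj_onI)
    fix i j assume ij: "i \<in> {1..2 * ?d}" "j \<in> {1..2 * ?d}" "phase_basis i = (phase_basis j :: (real ^ 'd::_) \<times> (real ^ 'd::_))"
    show "i = j"
    proof (cases "i \<le> ?d"; cases "j \<le> ?d")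
      assume A: "i \<le> ?d" "j \<le> ?d"
      hence "nth_index i = (nth_index j :: 'd)" using ij(3) by (simp add: phase_basis_def axis_eq_axis)
      moreover have "i \<in> {1..?d}" "j \<in> {1..?d}" using A ij(1,2) by auto
      ultimately show ?thesis using neq by blast
    next
      assume A: "\<not> i \<le> ?d" "\<not> j \<le> ?d"
      hence "nth_index (i - ?d) = (nth_index (j - ?d) :: 'd)" using ij(3) by (simp add: phase_basis_def axis_eq_axis)
      moreover have "i - ?d \<in> {1..?d}" "j - ?d \<in> {1..?d}" using A ij(1,2) by auto
      ultimately have "i - ?d = j - ?d" using neq by blast
      thus ?thesis using A by simp
    qed (use ij(3) in \<open>auto simp: phase_basis_def axis_eq_0_iff\<close>)
  qed
  have sub: "phase_basis ` {1..2 * ?d} \<subseteq> (Basis :: ((real ^ 'd::_) \<times> (real ^ 'd::_)) set)"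
    by (auto simp: phase_basis_def Basis_prod_def Basis_vec_def)
  have "card (phase_basis ` {1..2 * ?d} :: ((real ^ 'd::_) \<times> (real ^ 'd::_)) set) = card (Basis :: ((real ^ 'd::_) \<times> (real ^ 'd::_)) set)"
    using card_image[OF injp] by simp
  with sub have "phase_basis ` {1..2 * ?d} = (Basis :: ((real ^ 'd::_) \<times> (real ^ 'd::_)) set)"
    by (intro card_subset_eq) auto
  with injp show ?thesis by (simp add: bij_betw_def)
qed

lemma common_lower_exponent:
  assumes "finite J" "\<And>j. j \<in> J \<Longrightarrow> (0::ennreal) < p j"
  obtains r where "0 < r" "r \<le> 1" "\<And>j. j \<in> J \<Longrightarrow> ennreal r \<le> p j"
proof -
  have "\<exists>r. 0 < r \<and> r \<le> 1 \<and> (\<forall>j\<in>J. ennreal r \<le> p j)"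
    using assms
  proof (induct J rule: finite_induct)
    case empty
    show ?case by (intro exI[of _ 1]) simp
  next
    case (insert j J)
    then obtain r where r: "0 < r" "r \<le> 1" "\<forall>j\<in>J. ennreal r \<le> p j" by auto
    have "\<exists>q>0. ennreal q \<le> p j"
    proof (cases "p j")
      case (real x)
      thus ?thesis using insert(4)[of j] by (intro exI[of _ x]) auto
    qed (auto intro: exI[of _ 1])
    then obtain q where q: "q > 0" "ennreal q \<le> p j" by blast
    have "ennreal (min r q) \<le> ennreal r" "ennreal (min r q) \<le> ennreal q" by (auto intro: ennreal_leI)
    hence "\<forall>i\<in>insert j J. ennreal (min r q) \<le> p i" using r(3) q(2) order_trans by blast
    thus ?case using r q by (intro exI[of _ "min r q"]) auto
  qed
  thus ?thesis using that by blast
qed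

text \<open>The weighted form of the sub-averaging inequality: the growth of the weight is absorbed into
  half of the Gaussian.\<close>

lemma (in window) weighted_subaveraging:
  assumes g0: "g \<noteq> (\<lambda>_. 0)" and r: "0 < r" "r \<le> 1"
    and \<omega>: "\<And>X. 0 < \<omega> X" "\<And>X Z. \<omega> X \<le> exp (a * norm (X - Z)) * \<omega> Z" "a \<ge> 0"
  obtains A \<gamma> where "A > 0" "\<gamma> > 0" "\<And>u X. u \<in> gs_S_dual (1/2) \<Longrightarrow>
    ennreal ((cmod (u (tf_shift g X)) * \<omega> X) powr r)
      \<le> (\<integral>\<^sup>+ Z. ennreal (A * gauss \<gamma> (X - Z) * (cmod (u (tf_shift g Z)) * \<omega> Z) powr r) \<partial>lborel)"
proof -
  obtain A \<gamma> where A: "A > 0" "\<gamma> > 0" "\<And>u X. u \<in> gs_S_dual (1/2) \<Longrightarrow>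
    ennreal (cmod (u (tf_shift g X)) powr r)
      \<le> (\<integral>\<^sup>+ Z. ennreal (A * gauss \<gamma> (X - Z) * cmod (u (tf_shift g Z)) powr r) \<partial>lborel)"
    using subaveraging_inequality[OF g0 r] by blast
  define B where "B = A * exp ((a * r)\<^sup>2 / (2 * \<gamma>))"
  have "ennreal ((cmod (u (tf_shift g X)) * \<omega> X) powr r)
      \<le> (\<integral>\<^sup>+ Z. ennreal (B * gauss (\<gamma> / 2) (X - Z) * (cmod (u (tf_shift g Z)) * \<omega> Z) powr r) \<partial>lborel)"
    if u: "u \<in> gs_S_dual (1/2)" for u X
  proof -
    let ?V = "\<lambda>X. cmod (u (tf_shift g X))"
    have [measurable]: "?V \<in> borel_measurable borel"
      using borel_measurable_continuous_onI[OF continuous_functional_tf_shift[OF u]] by simp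
    have "ennreal ((?V X * \<omega> X) powr r) = ennreal (\<omega> X powr r) * ennreal (?V X powr r)"
      using \<omega>(1)[of X] by (simp add: powr_mult ennreal_mult'[symmetric] mult.commute)
    also have "\<dots> \<le> ennreal (\<omega> X powr r) * (\<integral>\<^sup>+ Z. ennreal (A * gauss \<gamma> (X - Z) * ?V Z powr r) \<partial>lborel)"
      by (intro mult_left_mono A(3)[OF u]) auto
    also have "\<dots> = (\<integral>\<^sup>+ Z. ennreal (\<omega> X powr r) * ennreal (A * gauss \<gamma> (X - Z) * ?V Z powr r) \<partial>lborel)"
      by (rule nn_integral_cmult[symmetric]) measurable
    also have "\<dots> \<le> (\<integral>\<^sup>+ Z. ennreal (B * gauss (\<gamma> / 2) (X - Z) * (?V Z * \<omega> Z) powr r) \<partial>lborel)"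
    proof (rule nn_integral_mono)
      fix Z
      let ?t = "norm (X - Z)"
      have "0 \<le> (\<gamma> * ?t - a * r)\<^sup>2 / (2 * \<gamma>)" using A(2) by simp
      also have "\<dots> = (a * r)\<^sup>2 / (2 * \<gamma>) + (\<gamma> / 2) * ?t\<^sup>2 - a * r * ?t"
        using A(2) by (simp add: power2_eq_square field_simps)
      finally have "r * (a * ?t) + - \<gamma> * ?t\<^sup>2 \<le> (a * r)\<^sup>2 / (2 * \<gamma>) + - (\<gamma> / 2) * ?t\<^sup>2" by (simp add: mult_ac)
      hence ex: "exp (r * (a * ?t)) * exp (- \<gamma> * ?t\<^sup>2) \<le> exp ((a * r)\<^sup>2 / (2 * \<gamma>)) * exp (- (\<gamma> / 2) * ?t\<^sup>2)"
        unfolding exp_add[symmetric] by (simp only: exp_le_cancel_iff)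
      have "\<omega> X powr r \<le> (exp (a * ?t) * \<omega> Z) powr r"
        using \<omega>(1)[of X] \<omega>(2)[of X Z] r by (intro powr_mono2) (auto intro: less_imp_le)
      also have "\<dots> = exp (r * (a * ?t)) * \<omega> Z powr r" using \<omega>(1)[of Z] by (simp add: powr_mult exp_powr_real mult.commute)
      finally have "\<omega> X powr r * (A * exp (- \<gamma> * ?t\<^sup>2) * ?V Z powr r) \<le> (exp (r * (a * ?t)) * \<omega> Z powr r) * (A * exp (- \<gamma> * ?t\<^sup>2) * ?V Z powr r)"
        using A(1) by (intro mult_right_mono) auto
      also have "\<dots> = (A * (?V Z powr r * \<omega> Z powr r)) * (exp (r * (a * ?t)) * exp (- \<gamma> * ?t\<^sup>2))" by (simp only: mult_ac)
      also have "\<dots> \<le> (A * (?V Z powr r * \<omega> Z powr r)) * (exp ((a * r)\<^sup>2 / (2 * \<gamma>)) * exp (- (\<gamma> / 2) * ?t\<^sup>2))"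
        using A(1) by (intro mult_left_mono ex) auto
      also have "\<dots> = B * exp (- (\<gamma> / 2) * ?t\<^sup>2) * (?V Z * \<omega> Z) powr r"
        using \<omega>(1)[of Z] by (simp add: B_def powr_mult mult_ac)
      finally show "ennreal (\<omega> X powr r) * ennreal (A * exp (- \<gamma> * ?t\<^sup>2) * ?V Z powr r) \<le> ennreal (B * exp (- (\<gamma> / 2) * ?t\<^sup>2) * (?V Z * \<omega> Z) powr r)"
        using A(1) by (simp add: ennreal_mult'[symmetric] ennreal_leI)
    qed
    finally show ?thesis .
  qed
  thus ?thesis using that[of B "\<gamma> / 2"] A(1,2) by (simp add: B_def)
qed

text \<open>The \<open>r\<close>-th power of the weighted transform is dominated by its Gaussian convolution, to which the
  estimate for iterated norms applies. The weights are compared through the regularization of \<open>\<omega>\<^sub>1\<close>.\<close>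

theorem mixed_qnorm_stft_le:
  fixes \<phi> :: "real ^ 'd::{finite,linorder} \<Rightarrow> complex"
    and p1 p2 :: "nat \<Rightarrow> ennreal"
    and \<omega>1 \<omega>2 :: "(real ^ 'd::_) \<times> (real ^ 'd::_) \<Rightarrow> real"
  assumes \<phi>: "\<phi> \<in> gs_S (1/2)" "\<phi> \<noteq> (\<lambda>_. 0)"
    and \<sigma>: "\<sigma> permutes {1..2 * CARD('d)}"
    and p1: "\<forall>j\<in>{1..2 * CARD('d)}. 0 < p1 j"
    and p12: "\<forall>j\<in>{1..2 * CARD('d)}. p1 j \<le> p2 j"
    and \<omega>1: "\<omega>1 \<in> moderate_weights" and \<omega>2: "\<And>X. 0 \<le> \<omega>2 X" and \<omega>12: "c > 0" "\<And>X. \<omega>2 X \<le> c * \<omega>1 X"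
  obtains C where "C > 0" "\<And>u. u \<in> gs_S_dual (1/2) \<Longrightarrow>
    mixed_qnorm \<sigma> p2 \<omega>2 (stft \<phi> u) \<le> ennreal C * mixed_qnorm \<sigma> p1 \<omega>1 (stft \<phi> u)"
proof -
  define n where "n = 2 * CARD('d)"
  define js where "js = [1..<Suc n]"
  have js: "set js = {1..n}" "distinct js" "length js = n" by (auto simp: js_def)
  define e where "e = (\<lambda>k. phase_basis (\<sigma> k) :: (real ^ 'd::_) \<times> (real ^ 'd::_))"
  have bij: "bij_betw e (set js) Basis"
    using bij_betw_trans[OF permutes_imp_bij[OF \<sigma>] phase_basis_bij] by (simp add: e_def js n_def o_def)
  define m where "m = (\<lambda>y. \<Sum>k\<in>set js. y k *\<^sub>R e k)"
  have m[measurable]: "m \<in> borel_measurable coord_space" unfolding m_def by measurable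
  have mixed: "mixed_qnorm \<sigma> p \<omega> F = iter_qnorm p n (\<lambda>y. ennreal (cmod (F (m y) * complex_of_real (\<omega> (m y))))) (\<lambda>_. 0)" for p \<omega> F
    by (simp add: mixed_qnorm_def m_def e_def js n_def Let_def)
  obtain r where r: "0 < r" "r \<le> 1" "\<And>j. j \<in> {1..n} \<Longrightarrow> ennreal r \<le> p1 j"
    using common_lower_exponent[of "{1..n}" p1] p1 by (auto simp: n_def)
  have p1pos: "0 < p1 j" and p2pos: "0 < p2 j" if "j \<in> {1..n}" for j
    using p1 p12 that less_le_trans unfolding n_def by blast+
  have q1: "1 \<le> p1 j / ennreal r" if "j \<in> {1..n}" for j
  proof -
    have "1 = ennreal r / ennreal r" using r by (simp add: ennreal_divide_self)
    also have "\<dots> \<le> p1 j / ennreal r" using r(3)[OF that] by (rule divide_right_mono_ennreal)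
    finally show ?thesis .
  qed
  have q12: "p1 j / ennreal r \<le> p2 j / ennreal r" if "j \<in> {1..n}" for j
    using p12 that by (intro divide_right_mono_ennreal) (auto simp: n_def)
  have qpos: "0 < p2 j / ennreal r" if "j \<in> {1..n}" for j
    by (rule less_le_trans[OF zero_less_one order_trans[OF q1[OF that] q12[OF that]]])
  obtain \<omega> c1 a where \<omega>: "c1 > 0" "a \<ge> 0" "continuous_on UNIV \<omega>" "\<And>X. 0 < \<omega> X" "\<And>X. \<omega>1 X \<le> \<omega> X" "\<And>X. \<omega> X \<le> c1 * \<omega>1 X"
    "\<And>X Z. \<omega> X \<le> exp (a * norm (X - Z)) * \<omega> Z"
    by (rule moderate_weight_regularization[OF \<omega>1]) (rule that, assumption+)
  obtain K h b where w: "window \<phi> K h b" by (rule gs_S_imp_window[OF \<phi>(1)])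
  have win: "window (\<lambda>y. cnj (\<phi> y)) K h b"
    by (rule window.intro[OF deriv_bound_cnj[OF window.bound_g[OF w]] window.pos[OF w]])
  interpret window "\<lambda>y. cnj (\<phi> y)" K h b by (rule win)
  let ?g = "\<lambda>y. cnj (\<phi> y)"
  have g0: "?g \<noteq> (\<lambda>_. 0)" using \<phi>(2) by (auto simp: fun_eq_iff)
  obtain A \<gamma> where A: "A > 0" "\<gamma> > 0" "\<And>u X. u \<in> gs_S_dual (1/2) \<Longrightarrow>
    ennreal ((cmod (u (tf_shift ?g X)) * \<omega> X) powr r)
      \<le> (\<integral>\<^sup>+ Z. ennreal (A * gauss \<gamma> (X - Z) * (cmod (u (tf_shift ?g Z)) * \<omega> Z) powr r) \<partial>lborel)"
    by (rule weighted_subaveraging[OF g0 r(1,2) \<omega>(4,7,2)]) (rule that, assumption+)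
  define k where "k = min 1 (sqrt (\<gamma> / pi))"
  have k: "k > 0" using A(2) by (simp add: k_def)
  interpret conv_kernel "gauss_kernel \<gamma>" by (rule conv_kernel_gauss[OF A(2)])
  \<comment> \<open>The kernels in the \<open>n\<close> coordinates are normalized by \<open>k\<close> each.\<close>
  define B where "B = A / k ^ n"
  have B: "B > 0" using A k by (simp add: B_def)
  define c0 where "c0 = fourier_const TYPE('d)"
  have c0: "c0 > 0" by (simp add: c0_def fourier_const_def)
  define C where "C = c0 * c * (B powr (1 / r)) * (c1 / c0)"
  have "mixed_qnorm \<sigma> p2 \<omega>2 (stft \<phi> u) \<le> ennreal C * mixed_qnorm \<sigma> p1 \<omega>1 (stft \<phi> u)"
    if u: "u \<in> gs_S_dual (1/2)" for u
  proof -
    define V where "V = (\<lambda>X. cmod (u (tf_shift ?g X)))"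
    have V0: "V X \<ge> 0" for X by (simp add: V_def)
    have Vm[measurable]: "V \<in> borel_measurable borel" unfolding V_def
      using borel_measurable_continuous_onI[OF continuous_functional_tf_shift[OF u]] by simp
    have \<omega>m[measurable]: "\<omega> \<in> borel_measurable borel" using \<omega>(3) by (rule borel_measurable_continuous_onI)
    have stft: "cmod (stft \<phi> u X * complex_of_real w) = c0 * V X * \<bar>w\<bar>" for X w
      using c0 by (simp add: stft_eq[OF \<phi> u win] norm_mult V_def c0_def)
    define F where "F = (\<lambda>y. ennreal (V (m y) * \<omega> (m y)))"
    have Fm: "F \<in> borel_measurable coord_space" unfolding F_def by measurable
    define G where "G = (\<lambda>y. epow (F y) r)"
    have Gm: "G \<in> borel_measurable coord_space" unfolding G_def using Fm by measurable
    have G: "G y = ennreal ((V (m y) * \<omega> (m y)) powr r)" for y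
      unfolding G_def F_def using V0[of "m y"] \<omega>(4)[of "m y"] by (intro epow_ennreal) simp
    let ?H = "\<lambda>Z. ennreal ((V Z * \<omega> Z) powr r)"
    have G_le: "G y \<le> ennreal B * convs js G y" for y
    proof -
      have "G y \<le> (\<integral>\<^sup>+ Z. ennreal (A * gauss \<gamma> (m y - Z) * (V Z * \<omega> Z) powr r) \<partial>lborel)"
        unfolding G V_def by (rule A(3)[OF u])
      also have "\<dots> = (\<integral>\<^sup>+ Z. ennreal B * (ennreal (k ^ length js * gauss \<gamma> (m y - Z)) * ?H Z) \<partial>lborel)"
      proof (rule nn_integral_cong)
        fix Z
        have eq: "A * gauss \<gamma> (m y - Z) * (V Z * \<omega> Z) powr r = B * ((k ^ length js * gauss \<gamma> (m y - Z)) * (V Z * \<omega> Z) powr r)"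
          using k by (simp add: B_def js)
        have split: "ennreal (B * (x * v)) = ennreal B * (ennreal x * ennreal v)" if "0 \<le> x" for x v
          using B that by (simp add: ennreal_mult')
        show "ennreal (A * gauss \<gamma> (m y - Z) * (V Z * \<omega> Z) powr r) = ennreal B * (ennreal (k ^ length js * gauss \<gamma> (m y - Z)) * ?H Z)"
          unfolding eq by (rule split) (use k in simp)
      qed
      also have "\<dots> = ennreal B * (\<integral>\<^sup>+ Z. ennreal (k ^ length js * gauss \<gamma> (m y - Z)) * ?H Z \<partial>lborel)"
        by (rule nn_integral_cmult) measurable
      also have "(\<integral>\<^sup>+ Z. ennreal (k ^ length js * gauss \<gamma> (m y - Z)) * ?H Z \<partial>lborel) = convs js (\<lambda>z. ?H (m z)) y"
        unfolding k_def m_def by (rule gaussian_convolution_eq_convs[OF _ js(2) bij A(2)]) measurable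
      also have "(\<lambda>z. ?H (m z)) = G" by (rule ext) (simp add: G)
      finally show ?thesis .
    qed
    let ?q1 = "\<lambda>j. p1 j / ennreal r" and ?q2 = "\<lambda>j. p2 j / ennreal r" and ?o = "\<lambda>_ :: nat. 0 :: real"
    have "iter_qnorm ?q2 n G ?o \<le> iter_qnorm ?q2 n (\<lambda>y. ennreal B * convs js G y) ?o"
      by (rule iter_qnorm_mono[OF qpos G_le])
    also have "\<dots> \<le> ennreal B * iter_qnorm ?q2 n (convs js G) ?o"
      by (rule iter_qnorm_cmult[OF convs_measurable[OF Gm] qpos])
    also have "\<dots> \<le> ennreal B * iter_qnorm ?q1 n G ?o"
    proof -
      have "iter_qnorm ?q2 n (convs [1..<Suc n] G) ?o \<le> convs [Suc n..<Suc n] (iter_qnorm ?q1 n G) ?o"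
        by (rule iter_qnorm_convs_le[OF Gm q1 q12 order_refl])
      moreover have "[Suc n..<Suc n] = []" by simp
      ultimately have "iter_qnorm ?q2 n (convs js G) ?o \<le> iter_qnorm ?q1 n G ?o"
        unfolding js_def by (simp only: foldr.simps id_apply)
      thus ?thesis by (rule mult_left_mono) simp
    qed
    finally have "epow (iter_qnorm ?q2 n G ?o) (1 / r) \<le> epow (ennreal B * iter_qnorm ?q1 n G ?o) (1 / r)"
      using r by (intro epow_mono) auto
    also have "\<dots> = ennreal (B powr (1 / r)) * epow (iter_qnorm ?q1 n G ?o) (1 / r)"
      using r B by (simp add: epow_mult epow_ennreal)
    finally have "epow (iter_qnorm ?q2 n G ?o) (1 / r) \<le> ennreal (B powr (1 / r)) * epow (iter_qnorm ?q1 n G ?o) (1 / r)" .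
    moreover have "iter_qnorm p2 n F ?o = epow (iter_qnorm ?q2 n G ?o) (1 / r)" unfolding G_def by (rule iter_qnorm_epow[OF r(1) p2pos])
    moreover have "iter_qnorm p1 n F ?o = epow (iter_qnorm ?q1 n G ?o) (1 / r)" unfolding G_def by (rule iter_qnorm_epow[OF r(1) p1pos])
    ultimately have main: "iter_qnorm p2 n F ?o \<le> ennreal (B powr (1 / r)) * iter_qnorm p1 n F ?o" by simp
    have "mixed_qnorm \<sigma> p2 \<omega>2 (stft \<phi> u) \<le> iter_qnorm p2 n (\<lambda>y. ennreal (c0 * c) * F y) ?o"
      unfolding mixed stft
    proof (rule iter_qnorm_mono[OF p2pos])
      fix y
      have "\<bar>\<omega>2 (m y)\<bar> \<le> c * \<omega> (m y)"
      proof -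
        have "c * \<omega>1 (m y) \<le> c * \<omega> (m y)" using \<omega>12(1) \<omega>(5) by (intro mult_left_mono) auto
        thus ?thesis using \<omega>2[of "m y"] \<omega>12(2)[of "m y"] by linarith
      qed
      hence "c0 * V (m y) * \<bar>\<omega>2 (m y)\<bar> \<le> c0 * V (m y) * (c * \<omega> (m y))"
        using c0 V0 by (intro mult_left_mono) auto
      thus "ennreal (c0 * V (m y) * \<bar>\<omega>2 (m y)\<bar>) \<le> ennreal (c0 * c) * F y"
        using c0 \<omega>12(1) unfolding F_def by (simp add: ennreal_mult'[symmetric] ennreal_leI mult_ac)
    qed
    also have "\<dots> \<le> ennreal (c0 * c) * iter_qnorm p2 n F ?o" by (rule iter_qnorm_cmult[OF Fm p2pos])
    also have "\<dots> \<le> ennreal (c0 * c) * (ennreal (B powr (1 / r)) * iter_qnorm p1 n F ?o)" by (intro mult_left_mono main) auto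
    finally have upper: "mixed_qnorm \<sigma> p2 \<omega>2 (stft \<phi> u)
        \<le> ennreal (c0 * c) * (ennreal (B powr (1 / r)) * iter_qnorm p1 n F ?o)" .
    have lower: "iter_qnorm p1 n F ?o \<le> ennreal (c1 / c0) * mixed_qnorm \<sigma> p1 \<omega>1 (stft \<phi> u)"
    proof -
      let ?F = "\<lambda>y. ennreal (c0 / c1) * F y"
      have "F y = ennreal (c1 / c0) * ?F y" for y
        using c0 \<omega>(1) by (simp add: mult.assoc[symmetric] ennreal_mult'[symmetric])
      hence "iter_qnorm p1 n F ?o = iter_qnorm p1 n (\<lambda>y. ennreal (c1 / c0) * ?F y) ?o" by presburger
      also have "\<dots> \<le> ennreal (c1 / c0) * iter_qnorm p1 n ?F ?o"
        by (rule iter_qnorm_cmult[OF _ p1pos]) (use Fm in measurable)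
      also have "\<dots> \<le> ennreal (c1 / c0) * mixed_qnorm \<sigma> p1 \<omega>1 (stft \<phi> u)"
        unfolding mixed stft
      proof (intro mult_left_mono iter_qnorm_mono[OF p1pos])
        fix y
        have "\<omega> (m y) / c1 \<le> \<bar>\<omega>1 (m y)\<bar>"
        proof -
          have "\<omega> (m y) / c1 \<le> \<omega>1 (m y)" using \<omega>(6)[of "m y"] \<omega>(1) by (simp add: pos_divide_le_eq mult.commute)
          thus ?thesis by linarith
        qed
        hence "c0 * V (m y) * (\<omega> (m y) / c1) \<le> c0 * V (m y) * \<bar>\<omega>1 (m y)\<bar>"
          using c0 V0 by (intro mult_left_mono) auto
        thus "ennreal (c0 / c1) * F y \<le> ennreal (c0 * V (m y) * \<bar>\<omega>1 (m y)\<bar>)"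
          using c0 \<omega>(1) unfolding F_def by (simp add: ennreal_mult'[symmetric] ennreal_leI mult_ac)
      qed auto
      finally show ?thesis .
    qed
    have "mixed_qnorm \<sigma> p2 \<omega>2 (stft \<phi> u)
        \<le> ennreal (c0 * c) * (ennreal (B powr (1 / r)) * (ennreal (c1 / c0) * mixed_qnorm \<sigma> p1 \<omega>1 (stft \<phi> u)))"
      by (rule order_trans[OF upper]) (intro mult_left_mono lower, simp_all)
    also have "\<dots> = (ennreal (c0 * c) * ennreal (B powr (1 / r)) * ennreal (c1 / c0)) * mixed_qnorm \<sigma> p1 \<omega>1 (stft \<phi> u)"
      by (simp only: mult.assoc)
    also have "ennreal (c0 * c) * ennreal (B powr (1 / r)) * ennreal (c1 / c0) = ennreal C"
      unfolding C_def using c0 \<omega>12(1) by (simp only: ennreal_mult'[symmetric] ennreal_mult''[symmetric] less_imp_le mult_nonneg_nonneg powr_ge_zero)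
    finally show ?thesis .
  qed
  moreover have "C > 0" using c0 \<omega>12(1) \<omega>(1) B by (simp add: C_def)
  ultimately show ?thesis using that by blast
qed

theorem proposition4p5:
  fixes \<phi> :: "real ^ 'd::{finite,linorder} \<Rightarrow> complex"
    and \<sigma> :: "nat \<Rightarrow> nat"
    and p1 p2 :: "nat \<Rightarrow> ennreal"
    and \<omega>1 \<omega>2 :: "(real ^ 'd::_) \<times> (real ^ 'd::_) \<Rightarrow> real"
  assumes "\<phi> \<in> gs_S (1/2)" and "\<phi> \<noteq> (\<lambda>_. 0)"
    and "\<sigma> permutes {1..2 * CARD('d)}"
    and "\<forall>j\<in>{1..2 * CARD('d)}. 0 < p1 j"
    and "\<forall>j\<in>{1..2 * CARD('d)}. 0 < p2 j"
    and "\<omega>1 \<in> moderate_weights" and "\<omega>2 \<in> moderate_weights"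
    and "\<forall>j\<in>{1..2 * CARD('d)}. p1 j \<le> p2 j"
    and "\<exists>c>0. \<forall>X. \<omega>2 X \<le> c * \<omega>1 X"
  shows "modulation_space \<phi> \<sigma> p1 \<omega>1 \<subseteq> modulation_space \<phi> \<sigma> p2 \<omega>2 \<and>
    (\<exists>C>0. \<forall>f\<in>gs_Sigma_dual 1.
       modulation_qnorm \<phi> \<sigma> p2 \<omega>2 (to_gs_S_dual f)
         \<le> ennreal C * modulation_qnorm \<phi> \<sigma> p1 \<omega>1 (to_gs_S_dual f))"
proof -
  obtain c where c: "c > 0" "\<And>X. \<omega>2 X \<le> c * \<omega>1 X" using assms(9) by blast
  have \<omega>2: "0 \<le> \<omega>2 X" for X using assms(7) unfolding moderate_weights_def weight_def using less_imp_le by blast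
  obtain C where C: "C > 0" "\<And>u. u \<in> gs_S_dual (1/2) \<Longrightarrow>
    mixed_qnorm \<sigma> p2 \<omega>2 (stft \<phi> u) \<le> ennreal C * mixed_qnorm \<sigma> p1 \<omega>1 (stft \<phi> u)"
    using mixed_qnorm_stft_le[OF assms(1-4,8,6) \<omega>2 c] by blast
  have sub: "modulation_space \<phi> \<sigma> p1 \<omega>1 \<subseteq> modulation_space \<phi> \<sigma> p2 \<omega>2"
  proof
    fix u assume u: "u \<in> modulation_space \<phi> \<sigma> p1 \<omega>1"
    hence "u \<in> gs_S_dual (1/2)" "mixed_qnorm \<sigma> p1 \<omega>1 (stft \<phi> u) < \<infinity>" by (auto simp: modulation_space_def)
    moreover from this(2) have "ennreal C * mixed_qnorm \<sigma> p1 \<omega>1 (stft \<phi> u) < \<infinity>" by (simp add: ennreal_mult_less_top)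
    ultimately show "u \<in> modulation_space \<phi> \<sigma> p2 \<omega>2"
      using le_less_trans[OF C(2)] by (simp add: modulation_space_def)
  qed
  have "modulation_qnorm \<phi> \<sigma> p2 \<omega>2 v \<le> ennreal C * modulation_qnorm \<phi> \<sigma> p1 \<omega>1 v" for v
  proof (cases "v \<in> modulation_space \<phi> \<sigma> p1 \<omega>1")
    case True
    hence "v \<in> gs_S_dual (1/2)" by (simp add: modulation_space_def)
    thus ?thesis using True sub C(2) by (auto simp: modulation_qnorm_def)
  next
    case False
    thus ?thesis using C(1) by (simp add: modulation_qnorm_def ennreal_mult_top)
  qed
  with sub C(1) show ?thesis by blast
qed

end
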